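(* Let $(M,g)$ be a connected homogeneous Riemannian manifold with $\lambda_g(M)=\infty$, let $\delta,t>0$, and let $G$ be the random graph of the threshold model on $(M,g)$ with density $\delta$ and threshold $t$, with vertices the atoms of the Poisson process $\nu$. Let $E_1,E_2,\dots$ be Borel subsets of $M$ with $\lambda_g(E_n)<\infty$ for all $n$ and $E_n\uparrow M$. For $k\in\{0,1,2,\dots\}$ write $$\widehat p_n(k):=\frac{1}{\nu(E_n)}\sum_{x\in v(G)\cap E_n}\mathbf{1}\{\deg(x)=k\}$$ on the event $\{\nu(E_n)>0\}$, and set $\widehat p_n(k):=0$ otherwise. Then $$\widehat p_n(k)\;\overset{\mathbb{P}}{\longrightarrow}\; e^{-\delta V_t}\frac{(\delta V_t)^k}{k!}\qquad(n\to\infty).$$ If $\sum_{n=1}^\infty\frac{1}{\lambda_g(E_n)}<\infty$, then this convergence holds almost surely.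
   Context: $d_g$ and $\lambda_g$ are the Riemannian distance and Riemannian volume measure. $(M,g)$ is homogeneous if its isometry group acts transitively (this implies geodesic completeness). $V_t:=\lambda_g(B_t(x_0))$ is the volume of the closed ball of radius $t$, which does not depend on the centre $x_0\in M$. $E_n\uparrow M$ means $E_1\subseteq E_2\subseteq\cdots$ and $\bigcup_n E_n=M$. The threshold model with density $\delta$ and threshold $t$: the vertex set $v(G)$ is the set of atoms of a Poisson process $\nu$ on $M$ with intensity measure $\delta\lambda_g$, and $e(G)$ consists of all $\{x,y\}$ with $x,y\in v(G)$, $x\ne y$ and $d_g(x,y)\le t$. The degree is $\deg(x)=\#\{y\in v(G)\mid\{x,y\}\in e(G)\}$, computed in the whole graph $G$. *)

theory Defs
  imports "HOL-Probability.Probability"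
begin

section \<open>Smooth manifolds\<close>

text \<open>
  A manifold is a whole type \<open>'m\<close>, with Hausdorff and second countable topology supplied by the
  type classes, together with a smooth atlas.  The dimension is \<open>CARD('n)\<close>, hence positive.
  A chart is a pair \<open>(U, \<phi>)\<close>; the values of \<open>\<phi>\<close> outside \<open>U\<close> are irrelevant.
\<close>

type_synonym ('m, 'n) chart = "'m set \<times> ('m \<Rightarrow> real ^ 'n)"

primrec Ck_on :: "nat \<Rightarrow> 'a::euclidean_space set \<Rightarrow> ('a \<Rightarrow> 'b::euclidean_space) \<Rightarrow> bool" where
  "Ck_on 0 S f \<longleftrightarrow> continuous_on S f"
| "Ck_on (Suc k) S f \<longleftrightarrow>
     (\<forall>x\<in>S. f differentiable (at x)) \<and> (\<forall>v. Ck_on k S (\<lambda>x. frechet_derivative f (at x) v))"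

text \<open>This is only meant for open \<open>S\<close>, since derivatives are taken with respect to \<^term>\<open>at x\<close>.\<close>

definition smooth_on :: "'a::euclidean_space set \<Rightarrow> ('a \<Rightarrow> 'b::euclidean_space) \<Rightarrow> bool" where
  "smooth_on S f \<longleftrightarrow> (\<forall>k. Ck_on k S f)"

definition chart_inv :: "('m, 'n::finite) chart \<Rightarrow> real ^ 'n \<Rightarrow> 'm" where
  "chart_inv c = inv_into (fst c) (snd c)"

definition is_chart :: "('m::topological_space, 'n::finite) chart \<Rightarrow> bool" where
  "is_chart c \<longleftrightarrow> open (fst c) \<and> open (snd c ` fst c) \<and>
     homeomorphism (fst c) (snd c ` fst c) (snd c) (chart_inv c)"

definition loc_rep ::
    "('m, 'n::finite) chart \<Rightarrow> ('m, 'n) chart \<Rightarrow> ('m \<Rightarrow> 'm) \<Rightarrow> real ^ 'n \<Rightarrow> real ^ 'n" where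
  "loc_rep c d f = snd d \<circ> f \<circ> chart_inv c"

definition smooth_map ::
    "('m::topological_space, 'n::finite) chart set \<Rightarrow> ('m \<Rightarrow> 'm) \<Rightarrow> bool" where
  "smooth_map A f \<longleftrightarrow> continuous_on UNIV f \<and>
     (\<forall>c\<in>A. \<forall>d\<in>A. smooth_on (snd c ` (fst c \<inter> f -` fst d)) (loc_rep c d f))"

text \<open>For \<open>f = id\<close> the maps \<open>loc_rep c d f\<close> are the coordinate changes.\<close>

definition smooth_atlas :: "('m::topological_space, 'n::finite) chart set \<Rightarrow> bool" where
  "smooth_atlas A \<longleftrightarrow> (\<forall>c\<in>A. is_chart c) \<and> (\<Union>c\<in>A. fst c) = UNIV \<and> smooth_map A id"


section \<open>Riemannian metrics\<close>

text \<open>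
  A Riemannian metric is given by its components: \<open>g c p\<close> is the Gram matrix, with respect to
  the coordinate frame of the chart \<open>c\<close>, of the inner product on the tangent space at \<open>p\<close>
  (relevant only for \<open>p\<close> in the domain of \<open>c\<close>).  The pull-back law for a map \<open>f\<close> says that
  \<open>f\<close> preserves the inner products; for \<open>f = id\<close> it is the transformation law of a
  covariant 2-tensor field.
\<close>

type_synonym ('m, 'n) metric_field = "('m, 'n) chart \<Rightarrow> 'm \<Rightarrow> real ^ 'n ^ 'n"

definition jacobian ::
    "('m, 'n::finite) chart \<Rightarrow> ('m, 'n) chart \<Rightarrow> ('m \<Rightarrow> 'm) \<Rightarrow> 'm \<Rightarrow> real ^ 'n ^ 'n" where
  "jacobian c d f p = matrix (frechet_derivative (loc_rep c d f) (at (snd c p)))"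

definition preserves_metric ::
    "('m, 'n::finite) chart set \<Rightarrow> ('m, 'n) metric_field \<Rightarrow> ('m \<Rightarrow> 'm) \<Rightarrow> bool" where
  "preserves_metric A g f \<longleftrightarrow>
     (\<forall>c\<in>A. \<forall>d\<in>A. \<forall>p\<in>fst c. f p \<in> fst d \<longrightarrow>
        g c p = transpose (jacobian c d f p) ** g d (f p) ** jacobian c d f p)"

definition riemannian_metric ::
    "('m::topological_space, 'n::finite) chart set \<Rightarrow> ('m, 'n) metric_field \<Rightarrow> bool" where
  "riemannian_metric A g \<longleftrightarrow>
     (\<forall>c\<in>A. smooth_on (snd c ` fst c) (\<lambda>x. g c (chart_inv c x)) \<and>
        (\<forall>p\<in>fst c. transpose (g c p) = g c p \<and> (\<forall>v. v \<noteq> 0 \<longrightarrow> v \<bullet> (g c p *v v) > 0))) \<and>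
     preserves_metric A g id"

definition riemannian_isometry ::
    "('m::topological_space, 'n::finite) chart set \<Rightarrow> ('m, 'n) metric_field \<Rightarrow> ('m \<Rightarrow> 'm) \<Rightarrow> bool" where
  "riemannian_isometry A g f \<longleftrightarrow> bij f \<and> smooth_map A f \<and> smooth_map A (inv f) \<and> preserves_metric A g f"

definition homogeneous ::
    "('m::topological_space, 'n::finite) chart set \<Rightarrow> ('m, 'n) metric_field \<Rightarrow> bool" where
  "homogeneous A g \<longleftrightarrow> (\<forall>x y. \<exists>f. riemannian_isometry A g f \<and> f x = y)"


section \<open>Riemannian distance\<close>

definition C1_curve_on ::
    "('m::topological_space, 'n::finite) chart set \<Rightarrow> real set \<Rightarrow> (real \<Rightarrow> 'm) \<Rightarrow> bool" where
  "C1_curve_on A I \<gamma> \<longleftrightarrow> continuous_on I \<gamma> \<and>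
     (\<forall>c\<in>A. let T = {t\<in>I. \<gamma> t \<in> fst c} in
        \<exists>D. (\<forall>t\<in>T. (snd c \<circ> \<gamma> has_vector_derivative D t) (at t within T)) \<and> continuous_on T D)"

text \<open>
  Each piece is \<open>C\<^sup>1\<close> up to and including its end points, unlike with the library's
  \<^const>\<open>piecewise_C1_differentiable_on\<close>, which allows unbounded derivatives at the break points.
\<close>

definition pw_C1_curve ::
    "('m::topological_space, 'n::finite) chart set \<Rightarrow> (real \<Rightarrow> 'm) \<Rightarrow> bool" where
  "pw_C1_curve A \<gamma> \<longleftrightarrow> continuous_on {0..1} \<gamma> \<and>
     (\<exists>S. finite S \<and> (\<forall>a b. 0 \<le> a \<and> a < b \<and> b \<le> 1 \<and> {a<..<b} \<inter> S = {} \<longrightarrow>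
        C1_curve_on A {a..b} \<gamma>))"

text \<open>By the transformation law the speed does not depend on the chart, except possibly at the
  finitely many break points.\<close>

definition speed ::
    "('m, 'n::finite) chart set \<Rightarrow> ('m, 'n) metric_field \<Rightarrow> (real \<Rightarrow> 'm) \<Rightarrow> real \<Rightarrow> real" where
  "speed A g \<gamma> t =
     (let c = (SOME c. c \<in> A \<and> \<gamma> t \<in> fst c);
          v = vector_derivative (snd c \<circ> \<gamma>) (at t within {0..1})
      in sqrt (v \<bullet> (g c (\<gamma> t) *v v)))"

definition curve_length ::
    "('m, 'n::finite) chart set \<Rightarrow> ('m, 'n) metric_field \<Rightarrow> (real \<Rightarrow> 'm) \<Rightarrow> real" where
  "curve_length A g \<gamma> = integral {0..1} (speed A g \<gamma>)"

definition rdist ::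
    "('m::topological_space, 'n::finite) chart set \<Rightarrow> ('m, 'n) metric_field \<Rightarrow> 'm \<Rightarrow> 'm \<Rightarrow> real" where
  "rdist A g x y = Inf {curve_length A g \<gamma> | \<gamma>. pw_C1_curve A \<gamma> \<and> \<gamma> 0 = x \<and> \<gamma> 1 = y}"

definition rcball ::
    "('m::topological_space, 'n::finite) chart set \<Rightarrow> ('m, 'n) metric_field \<Rightarrow> 'm \<Rightarrow> real \<Rightarrow> 'm set" where
  "rcball A g x t = {y. rdist A g x y \<le> t}"


section \<open>Riemannian volume measure\<close>

text \<open>The unique Borel measure with density \<open>sqrt (det g)\<close> in each chart.\<close>

definition rvol ::
    "('m::topological_space, 'n::finite) chart set \<Rightarrow> ('m, 'n) metric_field \<Rightarrow> 'm measure" where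
  "rvol A g = (THE \<mu>. sets \<mu> = sets borel \<and>
     (\<forall>c\<in>A. \<forall>B\<in>sets borel. B \<subseteq> fst c \<longrightarrow>
        emeasure \<mu> B = (\<integral>\<^sup>+x\<in>snd c ` B. ennreal (sqrt (det (g c (chart_inv c x)))) \<partial>lborel)))"


section \<open>Poisson processes\<close>

text \<open>Realisations of point processes: countable sums of finite integer-valued measures.\<close>

definition point_measure :: "'a measure \<Rightarrow> 'a measure \<Rightarrow> bool" where
  "point_measure N \<eta> \<longleftrightarrow> sets \<eta> = sets N \<and>
     (\<exists>\<kappa> :: nat \<Rightarrow> 'a measure.
        (\<forall>i. sets (\<kappa> i) = sets N \<and> (\<forall>B\<in>sets N. emeasure (\<kappa> i) B \<in> range of_nat)) \<and>
        (\<forall>B\<in>sets N. emeasure \<eta> B = (\<Sum>i. emeasure (\<kappa> i) B)))"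

definition poisson_process ::
    "'w measure \<Rightarrow> 'a measure \<Rightarrow> ('w \<Rightarrow> 'a measure) \<Rightarrow> bool" where
  "poisson_process P \<mu> \<nu> \<longleftrightarrow>
     (\<forall>\<omega>\<in>space P. point_measure \<mu> (\<nu> \<omega>)) \<and>
     (\<forall>B\<in>sets \<mu>. (\<lambda>\<omega>. emeasure (\<nu> \<omega>) B) \<in> borel_measurable P) \<and>
     (\<forall>B\<in>sets \<mu>. emeasure \<mu> B < \<infinity> \<longrightarrow>
        (\<forall>k::nat. measure P {\<omega>\<in>space P. emeasure (\<nu> \<omega>) B = of_nat k} =
           exp (- measure \<mu> B) * measure \<mu> B ^ k / fact k)) \<and>
     (\<forall>B\<in>sets \<mu>. emeasure \<mu> B = \<infinity> \<longrightarrow> (AE \<omega> in P. emeasure (\<nu> \<omega>) B = \<infinity>)) \<and>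
     (\<forall>(n::nat) B. (\<forall>i<n. B i \<in> sets \<mu>) \<and> disjoint_family_on B {..<n} \<longrightarrow>
        prob_space.indep_vars P (\<lambda>_. borel) (\<lambda>i \<omega>. emeasure (\<nu> \<omega>) (B i)) {..<n})"

definition atoms :: "'a measure \<Rightarrow> 'a set" where
  "atoms \<eta> = {x. emeasure \<eta> {x} > 0}"


section \<open>The threshold model\<close>

text \<open>The graph with vertex set \<open>V\<close> for a distance function \<open>d\<close> and a threshold \<open>t\<close>; a degree may
  be infinite.\<close>

definition threshold_edges :: "('a \<Rightarrow> 'a \<Rightarrow> real) \<Rightarrow> real \<Rightarrow> 'a set \<Rightarrow> 'a set set" where
  "threshold_edges d t V = {{x, y} | x y. x \<in> V \<and> y \<in> V \<and> x \<noteq> y \<and> d x y \<le> t}"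

definition vertex_degree :: "'a set \<Rightarrow> 'a set set \<Rightarrow> 'a \<Rightarrow> enat" where
  "vertex_degree V E x =
     (let N = {y\<in>V. {x, y} \<in> E} in if finite N then enat (card N) else \<infinity>)"

definition p_hat :: "('a \<Rightarrow> 'a \<Rightarrow> real) \<Rightarrow> real \<Rightarrow> 'a measure \<Rightarrow> 'a set \<Rightarrow> nat \<Rightarrow> real" where
  "p_hat d t \<eta> B k =
     (if emeasure \<eta> B > 0
      then 1 / measure \<eta> B *
        (\<Sum>x\<in>atoms \<eta> \<inter> B. of_bool (vertex_degree (atoms \<eta>) (threshold_edges d t (atoms \<eta>)) x = enat k))
      else 0)"


section \<open>Convergence in probability\<close>

definition tendsto_in_prob :: "'w measure \<Rightarrow> (nat \<Rightarrow> 'w \<Rightarrow> real) \<Rightarrow> ('w \<Rightarrow> real) \<Rightarrow> bool" where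
  "tendsto_in_prob P X Y \<longleftrightarrow>
     (\<forall>n. X n \<in> borel_measurable P) \<and> Y \<in> borel_measurable P \<and>
     (\<forall>\<epsilon>>0. (\<lambda>n. measure P {\<omega>\<in>space P. \<bar>X n \<omega> - Y \<omega>\<bar> > \<epsilon>}) \<longlonglongrightarrow> 0)"

text \<open>
  The definition of a point process leaves its realisations unrestricted on the null event that
  some compact set contains infinitely many points, so statistics such as \<^const>\<open>p_hat\<close> need only
  be measurable up to null sets; such random variables are considered on \<^term>\<open>completion P\<close>.
\<close>

end

theory Submission
  imports Defs
begin

text \<open>
  The degree of a vertex \<open>x\<close> is the number of other points of the process in the ball of radius
  \<open>t\<close> around \<open>x\<close>.  By homogeneity all these balls have the same volume \<open>V\<close>, so that each point of
  the process has degree \<open>k\<close> with the same probability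
  \<open>\<pi> = exp (- \<delta> * V) * (\<delta> * V) ^ k / fact k\<close>, and the number \<open>N\<close> of vertices of degree \<open>k\<close> in a set
  \<open>E\<close> has mean \<open>s * \<pi>\<close>, where \<open>s\<close> is the \<open>\<delta>\<close>-fold volume of \<open>E\<close>.  The degrees of two vertices at
  distance greater than \<open>2 * t\<close> depend on the process in disjoint balls and are uncorrelated; so the
  variance of \<open>N\<close> is at most a constant times \<open>s\<close>.  The number of points in \<open>E\<close> has mean and variance
  \<open>s\<close>.  Chebyshev's inequality, together with the Borel-Cantelli lemma for the almost sure statement,
  then shows that the quotient of the two numbers converges to \<open>\<pi>\<close>
  (\<open>ratio_law_of_large_numbers\<close>).

  The moments are computed without the Mecke formula, from a discretisation.  The space is
  partitioned into small cells; a cell with a vertex of degree \<open>k\<close> is approximated by the event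
  that the cell contains one point and a slightly enlarged ball around its centre contains \<open>k\<close> others
  (\<open>lone_point\<close>).  Such events involve counts in disjoint sets only, whose joint law is
  given by the definition of a Poisson process.  As the mesh tends to zero, the number of these
  events that occur is almost surely eventually equal to \<open>N\<close>
  (\<open>eventually_sum_lone_points_eq_degree_count\<close>), and Fatou's lemma yields the bound for the second
  moment (\<open>degree_count_L2\<close>).  This uses that the process almost surely is the counting
  measure of its atoms (\<open>AE_simple\<close>).

  The probabilistic part takes place in a metric space with a measure for which balls of equal
  radius have equal finite volume.  The geometric part verifies that a connected homogeneous
  manifold is such a space.  The volume measure is assembled from countably many charts, and the
  change of variables formula shows that it is well defined and invariant under isometries
  (\<open>chart_vol_image\<close>).  The distance is a metric that induces the topology of the manifold, by
  comparison with the Euclidean norm in coordinates (\<open>joins_near\<close>, \<open>small_ball_in_chart\<close>).  Small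
  balls lie in compact coordinate balls and have finite volume.  For large balls finiteness follows
  from homogeneity: finitely many balls of radius \<open>r/2\<close> cover a ball of a certain radius \<open>r\<close>, and hence,
  by induction on the radius, every ball (\<open>volume_gball_finite\<close>).
\<close>

section \<open>Poisson counts\<close>

lemma suminf_of_nat_ennreal_cases:
  fixes f :: "nat \<Rightarrow> ennreal"
  assumes "\<And>i. f i \<in> range of_nat"
  shows "(\<Sum>i. f i) = \<infinity> \<or> (\<Sum>i. f i) \<in> range of_nat"
proof (cases "finite {i. f i \<noteq> 0}")
  case True
  then have "(\<Sum>i. f i) = (\<Sum>i | f i \<noteq> 0. f i)"
    by (intro suminf_finite) auto
  moreover have "(\<Sum>i\<in>S. f i) \<in> range of_nat" if "finite S" for S
    using that
  proof induction
    case (insert x S)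
    then obtain a b where "f x = of_nat a" "(\<Sum>i\<in>S. f i) = of_nat b"
      using assms[of x] by auto
    then show ?case using insert by (auto intro!: range_eqI[of _ _ "a + b"])
  qed (auto intro: range_eqI[of _ _ 0])
  ultimately show ?thesis using True by simp
next
  case False
  have ge1: "1 \<le> f i" if "f i \<noteq> 0" for i
  proof -
    obtain n where "f i = of_nat n" using assms[of i] by auto
    with that have "n \<ge> 1" by (cases n) auto
    then show ?thesis using \<open>f i = of_nat n\<close> by (metis of_nat_1 of_nat_le_iff)
  qed
  have "of_nat n \<le> (\<Sum>i. f i)" for n
  proof -
    obtain S where S: "finite S" "card S = n" "S \<subseteq> {i. f i \<noteq> 0}"
      using infinite_arbitrarily_large[OF False] by blast
    have "of_nat n = (\<Sum>i\<in>S. (1::ennreal))" using S by simp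
    also have "\<dots> \<le> (\<Sum>i\<in>S. f i)" using S ge1 by (intro sum_mono) auto
    also have "\<dots> \<le> (\<Sum>i. f i)" using S by (intro sum_le_suminf) auto
    finally show ?thesis .
  qed
  then have "(\<Sum>i. f i) = \<infinity>"
    using ennreal_Ex_less_of_nat[of "\<Sum>i. f i"] by (metis infinity_ennreal_def leD less_top)
  then show ?thesis by simp
qed

lemma point_measure_nat_cases:
  assumes "point_measure N \<eta>" "B \<in> sets N"
  obtains "emeasure \<eta> B = \<infinity>" | n where "emeasure \<eta> B = of_nat n"
proof -
  from assms obtain \<kappa> :: "nat \<Rightarrow> 'a measure" where
    "\<forall>i. \<forall>B\<in>sets N. emeasure (\<kappa> i) B \<in> range of_nat"
    "emeasure \<eta> B = (\<Sum>i. emeasure (\<kappa> i) B)"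
    unfolding point_measure_def by blast
  with suminf_of_nat_ennreal_cases[of "\<lambda>i. emeasure (\<kappa> i) B"] assms that show thesis by auto
qed

text \<open>Estimates for a Poisson variable of mean \<open>m\<close>: the probability of at least one point, and of at
  least two points.  The second is quadratic in \<open>m\<close>, which makes multiple points disappear under
  refinement of a partition.\<close>

lemma poisson_count_ne_0_le:
  fixes m :: real
  assumes "m \<ge> 0"
  shows "1 - exp (- m) \<le> m"
  using exp_ge_add_one_self[of "-m"] by simp

lemma poisson_count_ge_2_le:
  fixes m :: real
  assumes "m \<ge> 0"
  shows "1 - exp (- m) - exp (- m) * m \<le> m\<^sup>2"
proof -
  have "(1 + m) * (1 - m) \<le> (1 + m) * exp (- m)"
    using exp_ge_add_one_self[of "-m"] assms by (intro mult_left_mono) auto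
  then show ?thesis by (simp add: algebra_simps power2_eq_square)
qed

lemma poisson_variance_sums:
  fixes m :: real
  shows "(\<lambda>k. (real k - m)\<^sup>2 * (exp (- m) * m ^ k / fact k)) sums m"
proof -
  have e: "(\<lambda>k. m ^ k / fact k) sums exp m"
    using exp_converges[of m] by (simp add: scaleR_conv_of_real divide_inverse mult.commute)
  have 1: "(\<lambda>k. real k * (m ^ k / fact k)) sums (m * exp m)"
  proof -
    have "real (Suc k) * (m ^ Suc k / fact (Suc k)) = m * (m ^ k / fact k)" for k
      by (simp add: divide_simps del: of_nat_Suc)
    then have "(\<lambda>k. real (Suc k) * (m ^ Suc k / fact (Suc k))) sums (m * exp m)"
      using sums_mult[OF e, of m] by presburger
    then show ?thesis
      using sums_Suc[of "\<lambda>k. real k * (m ^ k / fact k)"] by simp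
  qed
  have 2: "(\<lambda>k. real k * real k * (m ^ k / fact k)) sums (m * (m * exp m + exp m))"
  proof -
    have "real (Suc k) * real (Suc k) * (m ^ Suc k / fact (Suc k)) = m * (real k * (m ^ k / fact k) + m ^ k / fact k)" for k
      by (simp add: divide_simps del: of_nat_Suc) (simp add: algebra_simps)
    then have "(\<lambda>k. real (Suc k) * real (Suc k) * (m ^ Suc k / fact (Suc k))) sums (m * (m * exp m + exp m))"
      using sums_mult[OF sums_add[OF 1 e], of m] by presburger
    then show ?thesis
      using sums_Suc[of "\<lambda>k. real k * real k * (m ^ k / fact k)"] by simp
  qed
  have "(\<lambda>k. real k * real k * (m ^ k / fact k) - 2 * m * (real k * (m ^ k / fact k)) + m\<^sup>2 * (m ^ k / fact k))
     sums (m * (m * exp m + exp m) - 2 * m * (m * exp m) + m\<^sup>2 * exp m)"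
    by (intro sums_add sums_diff sums_mult 1 2 e)
  then have "(\<lambda>k. exp (- m) * (real k * real k * (m ^ k / fact k) - 2 * m * (real k * (m ^ k / fact k)) + m\<^sup>2 * (m ^ k / fact k)))
     sums (exp (-m) * (m * (m * exp m + exp m) - 2 * m * (m * exp m) + m\<^sup>2 * exp m))"
    by (rule sums_mult)
  also have "exp (-m) * (m * (m * exp m + exp m) - 2 * m * (m * exp m) + m\<^sup>2 * exp m) = m"
    by (simp add: algebra_simps power2_eq_square exp_minus)
  finally show ?thesis
    by (simp add: algebra_simps power2_eq_square diff_divide_distrib add_divide_distrib)
qed

lemma poisson_total_sums:
  fixes m :: real
  shows "(\<lambda>k. exp (- m) * m ^ k / fact k) sums 1"
proof -
  have e: "(\<lambda>k. m ^ k / fact k) sums exp m"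
    using exp_converges[of m] by (simp add: scaleR_conv_of_real divide_inverse mult.commute)
  show ?thesis using sums_mult[OF e, of "exp (-m)"] by (simp add: exp_minus)
qed

section \<open>Homogeneous metric measure spaces\<close>

text \<open>All that the probabilistic argument needs from a homogeneous manifold: a separable metric space
  with a diffuse measure for which balls of equal radius have equal, finite volume.  Only the balls
  have to be measurable.  The sequence \<open>q\<close> is dense.\<close>

locale homogeneous_metric_measure =
  fixes \<mu> :: "'a measure" and d :: "'a \<Rightarrow> 'a \<Rightarrow> real" and q :: "nat \<Rightarrow> 'a"
  assumes space_UNIV: "space \<mu> = UNIV"
    and d_eq_0: "d x y = 0 \<longleftrightarrow> x = y"
    and d_sym: "d x y = d y x"
    and d_triangle: "d x z \<le> d x y + d y z"
    and dense: "0 < e \<Longrightarrow> \<exists>i. d (q i) x \<le> e"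
    and closed_ball_sets: "{y. d x y \<le> r} \<in> sets \<mu>"
    and closed_ball_finite: "emeasure \<mu> {y. d x y \<le> r} < \<infinity>"
    and ball_volume: "emeasure \<mu> {y. d x y \<le> r} = emeasure \<mu> {y. d x' y \<le> r}"
    and diffuse: "emeasure \<mu> {x} = 0"
begin

definition cb :: "'a \<Rightarrow> real \<Rightarrow> 'a set" where "cb x r = {y. d x y \<le> r}"

definition vol :: "real \<Rightarrow> real" where "vol r = measure \<mu> (cb (q 0) r)"

lemma d_nonneg: "0 \<le> d x y"
  using d_triangle[of x x y] d_eq_0[of x x] d_sym[of x y] by simp

lemma cb_0: "cb x 0 = {x}"
proof -
  have "d x y \<le> 0 \<longleftrightarrow> y = x" for y
    using d_nonneg[of x y] d_eq_0[of x y] by auto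
  then show ?thesis by (auto simp: cb_def)
qed

lemma cb_sets [measurable, simp]: "cb x r \<in> sets \<mu>"
  unfolding cb_def by (rule closed_ball_sets)

lemma singleton_sets: "{x} \<in> sets \<mu>"
  using cb_sets[of x 0] by (simp add: cb_0)

lemma emeasure_cb: "emeasure \<mu> (cb x r) = ennreal (vol r)"
proof -
  have "emeasure \<mu> (cb x r) = emeasure \<mu> (cb (q 0) r)"
    unfolding cb_def by (rule ball_volume)
  also have "\<dots> = ennreal (vol r)"
    unfolding vol_def using closed_ball_finite[of "q 0" r]
    by (intro emeasure_eq_ennreal_measure) (auto simp: cb_def)
  finally show ?thesis .
qed

lemma vol_nonneg: "0 \<le> vol r" by (simp add: vol_def)

lemma measure_cb: "measure \<mu> (cb x r) = vol r"
  using emeasure_cb[of x r] vol_nonneg[of r] by (simp add: measure_def)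

lemma vol_mono: "r \<le> s \<Longrightarrow> vol r \<le> vol s"
  unfolding vol_def using emeasure_cb[of "q 0" s]
  by (intro measure_mono_fmeasurable) (auto simp: cb_def fmeasurable_def closed_ball_sets ennreal_less_top)

text \<open>The volume is right continuous because the balls are closed.  In order
  to approach the ball of radius \<open>t\<close> from above, spheres included, the approximations below use balls
  that are slightly too large.\<close>

lemma vol_continuous_right:
  assumes "\<And>m. s m \<ge> r" "decseq s" "s \<longlonglongrightarrow> r"
  shows "(\<lambda>m. vol (s m)) \<longlonglongrightarrow> vol r"
proof -
  have "(\<Inter>m. cb (q 0) (s m)) = cb (q 0) r"
  proof safe
    fix x assume "x \<in> (\<Inter>m. cb (q 0) (s m))"
    then have "d (q 0) x \<le> s m" for m by (auto simp: cb_def)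
    then show "x \<in> cb (q 0) r"
      using LIMSEQ_le_const[OF assms(3)] by (auto simp: cb_def)
  next
    fix x m assume "x \<in> cb (q 0) r"
    then show "x \<in> cb (q 0) (s m)" using assms(1)[of m] by (auto simp: cb_def)
  qed
  moreover have "(\<lambda>m. measure \<mu> (cb (q 0) (s m))) \<longlonglongrightarrow> measure \<mu> (\<Inter>m. cb (q 0) (s m))"
  proof (rule Lim_measure_decseq)
    show "decseq (\<lambda>m. cb (q 0) (s m))"
      using assms(2) unfolding decseq_def cb_def by (blast intro: order_trans)
  qed (auto simp: emeasure_cb)
  ultimately show ?thesis by (simp add: measure_cb)
qed

lemma vol_0: "vol 0 = 0"
proof -
  have "cb (q 0) 0 = {q 0}" by (rule cb_0)
  then show ?thesis using diffuse by (simp add: vol_def measure_def)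
qed

definition mesh :: "nat \<Rightarrow> real" where "mesh m = 1 / real (Suc m)"

lemma mesh_pos: "0 < mesh m" by (simp add: mesh_def)
lemma mesh_le_1: "mesh m \<le> 1" by (simp add: mesh_def)
lemma mesh_decseq: "decseq mesh" by (auto simp: mesh_def decseq_def frac_le)
lemma mesh_tendsto: "mesh \<longlonglongrightarrow> 0"
  unfolding mesh_def using LIMSEQ_inverse_real_of_nat by (simp add: inverse_eq_divide)

lemma vol_mesh_add_tendsto: "(\<lambda>m. vol (t + mesh m)) \<longlonglongrightarrow> vol t"
proof (rule vol_continuous_right)
  show "(\<lambda>m. t + mesh m) \<longlonglongrightarrow> t" using tendsto_add[OF tendsto_const mesh_tendsto, of t] by simp
qed (use mesh_pos mesh_decseq in \<open>auto simp: decseq_def less_imp_le\<close>)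

lemma vol_mesh_tendsto: "(\<lambda>m. vol (mesh m)) \<longlonglongrightarrow> 0"
  using vol_mesh_add_tendsto[of 0] by (simp add: vol_0)

text \<open>For each \<open>m\<close> the cells \<open>cell m j\<close> partition the space into countably many pieces within
  \<open>mesh m\<close> of their centres \<open>q j\<close>.\<close>

definition cell :: "nat \<Rightarrow> nat \<Rightarrow> 'a set" where
  "cell m j = disjointed (\<lambda>i. cb (q i) (mesh m)) j"

lemma cell_sets [measurable, simp]: "cell m j \<in> sets \<mu>"
  unfolding cell_def disjointed_def by auto

lemma cell_subset: "cell m j \<subseteq> cb (q j) (mesh m)"
  unfolding cell_def by (rule disjointed_subset)

lemma cell_disjoint: "disjoint_family (cell m)"
  unfolding cell_def using disjoint_family_disjointed[of "\<lambda>i. cb (q i) (mesh m)"] by (simp add: disjoint_family_on_def)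

lemma cell_UN: "(\<Union>j. cell m j) = UNIV"
proof -
  have "(\<Union>j. cb (q j) (mesh m)) = UNIV"
    using dense[OF mesh_pos] by (auto simp: cb_def)
  then show ?thesis unfolding cell_def UN_disjointed_eq .
qed

lemma cell_unique: "x \<in> cell m i \<Longrightarrow> x \<in> cell m j \<Longrightarrow> i = j"
  using cell_disjoint[of m] by (auto simp: disjoint_family_on_def)

lemma cell_close: "x \<in> cell m j \<Longrightarrow> y \<in> cell m j \<Longrightarrow> d x y \<le> 2 * mesh m"
proof -
  assume "x \<in> cell m j" "y \<in> cell m j"
  then have "d (q j) x \<le> mesh m" "d (q j) y \<le> mesh m"
    using cell_subset[of m j] by (auto simp: cb_def)
  then show ?thesis using d_triangle[of x y "q j"] d_sym[of x "q j"] by simp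
qed

text \<open>For every mesh size exactly one cell carries the mass.  The intersection of these cells still has
  mass one, hence is not empty, and its diameter is zero.\<close>

lemma zero_one_measure_is_dirac:
  assumes sets: "sets \<eta> = sets \<mu>" and F: "F \<in> sets \<mu>" "emeasure \<eta> F = 1"
    and 01: "\<And>B. B \<in> sets \<mu> \<Longrightarrow> B \<subseteq> F \<Longrightarrow> emeasure \<eta> B = 0 \<or> emeasure \<eta> B = 1"
  obtains x where "x \<in> F" "\<And>B. B \<in> sets \<mu> \<Longrightarrow> B \<subseteq> F \<Longrightarrow> emeasure \<eta> B = indicator B x"
proof -
  have [measurable_cong]: "sets \<eta> = sets \<mu>" by fact
  note F(1)[measurable]
  have "\<exists>j. emeasure \<eta> (F \<inter> cell m j) = 1" for m
  proof (rule ccontr)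
    assume "\<not> ?thesis"
    then have "F \<inter> cell m j \<in> null_sets \<eta>" for j
      using 01[of "F \<inter> cell m j"] F by (auto simp: null_sets_def sets)
    then have "(\<Union>j. F \<inter> cell m j) \<in> null_sets \<eta>" by (rule null_sets_UN)
    moreover have "(\<Union>j. F \<inter> cell m j) = F" using cell_UN[of m] by auto
    ultimately show False using F by auto
  qed
  then obtain j where j: "\<And>m. emeasure \<eta> (F \<inter> cell m (j m)) = 1" by metis
  define R where "R = (\<Inter>m. F \<inter> cell m (j m))"
  have R [measurable]: "R \<in> sets \<mu>" "R \<subseteq> F" unfolding R_def by auto
  have "F - cell m (j m) \<in> null_sets \<eta>" for m
  proof -
    have "emeasure \<eta> (F - F \<inter> cell m (j m)) = emeasure \<eta> F - emeasure \<eta> (F \<inter> cell m (j m))"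
      by (intro emeasure_Diff) (auto simp: j sets F)
    then show ?thesis using j[of m] F by (auto simp: Diff_Int2 sets Diff_Int)
  qed
  then have "(\<Union>m. F - cell m (j m)) \<in> null_sets \<eta>" by (rule null_sets_UN)
  also have "(\<Union>m. F - cell m (j m)) = F - R" unfolding R_def by auto
  finally have "emeasure \<eta> (F - R) = 0" by auto
  moreover have "emeasure \<eta> F = emeasure \<eta> R + emeasure \<eta> (F - R)"
    using R by (subst plus_emeasure) (auto simp: sets Un_absorb1)
  ultimately have R1: "emeasure \<eta> R = 1" using F by simp
  then obtain x where x: "x \<in> R" by (metis emeasure_empty equals0I zero_neq_one)
  have "y = x" if "y \<in> R" for y
  proof -
    have "d y x \<le> 2 * mesh m" for m
      using cell_close[of y m "j m" x] that x by (auto simp: R_def)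
    moreover have "(\<lambda>m. 2 * mesh m) \<longlonglongrightarrow> 0" using tendsto_mult_right_zero[OF mesh_tendsto] by simp
    ultimately have "d y x \<le> 0" by (meson LIMSEQ_le_const)
    then show ?thesis using d_nonneg[of y x] d_eq_0[of y x] by simp
  qed
  then have Rx: "R = {x}" using x by blast
  show thesis
  proof
    show "x \<in> F" using x R by auto
    fix B assume B: "B \<in> sets \<mu>" "B \<subseteq> F"
    show "emeasure \<eta> B = indicator B x"
    proof (cases "x \<in> B")
      case True
      then have "emeasure \<eta> R \<le> emeasure \<eta> B" using Rx B by (intro emeasure_mono) (auto simp: sets)
      then show ?thesis using True R1 01[OF B] by auto
    next
      case False
      then have "emeasure \<eta> B \<le> emeasure \<eta> (F - R)" using Rx B F R by (intro emeasure_mono) (auto simp: sets)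
      then show ?thesis using False \<open>emeasure \<eta> (F - R) = 0\<close> by auto
    qed
  qed
qed

end

section \<open>Poisson processes and their atoms\<close>

locale homogeneous_poisson = homogeneous_metric_measure \<mu> d q + prob_space P
  for \<mu> :: "'a measure" and d q and P :: "'w measure" +
  fixes \<nu> :: "'w \<Rightarrow> 'a measure"
  assumes poisson: "poisson_process P \<mu> \<nu>"
begin

lemma point_measure_nu: "\<omega> \<in> space P \<Longrightarrow> point_measure \<mu> (\<nu> \<omega>)"
  using poisson by (auto simp: poisson_process_def)

lemma sets_nu: "\<omega> \<in> space P \<Longrightarrow> sets (\<nu> \<omega>) = sets \<mu>"
  using point_measure_nu by (auto simp: point_measure_def)

lemma count_measurable [measurable]: "B \<in> sets \<mu> \<Longrightarrow> (\<lambda>\<omega>. emeasure (\<nu> \<omega>) B) \<in> borel_measurable P"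
  using poisson by (auto simp: poisson_process_def)

lemma count_pmf:
  assumes "B \<in> sets \<mu>" "emeasure \<mu> B < \<infinity>"
  shows "prob {\<omega>\<in>space P. emeasure (\<nu> \<omega>) B = of_nat k} = exp (- measure \<mu> B) * measure \<mu> B ^ k / fact k"
  using poisson assms unfolding poisson_process_def by blast

lemma nu_indep_vars:
  fixes n :: nat
  assumes "\<And>i. i < n \<Longrightarrow> B i \<in> sets \<mu>" "disjoint_family_on B {..<n}"
  shows "indep_vars (\<lambda>_. borel) (\<lambda>i \<omega>. emeasure (\<nu> \<omega>) (B i)) {..<n}"
proof -
  have "\<forall>(n::nat) B. (\<forall>i<n. B i \<in> sets \<mu>) \<and> disjoint_family_on B {..<n} \<longrightarrow>
      indep_vars (\<lambda>_. borel) (\<lambda>i \<omega>. emeasure (\<nu> \<omega>) (B i)) {..<n}"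
    using poisson unfolding poisson_process_def by (elim conjE)
  from this[rule_format, of n B] show ?thesis using assms by simp
qed

lemma count_finite:
  assumes B[measurable]: "B \<in> sets \<mu>" and "emeasure \<mu> B < \<infinity>"
  shows "AE \<omega> in P. \<exists>n. emeasure (\<nu> \<omega>) B = of_nat n"
proof -
  let ?A = "\<lambda>n. {\<omega>\<in>space P. emeasure (\<nu> \<omega>) B = of_nat n}"
  have "(\<lambda>n. prob (?A n)) sums prob (\<Union>n. ?A n)"
    by (intro finite_measure_UNION) (auto simp: disjoint_family_on_def)
  moreover have "(\<lambda>n. prob (?A n)) sums 1"
    using poisson_total_sums[of "measure \<mu> B"] by (simp add: count_pmf[OF assms])
  ultimately have "prob (\<Union>n. ?A n) = 1" by (rule sums_unique2)
  then have "AE \<omega> in P. \<omega> \<in> (\<Union>n. ?A n)" by (rule AE_prob_1)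
  then show ?thesis by eventually_elim auto
qed

lemma prob_count_ne_0_le:
  assumes B[measurable]: "B \<in> sets \<mu>" and fin: "emeasure \<mu> B < \<infinity>"
  shows "prob {\<omega>\<in>space P. emeasure (\<nu> \<omega>) B \<noteq> 0} \<le> measure \<mu> B"
proof -
  have "prob {\<omega>\<in>space P. \<not> emeasure (\<nu> \<omega>) B = 0} = 1 - prob {\<omega>\<in>space P. emeasure (\<nu> \<omega>) B = 0}"
    by (intro prob_neg) simp
  also have "\<dots> = 1 - exp (- measure \<mu> B)"
    using count_pmf[OF B fin, of 0] by simp
  finally show ?thesis using poisson_count_ne_0_le[of "measure \<mu> B"] by simp
qed

lemma prob_count_eq_1_le:
  assumes B[measurable]: "B \<in> sets \<mu>" and fin: "emeasure \<mu> B < \<infinity>"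
  shows "prob {\<omega>\<in>space P. emeasure (\<nu> \<omega>) B = 1} \<le> measure \<mu> B"
  using finite_measure_mono[of "{\<omega>\<in>space P. emeasure (\<nu> \<omega>) B = 1}" "{\<omega>\<in>space P. emeasure (\<nu> \<omega>) B \<noteq> 0}"]
    prob_count_ne_0_le[OF assms] by force

lemma prob_count_not_01_le:
  assumes B[measurable]: "B \<in> sets \<mu>" and fin: "emeasure \<mu> B < \<infinity>"
  shows "prob {\<omega>\<in>space P. emeasure (\<nu> \<omega>) B \<notin> {0, 1}} \<le> (measure \<mu> B)\<^sup>2"
proof -
  let ?A = "\<lambda>k. {\<omega>\<in>space P. emeasure (\<nu> \<omega>) B = of_nat k}"
  have "prob {\<omega>\<in>space P. \<not> emeasure (\<nu> \<omega>) B \<in> {0, 1}} = 1 - prob {\<omega>\<in>space P. emeasure (\<nu> \<omega>) B \<in> {0, 1}}"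
    by (intro prob_neg) simp
  also have "{\<omega>\<in>space P. emeasure (\<nu> \<omega>) B \<in> {0, 1}} = ?A 0 \<union> ?A 1" by auto
  also have "prob (?A 0 \<union> ?A 1) = prob (?A 0) + prob (?A 1)"
    by (intro finite_measure_Union) auto
  also have "\<dots> = exp (- measure \<mu> B) + exp (- measure \<mu> B) * measure \<mu> B"
    using count_pmf[OF B fin, of 0] count_pmf[OF B fin, of 1] by simp
  finally show ?thesis using poisson_count_ge_2_le[of "measure \<mu> B"] by simp
qed

text \<open>The definition of a Poisson process states independence for families indexed by an initial segment
  of the natural numbers; here the index set is any finite set.\<close>

lemma prob_counts_indep:
  assumes I: "finite I" "I \<noteq> {}" and B: "\<And>i. i \<in> I \<Longrightarrow> B i \<in> sets \<mu>" "disjoint_family_on B I"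
  shows "prob {\<omega>\<in>space P. \<forall>i\<in>I. emeasure (\<nu> \<omega>) (B i) = c i} =
    (\<Prod>i\<in>I. prob {\<omega>\<in>space P. emeasure (\<nu> \<omega>) (B i) = c i})"
proof -
  obtain h where h: "bij_betw h {..<card I} I"
    using ex_bij_betw_nat_finite[OF I(1)] by (auto simp: lessThan_atLeast0)
  let ?J = "{..<card I}"
  have inI: "h i \<in> I" if "i < card I" for i using h that by (auto simp: bij_betw_def)
  have "disjoint_family_on (\<lambda>i. B (h i)) ?J"
    using h B(2) unfolding disjoint_family_on_def bij_betw_def inj_on_def by (metis image_eqI)
  then have indep: "indep_vars (\<lambda>_. borel) (\<lambda>i \<omega>. emeasure (\<nu> \<omega>) (B (h i))) ?J"
    using nu_indep_vars[of "card I" "\<lambda>i. B (h i)"] inI B(1) by simp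
  have "0 < card I" using I by (simp add: card_gt_0_iff)
  then have ne: "?J \<noteq> {}" by auto
  have "prob (\<Inter>i\<in>?J. (\<lambda>\<omega>. emeasure (\<nu> \<omega>) (B (h i))) -` {c (h i)} \<inter> space P) =
    (\<Prod>i\<in>?J. prob ((\<lambda>\<omega>. emeasure (\<nu> \<omega>) (B (h i))) -` {c (h i)} \<inter> space P))"
    by (intro indep_varsD_finite[OF indep] ne) auto
  also have "(\<Inter>i\<in>?J. (\<lambda>\<omega>. emeasure (\<nu> \<omega>) (B (h i))) -` {c (h i)} \<inter> space P) =
     {\<omega>\<in>space P. \<forall>i\<in>h ` ?J. emeasure (\<nu> \<omega>) (B i) = c i}"
    using ne by auto
  also have "h ` ?J = I" using h by (auto simp: bij_betw_def)
  also have "(\<Prod>i\<in>?J. prob ((\<lambda>\<omega>. emeasure (\<nu> \<omega>) (B (h i))) -` {c (h i)} \<inter> space P))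
    = (\<Prod>i\<in>I. prob ((\<lambda>\<omega>. emeasure (\<nu> \<omega>) (B i)) -` {c i} \<inter> space P))"
    by (rule prod.reindex_bij_betw[OF h])
  also have "\<dots> = (\<Prod>i\<in>I. prob {\<omega>\<in>space P. emeasure (\<nu> \<omega>) (B i) = c i})"
    by (intro prod.cong arg_cong[where f=prob]) auto
  finally show ?thesis .
qed

lemma emeasure_cells:
  assumes "sets \<eta> = sets \<mu>" "B \<in> sets \<mu>"
  shows "(\<Sum>j. emeasure \<eta> (B \<inter> cell m j)) = emeasure \<eta> B"
proof -
  have [measurable_cong]: "sets \<eta> = sets \<mu>" by fact
  note assms(2)[measurable]
  have "(\<Sum>j. emeasure \<eta> (B \<inter> cell m j)) = emeasure \<eta> (\<Union>j. B \<inter> cell m j)"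
    using cell_disjoint[of m] by (intro suminf_emeasure) (auto simp: disjoint_family_on_def)
  also have "(\<Union>j. B \<inter> cell m j) = B" using cell_UN[of m] by auto
  finally show ?thesis .
qed

lemma emeasure_finite_subset: "emeasure \<mu> F < \<infinity> \<Longrightarrow> F \<in> sets \<mu> \<Longrightarrow> B \<subseteq> F \<Longrightarrow> emeasure \<mu> B < \<infinity>"
  by (rule order.strict_trans1[OF emeasure_mono])

lemma measure_cell_le: "B \<in> sets \<mu> \<Longrightarrow> measure \<mu> (B \<inter> cell m j) \<le> vol (mesh m)"
  using measure_mono_fmeasurable[of "B \<inter> cell m j" "cb (q j) (mesh m)" \<mu>] cell_subset[of m j]
  by (simp add: measure_cb fmeasurable_def emeasure_cb le_infI2)

text \<open>The probability that some cell contains at least two points is at most the sum of the squares of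
  the measures of the cells, which is at most \<open>vol (mesh m)\<close> times the measure of \<open>F\<close> and tends
  to zero with the mesh because \<open>\<mu>\<close> is diffuse.\<close>

lemma AE_cells_01:
  assumes F[measurable]: "F \<in> sets \<mu>" and fin: "emeasure \<mu> F < \<infinity>"
  shows "AE \<omega> in P. \<exists>m. \<forall>j. emeasure (\<nu> \<omega>) (F \<inter> cell m j) \<in> {0, 1}"
proof -
  define A where "A m j = {\<omega>\<in>space P. emeasure (\<nu> \<omega>) (F \<inter> cell m j) \<notin> {0, 1}}" for m j
  have [measurable]: "A m j \<in> sets P" for m j unfolding A_def by measurable
  define S where "S m = (\<Union>j. A m j)" for m
  have [measurable]: "S m \<in> sets P" for m unfolding S_def by measurable
  have finc: "emeasure \<mu> (F \<inter> cell m j) < \<infinity>" for m j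
    by (rule emeasure_finite_subset[OF fin]) auto
  have "emeasure P (S m) \<le> ennreal (vol (mesh m) * measure \<mu> F)" for m
  proof -
    have "emeasure P (S m) \<le> (\<Sum>j. emeasure P (A m j))"
      unfolding S_def by (intro emeasure_subadditive_countably) auto
    also have "\<dots> \<le> (\<Sum>j. ennreal (vol (mesh m)) * emeasure \<mu> (F \<inter> cell m j))"
    proof (intro suminf_le allI)
      fix j
      have "prob (A m j) \<le> (measure \<mu> (F \<inter> cell m j))\<^sup>2"
        unfolding A_def by (intro prob_count_not_01_le finc) simp
      also have "\<dots> \<le> vol (mesh m) * measure \<mu> (F \<inter> cell m j)"
        unfolding power2_eq_square by (intro mult_right_mono measure_cell_le) auto
      finally show "emeasure P (A m j) \<le> ennreal (vol (mesh m)) * emeasure \<mu> (F \<inter> cell m j)"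
        using finc[of m j]
        by (simp add: emeasure_eq_measure emeasure_eq_ennreal_measure vol_nonneg ennreal_mult'[symmetric] ennreal_leI)
    qed auto
    also have "\<dots> = ennreal (vol (mesh m)) * emeasure \<mu> F"
      by (simp add: ennreal_suminf_cmult emeasure_cells)
    also have "\<dots> = ennreal (vol (mesh m) * measure \<mu> F)"
      using fin vol_nonneg by (simp add: emeasure_eq_ennreal_measure ennreal_mult')
    finally show ?thesis .
  qed
  then have le: "emeasure P (\<Inter>m. S m) \<le> ennreal (vol (mesh m) * measure \<mu> F)" for m
    by (rule order_trans[OF emeasure_mono, rotated 2]) auto
  have "(\<lambda>m. ennreal (vol (mesh m) * measure \<mu> F)) \<longlonglongrightarrow> ennreal (0 * measure \<mu> F)"
    by (intro tendsto_ennrealI tendsto_mult vol_mesh_tendsto tendsto_const)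
  then have "emeasure P (\<Inter>m. S m) \<le> ennreal (0 * measure \<mu> F)"
    by (rule LIMSEQ_le_const) (use le in blast)
  then have "(\<Inter>m. S m) \<in> null_sets P" by auto
  then have "AE \<omega> in P. \<omega> \<notin> (\<Inter>m. S m)" by (rule AE_not_in)
  then show ?thesis by (rule AE_mp) (auto simp: S_def A_def)
qed

text \<open>A realisation is only a sum of integer-valued measures.  On a set of mass one it takes no values
  but zero and one, so it is a point mass.\<close>

lemma emeasure_eq_count_atoms_of_01:
  assumes \<omega>: "\<omega> \<in> space P" and Q: "Q \<in> sets \<mu>" "emeasure (\<nu> \<omega>) Q \<in> {0, 1}" and B: "B \<in> sets \<mu>" "B \<subseteq> Q"
  shows "emeasure (\<nu> \<omega>) B = emeasure (count_space UNIV) (atoms (\<nu> \<omega>) \<inter> B)"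
proof -
  have le1: "emeasure (\<nu> \<omega>) C \<le> emeasure (\<nu> \<omega>) Q" if "C \<in> sets \<mu>" "C \<subseteq> Q" for C
    using that Q by (intro emeasure_mono) (auto simp: sets_nu[OF \<omega>])
  have 01: "emeasure (\<nu> \<omega>) C = 0 \<or> emeasure (\<nu> \<omega>) C = 1" if C: "C \<in> sets \<mu>" "C \<subseteq> Q" for C
  proof (rule point_measure_nat_cases[OF point_measure_nu[OF \<omega>] C(1)])
    assume "emeasure (\<nu> \<omega>) C = \<infinity>"
    then show ?thesis using le1[OF C] Q(2) by (auto simp: top_unique)
  next
    fix n assume n: "emeasure (\<nu> \<omega>) C = of_nat n"
    have "emeasure (\<nu> \<omega>) C \<le> 1" using le1[OF C] Q(2) by (auto intro: order_trans)
    then have "n \<le> 1" unfolding n using of_nat_le_iff[of n 1, where 'a=ennreal] by simp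
    then show ?thesis using n by (cases n) auto
  qed
  show ?thesis
  proof (cases "emeasure (\<nu> \<omega>) Q = 0")
    case True
    then have "x \<notin> atoms (\<nu> \<omega>)" if "x \<in> Q" for x
      using le1[of "{x}"] singleton_sets that by (auto simp: atoms_def)
    then have "atoms (\<nu> \<omega>) \<inter> B = {}" using B by auto
    then show ?thesis using le1[OF B] True by simp
  next
    case False
    with Q have "emeasure (\<nu> \<omega>) Q = 1" by auto
    with zero_one_measure_is_dirac[OF sets_nu[OF \<omega>] Q(1) _ 01] obtain x where
      x: "x \<in> Q" and D: "\<And>C. C \<in> sets \<mu> \<Longrightarrow> C \<subseteq> Q \<Longrightarrow> emeasure (\<nu> \<omega>) C = indicator C x" by blast
    have "y \<in> atoms (\<nu> \<omega>) \<longleftrightarrow> y = x" if "y \<in> Q" for y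
      using D[of "{y}"] singleton_sets that by (auto simp: atoms_def indicator_def)
    then have "atoms (\<nu> \<omega>) \<inter> B = (if x \<in> B then {x} else {})" using B x by auto
    then show ?thesis using D[OF B] by simp
  qed
qed

text \<open>Almost surely the process is the counting measure of its atoms, on all measurable sets at once:
  multiplicities do not occur, so counts of the process can be read as counts of vertices.\<close>

lemma AE_simple:
  "AE \<omega> in P. \<forall>B\<in>sets \<mu>. emeasure (\<nu> \<omega>) B = emeasure (count_space UNIV) (atoms (\<nu> \<omega>) \<inter> B)"
proof -
  have "AE \<omega> in P. \<forall>i::nat. \<exists>m. \<forall>j. emeasure (\<nu> \<omega>) (cb (q 0) (real i) \<inter> cell m j) \<in> {0, 1}"
    unfolding AE_all_countable by (intro allI AE_cells_01) (auto simp: emeasure_cb)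
  then show ?thesis
  proof (rule AE_mp, intro AE_I2 impI ballI)
    fix \<omega> B assume \<omega>: "\<omega> \<in> space P" and B[measurable]: "B \<in> sets \<mu>"
      and G: "\<forall>i::nat. \<exists>m. \<forall>j. emeasure (\<nu> \<omega>) (cb (q 0) (real i) \<inter> cell m j) \<in> {0, 1}"
    let ?c = "\<lambda>B. emeasure (count_space UNIV) (atoms (\<nu> \<omega>) \<inter> B)"
    have [measurable_cong]: "sets (\<nu> \<omega>) = sets \<mu>" by (rule sets_nu[OF \<omega>])
    have bounded: "emeasure (\<nu> \<omega>) (B \<inter> cb (q 0) (real i)) = ?c (B \<inter> cb (q 0) (real i))" for i :: nat
    proof -
      let ?F = "B \<inter> cb (q 0) (real i)"
      obtain m where m: "\<And>j. emeasure (\<nu> \<omega>) (cb (q 0) (real i) \<inter> cell m j) \<in> {0, 1}" using G by blast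
      have "emeasure (\<nu> \<omega>) ?F = (\<Sum>j. emeasure (\<nu> \<omega>) (?F \<inter> cell m j))"
        by (rule emeasure_cells[symmetric]) (auto simp: sets_nu[OF \<omega>])
      also have "\<dots> = (\<Sum>j. ?c (?F \<inter> cell m j))"
        by (intro suminf_cong emeasure_eq_count_atoms_of_01[OF \<omega> _ m]) auto
      also have "\<dots> = emeasure (count_space UNIV) (\<Union>j. atoms (\<nu> \<omega>) \<inter> (?F \<inter> cell m j))"
        using cell_disjoint[of m] by (intro suminf_emeasure) (auto simp: disjoint_family_on_def)
      also have "(\<Union>j. atoms (\<nu> \<omega>) \<inter> (?F \<inter> cell m j)) = atoms (\<nu> \<omega>) \<inter> ?F"
        using cell_UN[of m] by auto
      finally show ?thesis .
    qed
    have incs: "incseq (\<lambda>i. B \<inter> cb (q 0) (real i))" "incseq (\<lambda>i. atoms (\<nu> \<omega>) \<inter> (B \<inter> cb (q 0) (real i)))"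
      by (auto simp: incseq_def cb_def)
    have "\<exists>n::nat. d (q 0) x \<le> real n" for x by (rule real_arch_simple)
    then have U: "(\<Union>i. B \<inter> cb (q 0) (real i)) = B"
      "(\<Union>i. atoms (\<nu> \<omega>) \<inter> (B \<inter> cb (q 0) (real i))) = atoms (\<nu> \<omega>) \<inter> B"
      by (auto simp: cb_def)
    have "emeasure (\<nu> \<omega>) B = (SUP i. emeasure (\<nu> \<omega>) (B \<inter> cb (q 0) (real i)))"
      using U(1) by (subst SUP_emeasure_incseq) (auto simp: incs)
    also have "\<dots> = (SUP i. ?c (B \<inter> cb (q 0) (real i)))" by (simp add: bounded)
    also have "\<dots> = ?c B"
      using U(2) by (subst SUP_emeasure_incseq) (auto simp: incs)
    finally show "emeasure (\<nu> \<omega>) B = ?c B" .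
  qed
qed

end

section \<open>Second moments of the degree counts\<close>

definition poisson_weight :: "real \<Rightarrow> nat \<Rightarrow> real" where
  "poisson_weight r k = exp (- r) * r ^ k / fact k"

lemma poisson_weight_nonneg: "0 \<le> r \<Longrightarrow> 0 \<le> poisson_weight r k"
  by (simp add: poisson_weight_def)

lemma poisson_weight_le_1:
  assumes "0 \<le> r"
  shows "poisson_weight r k \<le> 1"
proof -
  have s: "(\<lambda>k. poisson_weight r k) sums 1"
    using poisson_total_sums[of r] by (simp add: poisson_weight_def)
  have "(\<Sum>k\<in>{k}. poisson_weight r k) \<le> (\<Sum>k. poisson_weight r k)"
    using s assms by (intro sum_le_suminf) (auto simp: sums_iff poisson_weight_nonneg)
  then show ?thesis using s by (simp add: sums_iff)
qed

lemma (in prob_space) expectation_square_sum_indicators: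
  fixes J :: "'i set" and c :: real
  assumes "finite J" and I[measurable]: "\<And>j. I j \<in> events"
  shows "expectation (\<lambda>\<omega>. ((\<Sum>j\<in>J. indicator (I j) \<omega>) - c)\<^sup>2) =
    (\<Sum>j\<in>J. \<Sum>l\<in>J. prob (I j \<inter> I l)) - 2 * c * (\<Sum>j\<in>J. prob (I j)) + c\<^sup>2"
proof -
  have "((\<Sum>j\<in>J. indicator (I j) \<omega>) - c)\<^sup>2 =
     (\<Sum>j\<in>J. \<Sum>l\<in>J. indicator (I j \<inter> I l) \<omega>) - 2 * c * (\<Sum>j\<in>J. indicator (I j) \<omega>) + c\<^sup>2" for \<omega>
    by (simp add: power2_diff power2_eq_square[of "sum _ _"] sum_product indicator_inter_arith algebra_simps)
  moreover have "integrable M (indicator (I j) :: _ \<Rightarrow> real)" "integrable M (indicator (I j \<inter> I l) :: _ \<Rightarrow> real)" for j l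
    by (auto intro!: integrable_real_indicator simp: emeasure_eq_measure)
  ultimately show ?thesis by (simp add: prob_space)
qed

context homogeneous_poisson
begin

text \<open>The discrete version of ``the cell contains a vertex of degree \<open>k\<close>'': the cell contains exactly
  one point, and a ball that contains the ball of radius \<open>t\<close> around each point of the cell contains
  exactly \<open>k\<close> further points.  The two counts refer to disjoint sets, so they are independent.\<close>

definition lone_point :: "'a set \<Rightarrow> real \<Rightarrow> nat \<Rightarrow> nat \<Rightarrow> nat \<Rightarrow> 'w set" where
  "lone_point E t k m j = {\<omega>\<in>space P. emeasure (\<nu> \<omega>) (E \<inter> cell m j) = 1 \<and>
     emeasure (\<nu> \<omega>) (cb (q j) (t + mesh m) - E \<inter> cell m j) = of_nat k}"

lemma lone_point_events [measurable]:
  assumes E[measurable]: "E \<in> sets \<mu>"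
  shows "lone_point E t k m j \<in> events"
  unfolding lone_point_def by measurable

lemma cell_subset_cb: "0 \<le> t \<Longrightarrow> E \<inter> cell m j \<subseteq> cb (q j) (t + mesh m)"
  using cell_subset[of m j] by (auto simp: cb_def intro: order_trans)

lemma emeasure_cell_finite: "E \<in> sets \<mu> \<Longrightarrow> emeasure \<mu> (E \<inter> cell m j) < \<infinity>"
  by (rule emeasure_finite_subset[of "cb (q j) (mesh m)"]) (use cell_subset in \<open>auto simp: emeasure_cb\<close>)

lemma prob_two_counts:
  assumes "A \<in> sets \<mu>" "B \<in> sets \<mu>" "A \<inter> B = {}"
  shows "prob {\<omega>\<in>space P. emeasure (\<nu> \<omega>) A = c \<and> emeasure (\<nu> \<omega>) B = c'} =
    prob {\<omega>\<in>space P. emeasure (\<nu> \<omega>) A = c} * prob {\<omega>\<in>space P. emeasure (\<nu> \<omega>) B = c'}"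
proof -
  have "prob {\<omega>\<in>space P. \<forall>i\<in>{0, 1::nat}. emeasure (\<nu> \<omega>) (if i = 0 then A else B) = (if i = 0 then c else c')} =
    (\<Prod>i\<in>{0, 1::nat}. prob {\<omega>\<in>space P. emeasure (\<nu> \<omega>) (if i = 0 then A else B) = (if i = 0 then c else c')})"
    using assms
    by (intro prob_counts_indep[where B="\<lambda>i. if i = 0 then A else B" and c="\<lambda>i. if i = 0 then c else c'"])
      (auto simp: disjoint_family_on_def)
  then show ?thesis by simp
qed

text \<open>The factor \<open>exp (- a)\<close> from the count in the cell combines with the one from the count outside
  the cell to \<open>exp (- vol (t + mesh m))\<close>, the same for all cells.\<close>

lemma prob_lone_point:
  assumes E[measurable]: "E \<in> sets \<mu>" and t: "0 \<le> t"
  defines "a \<equiv> \<lambda>m j. measure \<mu> (E \<inter> cell m j)"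
  shows "prob (lone_point E t k m j) =
    a m j * (exp (- vol (t + mesh m)) * (vol (t + mesh m) - a m j) ^ k / fact k)"
proof -
  let ?Q = "E \<inter> cell m j" and ?C = "cb (q j) (t + mesh m) - E \<inter> cell m j"
  have fQ: "emeasure \<mu> ?Q < \<infinity>" by (rule emeasure_cell_finite[OF E])
  have fC: "emeasure \<mu> ?C < \<infinity>"
    by (rule emeasure_finite_subset[of "cb (q j) (t + mesh m)"]) (auto simp: emeasure_cb)
  have mC: "measure \<mu> ?C = vol (t + mesh m) - a m j"
    unfolding a_def using cell_subset_cb[OF t]
    by (subst measure_Diff) (auto simp: measure_cb emeasure_cb)
  have "prob (lone_point E t k m j) = prob {\<omega>\<in>space P. emeasure (\<nu> \<omega>) ?Q = of_nat 1} *
     prob {\<omega>\<in>space P. emeasure (\<nu> \<omega>) ?C = of_nat k}"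
    unfolding lone_point_def by (subst prob_two_counts) auto
  also have "\<dots> = (exp (- a m j) * a m j ^ 1 / fact 1) * (exp (- measure \<mu> ?C) * measure \<mu> ?C ^ k / fact k)"
    unfolding a_def using fQ fC by (subst (1 2) count_pmf) auto
  also have "\<dots> = a m j * (exp (- vol (t + mesh m)) * (vol (t + mesh m) - a m j) ^ k / fact k)"
    unfolding mC by (simp add: exp_minus exp_diff field_simps)
  finally show ?thesis .
qed

text \<open>The events belonging to distant cells depend on the process in disjoint balls, so four counts in
  disjoint sets determine them.\<close>

lemma prob_lone_points_far_cells:
  assumes E[measurable]: "E \<in> sets \<mu>" and t: "0 \<le> t" and far: "2 * t + 2 * mesh m < d (q j) (q l)"
  shows "prob (lone_point E t k m j \<inter> lone_point E t k m l) =
    prob (lone_point E t k m j) * prob (lone_point E t k m l)"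
proof -
  let ?C = "\<lambda>j. cb (q j) (t + mesh m) - E \<inter> cell m j" and ?Q = "\<lambda>j. E \<inter> cell m j"
  define B where "B = (\<lambda>(b, c). if c then ?Q (if b then j else l) else ?C (if b then j else l))"
  define n :: "bool \<times> bool \<Rightarrow> ennreal" where "n = (\<lambda>(b, c). if c then 1 else of_nat k)"
  have disj: "cb (q j) (t + mesh m) \<inter> cb (q l) (t + mesh m) = {}"
  proof safe
    fix x assume "x \<in> cb (q j) (t + mesh m)" "x \<in> cb (q l) (t + mesh m)"
    then have "d (q j) (q l) \<le> 2 * (t + mesh m)"
      using d_triangle[of "q j" "q l" x] d_sym[of x "q l"] by (simp add: cb_def)
    then show "x \<in> {}" using far by simp
  qed
  have sub: "B (b, c) \<subseteq> cb (q (if b then j else l)) (t + mesh m)" for b c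
    unfolding B_def using cell_subset_cb[OF t] by (cases b; cases c) auto
  have "B x \<inter> B y = {}" if "x \<noteq> y" for x y
  proof (cases "fst x = fst y")
    case True
    then show ?thesis using that by (cases x; cases y) (auto simp: B_def)
  next
    case False
    obtain b c b' c' where xy: "x = (b, c)" "y = (b', c')" by (cases x; cases y)
    have "b' = (\<not> b)" using False xy by auto
    then show ?thesis
      using sub[of b c] sub[of b' c'] disj unfolding xy by (cases b) (simp_all, blast+)
  qed
  then have dB: "disjoint_family_on B UNIV" by (auto simp: disjoint_family_on_def)
  have sB: "B i \<in> sets \<mu>" for i unfolding B_def by (cases i) auto
  have UN: "(UNIV :: (bool \<times> bool) set) = {(True, True), (True, False), (False, True), (False, False)}"
    by (auto simp: UNIV_bool)
  have "prob {\<omega>\<in>space P. \<forall>i\<in>UNIV. emeasure (\<nu> \<omega>) (B i) = n i} =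
     (\<Prod>i\<in>UNIV. prob {\<omega>\<in>space P. emeasure (\<nu> \<omega>) (B i) = n i})"
    by (intro prob_counts_indep dB sB) auto
  also have "{\<omega>\<in>space P. \<forall>i\<in>UNIV. emeasure (\<nu> \<omega>) (B i) = n i} =
     lone_point E t k m j \<inter> lone_point E t k m l"
    unfolding UN by (auto simp: B_def n_def lone_point_def)
  also have "(\<Prod>i\<in>UNIV. prob {\<omega>\<in>space P. emeasure (\<nu> \<omega>) (B i) = n i}) =
     prob (lone_point E t k m j) * prob (lone_point E t k m l)"
    unfolding UN lone_point_def by (subst (1 2) prob_two_counts) (auto simp: B_def n_def)
  finally show ?thesis .
qed

lemma sum_near_cells_le:
  assumes E[measurable]: "E \<in> sets \<mu>" and "finite S" "\<And>l. l \<in> S \<Longrightarrow> d (q j) (q l) \<le> 2 * t + 2 * mesh m"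
  shows "(\<Sum>l\<in>S. measure \<mu> (E \<inter> cell m l)) \<le> vol (2 * t + 3)"
proof -
  have "(\<Sum>l\<in>S. measure \<mu> (E \<inter> cell m l)) = measure \<mu> (\<Union>l\<in>S. E \<inter> cell m l)"
    using emeasure_cell_finite[OF E, THEN less_imp_neq] assms(2)
    by (intro measure_finite_Union[symmetric]) (auto simp: disjoint_family_on_def dest: cell_unique)
  also have "\<dots> \<le> measure \<mu> (cb (q j) (2 * t + 3))"
  proof (rule measure_mono_fmeasurable)
    show "(\<Union>l\<in>S. E \<inter> cell m l) \<subseteq> cb (q j) (2 * t + 3)"
    proof safe
      fix x l assume l: "l \<in> S" "x \<in> cell m l"
      then have "d (q l) x \<le> mesh m" using cell_subset[of m l] by (auto simp: cb_def)
      then show "x \<in> cb (q j) (2 * t + 3)"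
        using assms(3)[OF l(1)] d_triangle[of "q j" x "q l"] mesh_le_1[of m] by (auto simp: cb_def)
    qed
  qed (use assms(2) in \<open>auto simp: fmeasurable_def emeasure_cb\<close>)
  finally show ?thesis by (simp add: measure_cb)
qed

text \<open>The variance is linear in the measure of the cells: pairs of distant cells are uncorrelated, the
  diagonal contributes at most the sum of the measures, and for each cell the partners at distance
  at most \<open>2 * t + 2 * mesh m\<close> have total measure at most \<open>vol (2 * t + 3)\<close>.\<close>

lemma expectation_cells_le:
  fixes n m k :: nat and c :: real
  assumes E[measurable]: "E \<in> sets \<mu>" and t: "0 \<le> t"
  defines "a \<equiv> \<lambda>j. measure \<mu> (E \<inter> cell m j)"
    and "p \<equiv> \<lambda>j. prob (lone_point E t k m j)"
  shows "expectation (\<lambda>\<omega>. ((\<Sum>j<n. indicator (lone_point E t k m j) \<omega>) - c)\<^sup>2) \<le>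
    ((\<Sum>j<n. p j) - c)\<^sup>2 + (\<Sum>j<n. a j) * (1 + vol (2 * t + 3))"
proof -
  let ?I = "lone_point E t k m"
  let ?near = "\<lambda>j l. d (q j) (q l) \<le> 2 * t + 2 * mesh m"
  have a0: "0 \<le> a j" and p0: "0 \<le> p j" for j by (auto simp: a_def p_def)
  have pa: "prob (?I j) \<le> a j" for j
  proof -
    have "prob (?I j) \<le> prob {\<omega>\<in>space P. emeasure (\<nu> \<omega>) (E \<inter> cell m j) = 1}"
      unfolding lone_point_def by (intro finite_measure_mono) auto
    also have "\<dots> \<le> a j" unfolding a_def by (intro prob_count_eq_1_le emeasure_cell_finite) auto
    finally show ?thesis .
  qed
  have pair: "prob (?I j \<inter> ?I l) \<le> p j * p l + (if l = j then a j else 0) + (if ?near j l then a j * a l else 0)" for j l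
  proof (cases "?near j l")
    case False
    then have "prob (?I j \<inter> ?I l) = p j * p l"
      unfolding p_def by (intro prob_lone_points_far_cells E t) auto
    then show ?thesis using a0 False by auto
  next
    case near: True
    show ?thesis
    proof (cases "l = j")
      case True
      then have "prob (?I j \<inter> ?I l) \<le> a j" using pa by simp
      moreover have "0 \<le> p j * p l" "0 \<le> a j * a l" using a0 p0 by auto
      ultimately show ?thesis using True by (simp add: add_increasing add_increasing2)
    next
      case False
      have "(E \<inter> cell m j) \<inter> (E \<inter> cell m l) = {}"
        using cell_unique[of _ m j l] False by auto
      then have "prob {\<omega>\<in>space P. emeasure (\<nu> \<omega>) (E \<inter> cell m j) = 1 \<and> emeasure (\<nu> \<omega>) (E \<inter> cell m l) = 1} =
        prob {\<omega>\<in>space P. emeasure (\<nu> \<omega>) (E \<inter> cell m j) = 1} * prob {\<omega>\<in>space P. emeasure (\<nu> \<omega>) (E \<inter> cell m l) = 1}"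
        by (intro prob_two_counts) auto
      also have "\<dots> \<le> a j * a l"
        unfolding a_def by (intro mult_mono prob_count_eq_1_le emeasure_cell_finite) auto
      finally have "prob {\<omega>\<in>space P. emeasure (\<nu> \<omega>) (E \<inter> cell m j) = 1 \<and> emeasure (\<nu> \<omega>) (E \<inter> cell m l) = 1} \<le> a j * a l" .
      moreover have "prob (?I j \<inter> ?I l) \<le> prob {\<omega>\<in>space P. emeasure (\<nu> \<omega>) (E \<inter> cell m j) = 1 \<and> emeasure (\<nu> \<omega>) (E \<inter> cell m l) = 1}"
        unfolding lone_point_def by (intro finite_measure_mono) auto
      moreover have "0 \<le> p j * p l" using p0 by auto
      ultimately show ?thesis using near False by auto
    qed
  qed
  have near_sum: "(\<Sum>l<n. if ?near j l then a j * a l else 0) \<le> a j * vol (2 * t + 3)" for j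
  proof -
    have "(\<Sum>l<n. if ?near j l then a j * a l else 0) = (\<Sum>l\<in>{l\<in>{..<n}. ?near j l}. a j * a l)"
      by (rule sum.inter_filter[symmetric]) simp
    also have "\<dots> = a j * (\<Sum>l\<in>{l\<in>{..<n}. ?near j l}. a l)" by (simp add: sum_distrib_left)
    also have "\<dots> \<le> a j * vol (2 * t + 3)"
      unfolding a_def by (intro mult_left_mono sum_near_cells_le) auto
    finally show ?thesis .
  qed
  have "(\<Sum>j<n. \<Sum>l<n. prob (?I j \<inter> ?I l)) \<le>
     (\<Sum>j<n. \<Sum>l<n. p j * p l + (if l = j then a j else 0) + (if ?near j l then a j * a l else 0))"
    by (intro sum_mono pair)
  also have "\<dots> = (\<Sum>j<n. p j)\<^sup>2 + (\<Sum>j<n. a j) + (\<Sum>j<n. \<Sum>l<n. if ?near j l then a j * a l else 0)"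
    by (simp add: sum.distrib power2_eq_square sum_product)
  also have "\<dots> \<le> (\<Sum>j<n. p j)\<^sup>2 + (\<Sum>j<n. a j) + (\<Sum>j<n. a j * vol (2 * t + 3))"
    by (intro add_left_mono sum_mono near_sum)
  also have "\<dots> = (\<Sum>j<n. p j)\<^sup>2 + (\<Sum>j<n. a j) * (1 + vol (2 * t + 3))"
    by (simp add: sum_distrib_right[symmetric] algebra_simps)
  finally have *: "(\<Sum>j<n. \<Sum>l<n. prob (?I j \<inter> ?I l)) \<le> (\<Sum>j<n. p j)\<^sup>2 + (\<Sum>j<n. a j) * (1 + vol (2 * t + 3))" .
  have "expectation (\<lambda>\<omega>. ((\<Sum>j<n. indicator (?I j) \<omega>) - c)\<^sup>2) =
    (\<Sum>j<n. \<Sum>l<n. prob (?I j \<inter> ?I l)) - 2 * c * (\<Sum>j<n. p j) + c\<^sup>2"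
    unfolding p_def by (intro expectation_square_sum_indicators) auto
  then show ?thesis using * by (simp add: power2_diff algebra_simps)
qed

end

lemma vertex_degree_threshold:
  assumes "\<And>x y. d x y = d y x" "x \<in> V"
  shows "vertex_degree V (threshold_edges d t V) x =
    (let N = {y\<in>V. y \<noteq> x \<and> d x y \<le> t} in if finite N then enat (card N) else \<infinity>)"
proof -
  have "{y\<in>V. {x, y} \<in> threshold_edges d t V} = {y\<in>V. y \<noteq> x \<and> d x y \<le> t}"
    using assms by (auto simp: threshold_edges_def doubleton_eq_iff)
  then show ?thesis by (simp add: vertex_degree_def)
qed

context homogeneous_poisson
begin

definition degree_count :: "real \<Rightarrow> nat \<Rightarrow> 'a set \<Rightarrow> 'w \<Rightarrow> real" where
  "degree_count t k E \<omega> = (\<Sum>x\<in>atoms (\<nu> \<omega>) \<inter> E.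
     of_bool (vertex_degree (atoms (\<nu> \<omega>)) (threshold_edges d t (atoms (\<nu> \<omega>))) x = enat k))"

definition simple_locally_finite :: "'w \<Rightarrow> bool" where
  "simple_locally_finite \<omega> \<longleftrightarrow> \<omega> \<in> space P \<and>
    (\<forall>B\<in>sets \<mu>. emeasure (\<nu> \<omega>) B = emeasure (count_space UNIV) (atoms (\<nu> \<omega>) \<inter> B)) \<and>
    (\<forall>x r. finite (atoms (\<nu> \<omega>) \<inter> cb x r))"

lemma AE_finite_atoms:
  assumes "E \<in> sets \<mu>" "emeasure \<mu> E < \<infinity>"
  shows "AE \<omega> in P. finite (atoms (\<nu> \<omega>) \<inter> E)"
  using AE_simple count_finite[OF assms]
proof eventually_elim
  case (elim \<omega>)
  then have "emeasure (count_space UNIV) (atoms (\<nu> \<omega>) \<inter> E) \<noteq> \<infinity>" using assms by auto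
  then show ?case by (auto simp: emeasure_count_space split: if_splits)
qed

lemma AE_simple_locally_finite: "AE \<omega> in P. simple_locally_finite \<omega>"
proof -
  have "AE \<omega> in P. \<forall>i::nat. finite (atoms (\<nu> \<omega>) \<inter> cb (q 0) (real i))"
    unfolding AE_all_countable by (intro allI AE_finite_atoms) (auto simp: emeasure_cb)
  with AE_simple AE_space show ?thesis
  proof eventually_elim
    case (elim \<omega>)
    have "finite (atoms (\<nu> \<omega>) \<inter> cb x r)" for x r
    proof -
      obtain i :: nat where "d (q 0) x + r \<le> real i" using real_arch_simple by blast
      then have "d (q 0) y \<le> real i" if "d x y \<le> r" for y
        using d_triangle[of "q 0" y x] that by simp
      then have "cb x r \<subseteq> cb (q 0) (real i)" by (auto simp: cb_def)
      then show ?thesis using elim(3) by (meson Int_mono finite_subset order_refl)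
    qed
    then show ?case using elim by (simp add: simple_locally_finite_def)
  qed
qed

lemma emeasure_simple_locally_finite:
  assumes "simple_locally_finite \<omega>" "B \<in> sets \<mu>" "finite (atoms (\<nu> \<omega>) \<inter> B)"
  shows "emeasure (\<nu> \<omega>) B = of_nat (card (atoms (\<nu> \<omega>) \<inter> B))"
  using assms by (simp add: simple_locally_finite_def)

lemma eventually_mesh_less: "0 < e \<Longrightarrow> eventually (\<lambda>m. 2 * mesh m < e) sequentially"
  using order_tendstoD(2)[OF tendsto_mult[OF tendsto_const[of 2] mesh_tendsto], of e] by simp

text \<open>For a fixed locally finite realisation the discretisation is exact as soon as the mesh is small
  compared to the gaps in the finitely many relevant distances: the atoms in \<open>E\<close> lie in different
  cells, and for each atom \<open>x\<close> in \<open>E\<close> the atoms in the enlarged ball around the centre of its cell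
  are those at distance at most \<open>t\<close> from \<open>x\<close>.  Atoms at distance exactly \<open>t\<close> cause no trouble since
  the approximating balls contain the ball of radius \<open>t\<close>.\<close>

lemma eventually_sum_lone_points_eq_degree_count:
  assumes good: "simple_locally_finite \<omega>" and E[measurable]: "E \<in> sets \<mu>" and t: "0 \<le> t"
    and finE: "finite (atoms (\<nu> \<omega>) \<inter> E)"
    and rest: "eventually (\<lambda>m. emeasure (\<nu> \<omega>) (E - (\<Union>j<J m. cell m j)) = 0) sequentially"
  shows "eventually (\<lambda>m. (\<Sum>j<J m. indicator (lone_point E t k m j) \<omega>) = degree_count t k E \<omega>) sequentially"
proof -
  define V where "V = atoms (\<nu> \<omega>)"
  have finV: "finite (V \<inter> cb x r)" for x r using good by (simp add: simple_locally_finite_def V_def)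
  have \<omega>: "\<omega> \<in> space P" using good by (simp add: simple_locally_finite_def)
  \<comment> \<open>at mesh \<open>m\<close> no atom shares a cell with \<open>x\<close>, and no atom is just outside the ball of radius \<open>t\<close>\<close>
  define sep where "sep m x \<longleftrightarrow> (\<forall>y\<in>V \<inter> cb x (t + 1). (y \<noteq> x \<longrightarrow> 2 * mesh m < d x y) \<and>
      (t < d x y \<longrightarrow> 2 * mesh m < d x y - t))" for m x
  have ev_sep: "eventually (\<lambda>m. sep m x) sequentially" for x
    unfolding sep_def
  proof (rule eventually_ball_finite[OF finV], intro ballI eventually_conj)
    fix y
    show "eventually (\<lambda>m. y \<noteq> x \<longrightarrow> 2 * mesh m < d x y) sequentially"
      using eventually_mesh_less[of "d x y"] d_nonneg[of x y] d_eq_0[of x y]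
      by (cases "y = x") auto
    show "eventually (\<lambda>m. t < d x y \<longrightarrow> 2 * mesh m < d x y - t) sequentially"
      using eventually_mesh_less[of "d x y - t"] by (cases "t < d x y") auto
  qed
  have "eventually (\<lambda>m. \<forall>x\<in>V \<inter> E. sep m x) sequentially"
    using finE ev_sep by (intro eventually_ball_finite) (auto simp: V_def)
  moreover have "eventually (\<lambda>m. 2 * mesh m < 1) sequentially" by (rule eventually_mesh_less) simp
  ultimately show ?thesis using rest
  proof eventually_elim
    case (elim m)
    have sep_ne: "2 * mesh m < d x y" if "x \<in> V" "x \<in> E" "y \<in> V" "y \<noteq> x" for x y
    proof (cases "d x y \<le> t + 1")
      case True
      then show ?thesis using elim(1) that by (auto simp: sep_def cb_def)
    next
      case False
      then show ?thesis using elim(2) t by simp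
    qed
    have sep_t: "d x y \<le> t" if "x \<in> V" "x \<in> E" "y \<in> V" "d x y \<le> t + 2 * mesh m" for x y
    proof (rule ccontr)
      assume "\<not> d x y \<le> t"
      moreover have "d x y \<le> t + 1" using that elim(2) by simp
      ultimately have "2 * mesh m < d x y - t" using elim(1) that unfolding sep_def by (auto simp: cb_def)
      then show False using that by simp
    qed
    have rest0: "V \<inter> (E - (\<Union>j<J m. cell m j)) = {}"
    proof -
      have "finite (V \<inter> (E - (\<Union>j<J m. cell m j)))"
        using finE by (rule rev_finite_subset) (auto simp: V_def)
      moreover from this have "emeasure (\<nu> \<omega>) (E - (\<Union>j<J m. cell m j)) = of_nat (card (V \<inter> (E - (\<Union>j<J m. cell m j))))"
        unfolding V_def by (intro emeasure_simple_locally_finite good) auto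
      ultimately show ?thesis using elim(3) by simp
    qed
    have "\<exists>j. x \<in> cell m j" for x using cell_UN[of m] by blast
    then obtain ix where ix: "\<And>x. x \<in> cell m (ix x)" by metis
    have ixJ: "ix x < J m" if "x \<in> V \<inter> E" for x
    proof (rule ccontr)
      assume *: "\<not> ix x < J m"
      have "x \<notin> cell m j" if "j < J m" for j
        using cell_unique[OF ix[of x], of j] that * by auto
      then show False using rest0 that by auto
    qed
    have inj: "inj_on ix (V \<inter> E)"
    proof (rule inj_onI, rule ccontr)
      fix x y assume "x \<in> V \<inter> E" "y \<in> V \<inter> E" "ix x = ix y" "x \<noteq> y"
      then show False using cell_close[OF ix[of x], of y] ix[of y] sep_ne[of x y] by auto
    qed
    have only: "V \<inter> (E \<inter> cell m (ix x)) = {x}" if "x \<in> V \<inter> E" for x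
    proof -
      have "y = x" if "y \<in> V" "y \<in> cell m (ix x)" for y
        using cell_close[OF ix[of x] that(2)] sep_ne[of x y] \<open>x \<in> V \<inter> E\<close> that by force
      then show ?thesis using that ix[of x] by blast
    qed
    have nbrs: "V \<inter> (cb (q (ix x)) (t + mesh m) - E \<inter> cell m (ix x)) = {y\<in>V. y \<noteq> x \<and> d x y \<le> t}"
      if x: "x \<in> V \<inter> E" for x
    proof -
      have qx: "d (q (ix x)) x \<le> mesh m" using ix[of x] cell_subset[of m "ix x"] by (auto simp: cb_def)
      have "d (q (ix x)) y \<le> t + mesh m \<longleftrightarrow> d x y \<le> t" if "y \<in> V" for y
      proof
        assume "d (q (ix x)) y \<le> t + mesh m"
        then have "d x y \<le> t + 2 * mesh m"
          using d_triangle[of x y "q (ix x)"] qx d_sym[of x "q (ix x)"] by simp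
        then show "d x y \<le> t" using sep_t[of x y] x that by auto
      next
        assume "d x y \<le> t"
        then show "d (q (ix x)) y \<le> t + mesh m"
          using d_triangle[of "q (ix x)" y x] qx by simp
      qed
      then show ?thesis using only[OF x] by (auto simp: cb_def)
    qed
    let ?deg = "\<lambda>x. vertex_degree V (threshold_edges d t V) x = enat k"
    have iso: "\<omega> \<in> lone_point E t k m (ix x) \<longleftrightarrow> ?deg x" if x: "x \<in> V \<inter> E" for x
    proof -
      let ?Q = "E \<inter> cell m (ix x)" and ?C = "cb (q (ix x)) (t + mesh m) - E \<inter> cell m (ix x)"
      have "emeasure (\<nu> \<omega>) ?Q = of_nat (card (V \<inter> ?Q))"
        unfolding V_def using only[OF x] by (intro emeasure_simple_locally_finite good) (auto simp: V_def)
      then have 1: "emeasure (\<nu> \<omega>) ?Q = 1" using only[OF x] by simp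
      have fin: "finite (V \<inter> ?C)" using finV by (rule rev_finite_subset) auto
      then have "emeasure (\<nu> \<omega>) ?C = of_nat (card (V \<inter> ?C))"
        unfolding V_def by (intro emeasure_simple_locally_finite good) auto
      then have 2: "emeasure (\<nu> \<omega>) ?C = of_nat k \<longleftrightarrow> card {y\<in>V. y \<noteq> x \<and> d x y \<le> t} = k"
        by (simp add: nbrs[OF x])
      show ?thesis
        using 1 2 \<omega> fin x vertex_degree_threshold[of d x V t] d_sym
        by (simp add: lone_point_def nbrs[OF x] Let_def)
    qed
    have none: "\<omega> \<notin> lone_point E t k m j" if "j \<notin> ix ` (V \<inter> E)" for j
    proof -
      have "V \<inter> (E \<inter> cell m j) = {}"
      proof safe
        fix x assume "x \<in> V" "x \<in> E" "x \<in> cell m j"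
        then have "ix x = j" using cell_unique[OF ix] by blast
        then show "x \<in> {}" using that \<open>x \<in> V\<close> \<open>x \<in> E\<close> by auto
      qed
      then have "emeasure (\<nu> \<omega>) (E \<inter> cell m j) = 0"
        using emeasure_simple_locally_finite[OF good, of "E \<inter> cell m j"] by (simp add: V_def)
      then show ?thesis by (simp add: lone_point_def)
    qed
    have "(\<Sum>j<J m. indicator (lone_point E t k m j) \<omega> :: real) =
       (\<Sum>j\<in>ix ` (V \<inter> E). indicator (lone_point E t k m j) \<omega>)"
      using ixJ none by (intro sum.mono_neutral_right) (auto simp: indicator_def)
    also have "\<dots> = (\<Sum>x\<in>V \<inter> E. indicator (lone_point E t k m (ix x)) \<omega>)"
      using inj by (subst sum.reindex) auto
    also have "\<dots> = (\<Sum>x\<in>V \<inter> E. of_bool (?deg x))"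
      using iso by (intro sum.cong) (auto simp: indicator_def)
    finally show ?case by (simp add: degree_count_def V_def)
  qed
qed

lemma ex_finitely_many_cells:
  assumes E[measurable]: "E \<in> sets \<mu>" and fin: "emeasure \<mu> E < \<infinity>" and "0 < e"
  shows "\<exists>n. measure \<mu> E - e \<le> (\<Sum>j<n. measure \<mu> (E \<inter> cell m j))"
proof -
  have "(\<lambda>j. measure \<mu> (E \<inter> cell m j)) sums measure \<mu> (\<Union>j. E \<inter> cell m j)"
  proof (rule measure_UNION)
    show "emeasure \<mu> (\<Union>j. E \<inter> cell m j) \<noteq> \<infinity>"
      using emeasure_finite_subset[OF fin E, of "\<Union>j. E \<inter> cell m j"] by auto
  qed (auto simp: disjoint_family_on_def dest: cell_unique)
  also have "(\<Union>j. E \<inter> cell m j) = E" using cell_UN[of m] by auto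
  finally have "(\<lambda>n. \<Sum>j<n. measure \<mu> (E \<inter> cell m j)) \<longlonglongrightarrow> measure \<mu> E" by (simp add: sums_def)
  then have "eventually (\<lambda>n. measure \<mu> E - e < (\<Sum>j<n. measure \<mu> (E \<inter> cell m j))) sequentially"
    by (rule order_tendstoD) (use \<open>0 < e\<close> in simp)
  then show ?thesis by (meson eventually_happens' less_imp_le sequentially_bot)
qed

lemma sum_cells_eq:
  assumes E[measurable]: "E \<in> sets \<mu>" and fin: "emeasure \<mu> E < \<infinity>"
  shows "(\<Sum>j<n. measure \<mu> (E \<inter> cell m j)) = measure \<mu> (E \<inter> (\<Union>j<n. cell m j))"
proof -
  have "(\<Sum>j<n. measure \<mu> (E \<inter> cell m j)) = measure \<mu> (\<Union>j<n. E \<inter> cell m j)"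
    using emeasure_cell_finite[OF E, THEN less_imp_neq]
    by (intro measure_finite_Union[symmetric]) (auto simp: disjoint_family_on_def dest: cell_unique)
  also have "(\<Union>j<n. E \<inter> cell m j) = E \<inter> (\<Union>j<n. cell m j)" by auto
  finally show ?thesis .
qed

text \<open>The variance bound passes from the discretisations to the degree count by Fatou's lemma.  The
  degree count itself need not be measurable, because the realisations in the null set of those that are
  not locally finite are arbitrary; \<open>N\<close> is a measurable version of it.\<close>

lemma degree_count_L2:
  assumes E[measurable]: "E \<in> sets \<mu>" and fin: "emeasure \<mu> E < \<infinity>" and t: "0 \<le> t"
  obtains N where "N \<in> borel_measurable P" "AE \<omega> in P. degree_count t k E \<omega> = N \<omega>"
    "(\<integral>\<^sup>+\<omega>. ennreal ((N \<omega> - measure \<mu> E * poisson_weight (vol t) k)\<^sup>2) \<partial>P) \<le>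
       ennreal (measure \<mu> E * (1 + vol (2 * t + 3)))"
proof -
  have "\<forall>m. \<exists>n. measure \<mu> E - (1/2)^m \<le> (\<Sum>j<n. measure \<mu> (E \<inter> cell m j))"
    by (intro allI ex_finitely_many_cells E fin) simp
  then obtain J where J: "\<And>m. measure \<mu> E - (1/2)^m \<le> (\<Sum>j<J m. measure \<mu> (E \<inter> cell m j))"
    by metis
  \<comment> \<open>\<open>J m\<close> is chosen such that the first \<open>J m\<close> cells miss so little of \<open>E\<close> that, by Borel-Cantelli, the
    missing part contains no points from some \<open>m\<close> on\<close>
  define a where "a m = (\<Sum>j<J m. measure \<mu> (E \<inter> cell m j))" for m
  define S where "S m \<omega> = (\<Sum>j<J m. indicator (lone_point E t k m j) \<omega> :: real)" for m \<omega>
  define N where "N \<omega> = lim (\<lambda>m. S m \<omega>)" for \<omega>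
  define c where "c = measure \<mu> E * poisson_weight (vol t) k"
  define p where "p m = (\<Sum>j<J m. prob (lone_point E t k m j))" for m
  have S_meas [measurable]: "S m \<in> borel_measurable P" for m unfolding S_def by measurable
  have N_meas: "N \<in> borel_measurable P" unfolding N_def by measurable
  let ?R = "\<lambda>m. E - (\<Union>j<J m. cell m j)"
  have a_le: "a m \<le> measure \<mu> E" for m
    unfolding a_def sum_cells_eq[OF E fin] using fin by (intro measure_mono_fmeasurable) (auto simp: fmeasurable_def)
  have finR: "emeasure \<mu> (?R m) < \<infinity>" for m
    by (rule emeasure_finite_subset[OF fin]) auto
  have R: "measure \<mu> (?R m) \<le> (1/2)^m" for m
  proof -
    have "measure \<mu> (?R m) = measure \<mu> (E - E \<inter> (\<Union>j<J m. cell m j))"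
      by (intro arg_cong[where f="measure \<mu>"]) auto
    also have "\<dots> = measure \<mu> E - a m"
      unfolding a_def sum_cells_eq[OF E fin] using fin by (intro measure_Diff) auto
    finally show ?thesis using J[of m] by (simp add: a_def)
  qed
  have "AE \<omega> in P. eventually (\<lambda>m. \<omega> \<in> space P - {\<omega>\<in>space P. emeasure (\<nu> \<omega>) (?R m) \<noteq> 0}) sequentially"
  proof (rule borel_cantelli_AE1)
    show "summable (\<lambda>m. prob {\<omega>\<in>space P. emeasure (\<nu> \<omega>) (?R m) \<noteq> 0})"
    proof (rule summable_comparison_test')
      show "summable (\<lambda>m. (1/2)^m :: real)" by (rule summable_geometric) simp
      show "norm (prob {\<omega>\<in>space P. emeasure (\<nu> \<omega>) (?R m) \<noteq> 0}) \<le> (1/2)^m" for m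
        using order_trans[OF prob_count_ne_0_le[OF _ finR[of m]] R[of m]] by simp
    qed
  qed (auto simp: emeasure_eq_measure)
  with AE_simple_locally_finite AE_finite_atoms[OF E fin]
  have ev: "AE \<omega> in P. eventually (\<lambda>m. S m \<omega> = degree_count t k E \<omega>) sequentially"
  proof eventually_elim
    case (elim \<omega>)
    then have "eventually (\<lambda>m. emeasure (\<nu> \<omega>) (?R m) = 0) sequentially"
      by (auto elim!: eventually_mono)
    with elim show ?case
      unfolding S_def by (intro eventually_sum_lone_points_eq_degree_count E t) auto
  qed
  then have conv: "AE \<omega> in P. (\<lambda>m. S m \<omega>) \<longlonglongrightarrow> degree_count t k E \<omega>"
    by eventually_elim (rule tendsto_eventually)
  then have AEN: "AE \<omega> in P. degree_count t k E \<omega> = N \<omega>"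
    by eventually_elim (simp add: N_def limI)
  have pow: "(\<lambda>m. (1/2::real)^m) \<longlonglongrightarrow> 0" by (rule LIMSEQ_power_zero) simp
  have a_lim: "a \<longlonglongrightarrow> measure \<mu> E"
  proof (rule tendsto_sandwich[OF _ _ _ tendsto_const])
    show "(\<lambda>m. measure \<mu> E - (1/2)^m) \<longlonglongrightarrow> measure \<mu> E"
      using tendsto_diff[OF tendsto_const pow] by simp
  qed (use J a_le in \<open>auto simp: a_def\<close>)
  have p_lim: "p \<longlonglongrightarrow> c"
  proof -
    let ?v = "\<lambda>m. vol (t + mesh m)"
    let ?w = "\<lambda>m s. exp (- ?v m) * (?v m - s) ^ k / fact k"
    have v: "?v \<longlonglongrightarrow> vol t" by (rule vol_mesh_add_tendsto)
    have "(\<lambda>m. a m * ?w m 0) \<longlonglongrightarrow> measure \<mu> E * (exp (- vol t) * (vol t - 0) ^ k / fact k)"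
      by (intro tendsto_intros a_lim v) auto
    then have upper: "(\<lambda>m. a m * ?w m 0) \<longlonglongrightarrow> c" by (simp add: c_def poisson_weight_def)
    have "(\<lambda>m. a m * ?w m (vol (mesh m))) \<longlonglongrightarrow> measure \<mu> E * (exp (- vol t) * (vol t - 0) ^ k / fact k)"
      by (intro tendsto_intros a_lim v vol_mesh_tendsto) auto
    then have lower: "(\<lambda>m. a m * ?w m (vol (mesh m))) \<longlonglongrightarrow> c" by (simp add: c_def poisson_weight_def)
    have vv: "vol (mesh m) \<le> ?v m" for m using t by (intro vol_mono) auto
    have w_mono: "?w m s' \<le> ?w m s" if "s \<le> s'" "s' \<le> ?v m" for m s s'
      using that by (intro divide_right_mono mult_left_mono power_mono) auto
    have pj: "prob (lone_point E t k m j) = measure \<mu> (E \<inter> cell m j) * ?w m (measure \<mu> (E \<inter> cell m j))" for m j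
      by (rule prob_lone_point[OF E t])
    have "p m \<le> a m * ?w m 0" for m
      unfolding p_def a_def sum_distrib_right pj
      by (intro sum_mono mult_left_mono w_mono order_trans[OF measure_cell_le vv]) auto
    moreover have "a m * ?w m (vol (mesh m)) \<le> p m" for m
      unfolding p_def a_def sum_distrib_right pj
      by (intro sum_mono mult_left_mono w_mono measure_cell_le vv) auto
    ultimately show ?thesis
      by (intro tendsto_sandwich[OF _ _ lower upper] always_eventually allI)
  qed
  have "(\<integral>\<^sup>+\<omega>. ennreal ((N \<omega> - c)\<^sup>2) \<partial>P) = (\<integral>\<^sup>+\<omega>. liminf (\<lambda>m. ennreal ((S m \<omega> - c)\<^sup>2)) \<partial>P)"
  proof (rule nn_integral_cong_AE)
    from conv AEN show "AE \<omega> in P. ennreal ((N \<omega> - c)\<^sup>2) = liminf (\<lambda>m. ennreal ((S m \<omega> - c)\<^sup>2))"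
    proof eventually_elim
      case (elim \<omega>)
      then have "(\<lambda>m. ennreal ((S m \<omega> - c)\<^sup>2)) \<longlonglongrightarrow> ennreal ((N \<omega> - c)\<^sup>2)"
        by (intro tendsto_ennrealI tendsto_intros) auto
      then show ?case by (intro lim_imp_Liminf[symmetric]) auto
    qed
  qed
  also have "\<dots> \<le> liminf (\<lambda>m. \<integral>\<^sup>+\<omega>. ennreal ((S m \<omega> - c)\<^sup>2) \<partial>P)"
    by (intro nn_integral_liminf) measurable
  also have "\<dots> \<le> liminf (\<lambda>m. ennreal ((p m - c)\<^sup>2 + a m * (1 + vol (2 * t + 3))))"
  proof (intro Liminf_mono always_eventually allI)
    fix m
    have "(\<integral>\<^sup>+\<omega>. ennreal ((S m \<omega> - c)\<^sup>2) \<partial>P) = ennreal (expectation (\<lambda>\<omega>. (S m \<omega> - c)\<^sup>2))"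
    proof (rule nn_integral_eq_integral)
      have "norm (S m \<omega> - c) \<le> real (J m) + \<bar>c\<bar>" for \<omega>
      proof -
        have "0 \<le> S m \<omega>" unfolding S_def by (intro sum_nonneg) auto
        moreover have "S m \<omega> \<le> (\<Sum>j<J m. 1)" unfolding S_def by (intro sum_mono) (auto simp: indicator_def)
        ultimately show ?thesis by auto
      qed
      then have "\<bar>S m \<omega> - c\<bar>\<^sup>2 \<le> (real (J m) + \<bar>c\<bar>)\<^sup>2" for \<omega> by (intro power_mono) auto
      then show "integrable P (\<lambda>\<omega>. (S m \<omega> - c)\<^sup>2)"
        by (intro integrable_const_bound[where B="(real (J m) + \<bar>c\<bar>)\<^sup>2"]) auto
    qed auto
    also have "\<dots> \<le> ennreal ((p m - c)\<^sup>2 + a m * (1 + vol (2 * t + 3)))"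
      unfolding S_def p_def a_def by (intro ennreal_leI expectation_cells_le E t)
    finally show "(\<integral>\<^sup>+\<omega>. ennreal ((S m \<omega> - c)\<^sup>2) \<partial>P) \<le> ennreal ((p m - c)\<^sup>2 + a m * (1 + vol (2 * t + 3)))" .
  qed
  also have "\<dots> = ennreal ((c - c)\<^sup>2 + measure \<mu> E * (1 + vol (2 * t + 3)))"
    by (intro lim_imp_Liminf tendsto_ennrealI tendsto_intros p_lim a_lim) auto
  finally show thesis
    using that[OF N_meas AEN] by (simp add: c_def)
qed

lemma count_L2:
  assumes E[measurable]: "E \<in> sets \<mu>" and fin: "emeasure \<mu> E < \<infinity>"
  shows "(\<integral>\<^sup>+\<omega>. ennreal ((measure (\<nu> \<omega>) E - measure \<mu> E)\<^sup>2) \<partial>P) = ennreal (measure \<mu> E)"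
proof -
  define m where "m = measure \<mu> E"
  let ?A = "\<lambda>n. {\<omega>\<in>space P. emeasure (\<nu> \<omega>) E = of_nat n}"
  have meas [measurable]: "?A n \<in> sets P" for n by measurable
  have "(\<integral>\<^sup>+\<omega>. ennreal ((measure (\<nu> \<omega>) E - m)\<^sup>2) \<partial>P) =
    (\<integral>\<^sup>+\<omega>. (\<Sum>n. ennreal ((real n - m)\<^sup>2) * indicator (?A n) \<omega>) \<partial>P)"
  proof (rule nn_integral_cong_AE)
    from count_finite[OF assms] AE_space
    show "AE \<omega> in P. ennreal ((measure (\<nu> \<omega>) E - m)\<^sup>2) = (\<Sum>n. ennreal ((real n - m)\<^sup>2) * indicator (?A n) \<omega>)"
    proof eventually_elim
      case (elim \<omega>)
      then obtain n where n: "emeasure (\<nu> \<omega>) E = of_nat n" by blast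
      have "(\<Sum>k. ennreal ((real k - m)\<^sup>2) * indicator (?A k) \<omega>) = (\<Sum>k\<in>{n}. ennreal ((real k - m)\<^sup>2) * indicator (?A k) \<omega>)"
        by (rule suminf_finite) (auto simp: n)
      also have "\<dots> = ennreal ((real n - m)\<^sup>2)" using n elim by simp
      finally show ?case using n by (simp add: measure_def)
    qed
  qed
  also have "\<dots> = (\<Sum>n. \<integral>\<^sup>+\<omega>. ennreal ((real n - m)\<^sup>2) * indicator (?A n) \<omega> \<partial>P)"
    by (rule nn_integral_suminf) measurable
  also have "\<dots> = (\<Sum>n. ennreal ((real n - m)\<^sup>2 * (exp (- m) * m ^ n / fact n)))"
    by (intro suminf_cong)
      (simp add: nn_integral_cmult_indicator emeasure_eq_measure count_pmf[OF assms] ennreal_mult'[symmetric] m_def)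
  also have "\<dots> = ennreal m"
    using poisson_variance_sums[of m] by (intro suminf_ennreal_eq) (auto simp: m_def)
  finally show ?thesis by (simp add: m_def)
qed

end

section \<open>The law of large numbers\<close>

lemma borel_measurable_completion_AE:
  fixes f g :: "'a \<Rightarrow> real"
  assumes f: "f \<in> borel_measurable M" and ae: "AE x in M. g x = f x"
  shows "g \<in> borel_measurable (completion M)"
proof (rule measurableI)
  fix S :: "real set" assume S: "S \<in> sets borel"
  have f': "f -` S \<inter> space (completion M) \<in> sets (completion M)"
    using measurable_sets[OF measurable_completion[OF f] S] .
  have "AE x in completion M. x \<in> f -` S \<inter> space (completion M) \<longleftrightarrow> x \<in> g -` S \<inter> space (completion M)"
    using AE_completion[OF ae] by eventually_elim auto
  then show "g -` S \<inter> space (completion M) \<in> sets (completion M)"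
    using completion.in_sets_AE[OF _ f', of "g -` S \<inter> space (completion M)"] by auto
qed auto

context prob_space
begin

lemma chebyshev_L2:
  assumes W[measurable]: "W \<in> borel_measurable M" and L2: "(\<integral>\<^sup>+x. ennreal ((W x)\<^sup>2) \<partial>M) \<le> ennreal K"
    and "0 < r" "0 \<le> K"
  shows "prob {x\<in>space M. r < \<bar>W x\<bar>} \<le> K / r\<^sup>2"
proof -
  have "emeasure M {x\<in>space M. r < \<bar>W x\<bar>} \<le> emeasure M {x\<in>space M. 1 \<le> ennreal (1 / r\<^sup>2) * ennreal ((W x)\<^sup>2)}"
  proof (rule emeasure_mono)
    have "1 \<le> ennreal (1 / r\<^sup>2) * ennreal ((W x)\<^sup>2)" if "r < \<bar>W x\<bar>" for x
    proof -
      have "r\<^sup>2 \<le> \<bar>W x\<bar>\<^sup>2" using that \<open>0 < r\<close> by (intro power_mono) auto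
      then have "1 \<le> 1 / r\<^sup>2 * (W x)\<^sup>2" using \<open>0 < r\<close> by (simp add: field_simps)
      then show ?thesis by (simp add: ennreal_mult[symmetric])
    qed
    then show "{x\<in>space M. r < \<bar>W x\<bar>} \<subseteq> {x\<in>space M. 1 \<le> ennreal (1 / r\<^sup>2) * ennreal ((W x)\<^sup>2)}" by auto
  qed measurable
  also have "\<dots> \<le> ennreal (1 / r\<^sup>2) * (\<integral>\<^sup>+x. ennreal ((W x)\<^sup>2) * indicator (space M) x \<partial>M)"
    by (rule nn_integral_Markov_inequality) measurable
  also have "(\<integral>\<^sup>+x. ennreal ((W x)\<^sup>2) * indicator (space M) x \<partial>M) = (\<integral>\<^sup>+x. ennreal ((W x)\<^sup>2) \<partial>M)"
    by (rule nn_integral_cong) simp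
  also have "ennreal (1 / r\<^sup>2) * (\<integral>\<^sup>+x. ennreal ((W x)\<^sup>2) \<partial>M) \<le> ennreal (1 / r\<^sup>2) * ennreal K"
    by (intro mult_left_mono L2) simp
  also have "\<dots> = ennreal (K / r\<^sup>2)" using \<open>0 \<le> K\<close> by (simp add: ennreal_mult[symmetric])
  finally show ?thesis using \<open>0 \<le> K\<close> \<open>0 < r\<close> by (simp add: emeasure_eq_measure)
qed

text \<open>Numerator and denominator both have variance of order \<open>s n\<close>, so that Chebyshev's inequality bounds
  the probability of a relative deviation \<open>\<eta>\<close> by a constant times \<open>1 / (\<eta>\<^sup>2 * s n)\<close>.\<close>

lemma ratio_law_of_large_numbers:
  fixes X Y :: "nat \<Rightarrow> 'a \<Rightarrow> real" and s :: "nat \<Rightarrow> real" and C \<pi> :: real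
  assumes X[measurable]: "\<And>n. X n \<in> borel_measurable M" and Y[measurable]: "\<And>n. Y n \<in> borel_measurable M"
    and C: "0 \<le> C" and \<pi>: "0 \<le> \<pi>" "\<pi> \<le> 1" and s: "\<And>n. 0 \<le> s n" "filterlim s at_top sequentially"
    and X2: "\<And>n. (\<integral>\<^sup>+x. ennreal ((X n x - s n * \<pi>)\<^sup>2) \<partial>M) \<le> ennreal (C * s n)"
    and Y2: "\<And>n. (\<integral>\<^sup>+x. ennreal ((Y n x - s n)\<^sup>2) \<partial>M) \<le> ennreal (C * s n)"
  defines "Z \<equiv> \<lambda>n x. if 0 < Y n x then 1 / Y n x * X n x else 0"
  shows "tendsto_in_prob M Z (\<lambda>_. \<pi>)"
    and "summable (\<lambda>n. 1 / s n) \<Longrightarrow> AE x in M. (\<lambda>n. Z n x) \<longlonglongrightarrow> \<pi>"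
proof -
  define bad where "bad \<eta> n = {x\<in>space M. \<eta> * s n < \<bar>X n x - s n * \<pi>\<bar>} \<union> {x\<in>space M. \<eta> * s n < \<bar>Y n x - s n\<bar>}" for \<eta> n
  have bad_ev [measurable]: "bad \<eta> n \<in> events" for \<eta> n unfolding bad_def by measurable
  have Z_meas [measurable]: "Z n \<in> borel_measurable M" for n unfolding Z_def by measurable
  have s_pos: "eventually (\<lambda>n. 0 < s n) sequentially"
    using s(2) by (simp add: filterlim_at_top_dense)
  have bad_prob: "prob (bad \<eta> n) \<le> 2 * C / \<eta>\<^sup>2 * (1 / s n)" if "0 < \<eta>" "0 < s n" for \<eta> n
  proof -
    have "prob (bad \<eta> n) \<le> prob {x\<in>space M. \<eta> * s n < \<bar>X n x - s n * \<pi>\<bar>} + prob {x\<in>space M. \<eta> * s n < \<bar>Y n x - s n\<bar>}"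
      unfolding bad_def by (intro measure_Un_le) auto
    also have "\<dots> \<le> C * s n / (\<eta> * s n)\<^sup>2 + C * s n / (\<eta> * s n)\<^sup>2"
      using that C s by (intro add_mono chebyshev_L2 X2 Y2) auto
    also have "\<dots> = 2 * C / \<eta>\<^sup>2 * (1 / s n)"
      using that by (simp add: field_simps power2_eq_square)
    finally show ?thesis .
  qed
  have off_bad: "\<bar>Z n x - \<pi>\<bar> \<le> 4 * \<eta>" if x: "x \<in> space M" "x \<notin> bad \<eta> n" and \<eta>: "0 < \<eta>" "\<eta> \<le> 1/2" and sn: "0 < s n" for \<eta> n x
  proof -
    have 1: "\<bar>X n x - s n * \<pi>\<bar> \<le> \<eta> * s n" and 2: "\<bar>Y n x - s n\<bar> \<le> \<eta> * s n"
      using x by (auto simp: bad_def)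
    have "\<eta> * s n \<le> 1/2 * s n" using \<eta> sn by (intro mult_right_mono) auto
    then have Yn: "s n / 2 \<le> Y n x" using 2 by auto
    then have Y0: "0 < Y n x" using sn by simp
    have "\<bar>X n x - Y n x * \<pi>\<bar> \<le> \<bar>X n x - s n * \<pi>\<bar> + \<bar>(Y n x - s n) * \<pi>\<bar>" by (simp add: algebra_simps)
    also have "\<bar>(Y n x - s n) * \<pi>\<bar> \<le> \<bar>Y n x - s n\<bar> * 1" unfolding abs_mult using \<pi> by (intro mult_left_mono) auto
    finally have "\<bar>X n x - Y n x * \<pi>\<bar> \<le> 2 * \<eta> * s n" using 1 2 by simp
    also have "\<dots> \<le> 4 * \<eta> * Y n x"
      using mult_left_mono[OF Yn, of "4 * \<eta>"] \<eta> by simp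
    finally have "\<bar>X n x - Y n x * \<pi>\<bar> / Y n x \<le> 4 * \<eta>" using Y0 by (simp add: field_simps)
    moreover have "Z n x - \<pi> = (X n x - Y n x * \<pi>) / Y n x" using Y0 by (simp add: Z_def field_simps)
    ultimately show ?thesis using Y0 by (simp add: abs_divide)
  qed
  show "tendsto_in_prob M Z (\<lambda>_. \<pi>)"
    unfolding tendsto_in_prob_def
  proof (intro conjI allI impI)
    fix \<epsilon> :: real assume "0 < \<epsilon>"
    define \<eta> where "\<eta> = min (1/2) (\<epsilon> / 4)"
    have \<eta>: "0 < \<eta>" "\<eta> \<le> 1/2" "4 * \<eta> \<le> \<epsilon>" using \<open>0 < \<epsilon>\<close> by (auto simp: \<eta>_def)
    show "(\<lambda>n. prob {x\<in>space M. \<epsilon> < \<bar>Z n x - \<pi>\<bar>}) \<longlonglongrightarrow> 0"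
    proof (rule tendsto_sandwich[OF _ _ tendsto_const])
      show "eventually (\<lambda>n. prob {x\<in>space M. \<epsilon> < \<bar>Z n x - \<pi>\<bar>} \<le> 2 * C / \<eta>\<^sup>2 * (1 / s n)) sequentially"
        using s_pos
      proof eventually_elim
        case (elim n)
        have "{x\<in>space M. \<epsilon> < \<bar>Z n x - \<pi>\<bar>} \<subseteq> bad \<eta> n"
          using off_bad[OF _ _ \<eta>(1,2) elim] \<eta>(3) by force
        then have "prob {x\<in>space M. \<epsilon> < \<bar>Z n x - \<pi>\<bar>} \<le> prob (bad \<eta> n)"
          by (intro finite_measure_mono) auto
        also have "\<dots> \<le> 2 * C / \<eta>\<^sup>2 * (1 / s n)" by (rule bad_prob[OF \<eta>(1) elim])
        finally show ?case .
      qed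
      have "(\<lambda>n. 1 / s n) \<longlonglongrightarrow> 0"
        using tendsto_inverse_0_at_top[OF s(2)] by (simp add: inverse_eq_divide)
      then show "(\<lambda>n. 2 * C / \<eta>\<^sup>2 * (1 / s n)) \<longlonglongrightarrow> 0" by (rule tendsto_mult_right_zero)
    qed auto
  qed auto
  assume summ: "summable (\<lambda>n. 1 / s n)"
  let ?\<eta> = "\<lambda>i. 1 / real (i + 2)"
  have "AE x in M. \<forall>i. eventually (\<lambda>n. x \<in> space M - bad (?\<eta> i) n) sequentially"
    unfolding AE_all_countable
  proof (intro allI borel_cantelli_AE1)
    fix i
    show "summable (\<lambda>n. prob (bad (?\<eta> i) n))"
    proof (rule summable_comparison_test_ev)
      show "summable (\<lambda>n. 2 * C / (?\<eta> i)\<^sup>2 * (1 / s n))" by (intro summable_mult summ)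
      show "eventually (\<lambda>n. norm (prob (bad (?\<eta> i) n)) \<le> 2 * C / (?\<eta> i)\<^sup>2 * (1 / s n)) sequentially"
        using s_pos
      proof eventually_elim
        case (elim n)
        then show ?case using bad_prob[of "?\<eta> i" n] by simp
      qed
    qed
  qed (auto simp: emeasure_eq_measure)
  then show "AE x in M. (\<lambda>n. Z n x) \<longlonglongrightarrow> \<pi>"
  proof eventually_elim
    case (elim x)
    show ?case
    proof (rule LIMSEQ_I)
      fix r :: real assume "0 < r"
      obtain i where i: "inverse (real (Suc i)) < r / 4" using reals_Archimedean[of "r / 4"] \<open>0 < r\<close> by auto
      have "1 / real (i + 2) \<le> inverse (real (Suc i))" by (simp add: field_simps)
      with i have i': "4 * (1 / real (i + 2)) < r" by simp
      have "eventually (\<lambda>n. norm (Z n x - \<pi>) < r) sequentially"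
        using elim[rule_format, of i] s_pos
      proof eventually_elim
        case (elim n)
        then have "\<bar>Z n x - \<pi>\<bar> \<le> 4 * ?\<eta> i" by (intro off_bad) auto
        then show ?case using i' by simp
      qed
      then show "\<exists>no. \<forall>n\<ge>no. norm (Z n x - \<pi>) < r" by (simp add: eventually_sequentially)
    qed
  qed
qed

lemma tendsto_in_prob_completion:
  assumes conv: "tendsto_in_prob M Z (\<lambda>_. c)" and ae: "\<And>n. AE x in M. p n x = Z n x"
  shows "tendsto_in_prob (completion M) p (\<lambda>_. c)"
  unfolding tendsto_in_prob_def
proof (intro conjI allI impI)
  have Z[measurable]: "Z n \<in> borel_measurable M" for n using conv by (simp add: tendsto_in_prob_def)
  show p: "p n \<in> borel_measurable (completion M)" for n
    by (rule borel_measurable_completion_AE[OF Z ae])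
  fix \<epsilon> :: real assume "0 < \<epsilon>"
  have "measure (completion M) {x\<in>space (completion M). \<epsilon> < \<bar>p n x - c\<bar>} = prob {x\<in>space M. \<epsilon> < \<bar>Z n x - c\<bar>}" for n
  proof -
    have "measure (completion M) {x\<in>space (completion M). \<epsilon> < \<bar>p n x - c\<bar>} = measure (completion M) {x\<in>space M. \<epsilon> < \<bar>Z n x - c\<bar>}"
    proof (rule measure_eq_AE)
      show "AE x in completion M. x \<in> {x\<in>space (completion M). \<epsilon> < \<bar>p n x - c\<bar>} \<longleftrightarrow> x \<in> {x\<in>space M. \<epsilon> < \<bar>Z n x - c\<bar>}"
        using AE_completion[OF ae[of n]] by eventually_elim auto
      show "{x\<in>space (completion M). \<epsilon> < \<bar>p n x - c\<bar>} \<in> sets (completion M)"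
        using p[of n] by measurable
    qed (intro sets_completionI_sets, measurable)
    also have "\<dots> = prob {x\<in>space M. \<epsilon> < \<bar>Z n x - c\<bar>}" by (intro measure_completion) measurable
    finally show ?thesis .
  qed
  then show "(\<lambda>n. measure (completion M) {x\<in>space (completion M). \<epsilon> < \<bar>p n x - c\<bar>}) \<longlonglongrightarrow> 0"
    using conv \<open>0 < \<epsilon>\<close> by (simp add: tendsto_in_prob_def)
qed auto

end

lemma summable_inverse_measure:
  assumes sum: "(\<Sum>n. 1 / emeasure M (E n)) < \<infinity>" and fin: "\<And>n. emeasure M (E n) < \<infinity>"
  shows "summable (\<lambda>n. 1 / measure M (E n))"
proof -
  have ne: "emeasure M (E n) \<noteq> 0" for n
  proof
    assume "emeasure M (E n) = 0"
    then have "(\<Sum>k\<in>{n}. 1 / emeasure M (E k)) = \<infinity>" by simp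
    moreover have "(\<Sum>k\<in>{n}. 1 / emeasure M (E k)) \<le> (\<Sum>n. 1 / emeasure M (E n))"
      by (intro sum_le_suminf) auto
    ultimately show False using sum by (auto simp: top_unique)
  qed
  have eq: "1 / emeasure M (E n) = ennreal (1 / measure M (E n))" for n
  proof -
    have e: "emeasure M (E n) = ennreal (measure M (E n))"
      using fin[of n] by (intro emeasure_eq_ennreal_measure) auto
    then have "measure M (E n) \<noteq> 0" using ne[of n] by auto
    then have "0 < measure M (E n)" by (simp add: zero_less_measure_iff)
    then show ?thesis unfolding e using divide_ennreal[of 1 "measure M (E n)"] by simp
  qed
  show ?thesis
    using sum unfolding eq by (intro summable_suminf_not_top) auto
qed

context homogeneous_poisson
begin

theorem degree_frequencies:
  fixes k :: nat
  assumes E[measurable]: "\<And>n. E n \<in> sets \<mu>" and fin: "\<And>n. emeasure \<mu> (E n) < \<infinity>"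
    and inc: "incseq E" and UN: "(\<Union>n. E n) = UNIV" and inf: "emeasure \<mu> UNIV = \<infinity>" and t: "0 \<le> t"
  defines "p \<equiv> \<lambda>n \<omega>. p_hat d t (\<nu> \<omega>) (E n) k"
  shows "tendsto_in_prob (completion P) p (\<lambda>_. poisson_weight (vol t) k)"
    and "(\<Sum>n. 1 / emeasure \<mu> (E n)) < \<infinity> \<Longrightarrow> AE \<omega> in P. (\<lambda>n. p n \<omega>) \<longlonglongrightarrow> poisson_weight (vol t) k"
proof -
  define s where "s n = measure \<mu> (E n)" for n
  define C where "C = 1 + vol (2 * t + 3)"
  have C: "1 \<le> C" using vol_nonneg by (simp add: C_def)
  have e_s: "emeasure \<mu> (E n) = ennreal (s n)" for n
    unfolding s_def using fin[of n] by (intro emeasure_eq_ennreal_measure) auto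
  have "\<forall>n. \<exists>N. N \<in> borel_measurable P \<and> (AE \<omega> in P. degree_count t k (E n) \<omega> = N \<omega>) \<and>
    (\<integral>\<^sup>+\<omega>. ennreal ((N \<omega> - s n * poisson_weight (vol t) k)\<^sup>2) \<partial>P) \<le> ennreal (C * s n)"
  proof
    fix n
    show "\<exists>N. N \<in> borel_measurable P \<and> (AE \<omega> in P. degree_count t k (E n) \<omega> = N \<omega>) \<and>
      (\<integral>\<^sup>+\<omega>. ennreal ((N \<omega> - s n * poisson_weight (vol t) k)\<^sup>2) \<partial>P) \<le> ennreal (C * s n)"
      by (rule degree_count_L2[OF E fin t, of k n], rule exI) (simp add: s_def C_def mult.commute)
  qed
  from choice[OF this] obtain X where X': "\<forall>n. X n \<in> borel_measurable P \<and> (AE \<omega> in P. degree_count t k (E n) \<omega> = X n \<omega>) \<and>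
    (\<integral>\<^sup>+\<omega>. ennreal ((X n \<omega> - s n * poisson_weight (vol t) k)\<^sup>2) \<partial>P) \<le> ennreal (C * s n)" ..
  have X: "X n \<in> borel_measurable P" "AE \<omega> in P. degree_count t k (E n) \<omega> = X n \<omega>"
    "(\<integral>\<^sup>+\<omega>. ennreal ((X n \<omega> - s n * poisson_weight (vol t) k)\<^sup>2) \<partial>P) \<le> ennreal (C * s n)" for n
    using X'[rule_format, of n] by blast+
  define Y where "Y n \<omega> = measure (\<nu> \<omega>) (E n)" for n \<omega>
  have Y: "Y n \<in> borel_measurable P" for n unfolding Y_def measure_def by measurable
  have Y2: "(\<integral>\<^sup>+\<omega>. ennreal ((Y n \<omega> - s n)\<^sup>2) \<partial>P) \<le> ennreal (C * s n)" for n
  proof -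
    have "s n \<le> C * s n" using mult_right_mono[OF C, of "s n"] by (simp add: s_def)
    then show ?thesis
      using count_L2[OF E fin] by (simp add: Y_def s_def ennreal_leI)
  qed
  have s_lim: "filterlim s at_top sequentially"
    unfolding filterlim_at_top_dense
  proof
    fix K :: real
    have "(\<lambda>n. emeasure \<mu> (E n)) \<longlonglongrightarrow> \<infinity>"
      using Lim_emeasure_incseq[OF _ inc, of \<mu>] E UN inf by (auto simp: image_subset_iff)
    then have "eventually (\<lambda>n. ennreal K < emeasure \<mu> (E n)) sequentially"
      by (rule order_tendstoD) simp
    then show "eventually (\<lambda>n. K < s n) sequentially"
      unfolding e_s by eventually_elim (metis ennreal_leI leD linorder_le_less_linear)
  qed
  define Z where "Z n \<omega> = (if 0 < Y n \<omega> then 1 / Y n \<omega> * X n \<omega> else 0)" for n \<omega>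
  have pZ: "AE \<omega> in P. p n \<omega> = Z n \<omega>" for n
    using X(2)[of n] count_finite[OF E fin, of n]
  proof eventually_elim
    case (elim \<omega>)
    then obtain i where i: "emeasure (\<nu> \<omega>) (E n) = of_nat i" by blast
    then have "Y n \<omega> = real i" by (simp add: Y_def measure_def)
    then show ?case using elim(1) i
      by (simp add: p_def p_hat_def Z_def Y_def degree_count_def)
  qed
  have s0: "0 \<le> s n" for n by (simp add: s_def)
  have C0: "0 \<le> C" using C by simp
  note lln = ratio_law_of_large_numbers[OF X(1) Y C0 poisson_weight_nonneg[OF vol_nonneg]
      poisson_weight_le_1[OF vol_nonneg] s0 s_lim X(3) Y2, folded Z_def]
  show "tendsto_in_prob (completion P) p (\<lambda>_. poisson_weight (vol t) k)"
    by (rule tendsto_in_prob_completion[OF _ pZ]) (rule lln(1)[unfolded Z_def[symmetric]])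
  assume "(\<Sum>n. 1 / emeasure \<mu> (E n)) < \<infinity>"
  then have "summable (\<lambda>n. 1 / s n)"
    unfolding s_def using fin by (rule summable_inverse_measure)
  then have "AE \<omega> in P. (\<lambda>n. Z n \<omega>) \<longlonglongrightarrow> poisson_weight (vol t) k" by (rule lln(2))
  moreover have "AE \<omega> in P. \<forall>n. p n \<omega> = Z n \<omega>" using pZ by (simp add: AE_all_countable)
  ultimately show "AE \<omega> in P. (\<lambda>n. p n \<omega>) \<longlonglongrightarrow> poisson_weight (vol t) k"
    by eventually_elim simp
qed

end

section \<open>Change of variables for arbitrary finite index types\<close>

text \<open>The change of variables formula is proved for \<open>real ^ 'm\<close> with a well-ordered index type \<open>'m\<close> first
  and then transferred to any finite index type \<open>'n\<close> along a bijection from a well-ordered type with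
  as many elements.\<close>

typedef 'n ordered_index = "{..<CARD('n::finite)}"
  by (auto intro!: exI[of _ 0])

instance ordered_index :: (finite) finite
proof
  have "(UNIV :: 'a ordered_index set) = Abs_ordered_index ` {..<CARD('a)}"
    by (rule type_definition.Abs_image[OF type_definition_ordered_index, symmetric])
  moreover have "finite (Abs_ordered_index ` {..<CARD('a)} :: 'a ordered_index set)" by (rule finite_imageI) simp
  ultimately show "finite (UNIV :: 'a ordered_index set)" by metis
qed

instantiation ordered_index :: (finite) wellorder
begin

definition "i \<le> j \<longleftrightarrow> Rep_ordered_index i \<le> Rep_ordered_index j"
definition "i < j \<longleftrightarrow> Rep_ordered_index i < Rep_ordered_index j"

instance
proof
  fix Q :: "'a ordered_index \<Rightarrow> bool" and a
  assume step: "\<And>x. (\<And>y. y < x \<Longrightarrow> Q y) \<Longrightarrow> Q x"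
  show "Q a"
    by (induction a rule: measure_induct_rule[of Rep_ordered_index]) (auto intro: step simp: less_ordered_index_def)
qed (auto simp: less_eq_ordered_index_def less_ordered_index_def Rep_ordered_index_inject)

end

lemma ex_index_bij: "\<exists>\<sigma> :: 'n::finite ordered_index \<Rightarrow> 'n. bij \<sigma>"
proof -
  obtain h where "bij_betw h {..<CARD('n)} (UNIV :: 'n set)"
    using ex_bij_betw_nat_finite[of "UNIV :: 'n set"] by (auto simp: lessThan_atLeast0)
  moreover have "bij_betw Rep_ordered_index (UNIV :: 'n ordered_index set) {..<CARD('n)}"
    using type_definition.Rep_range[OF type_definition_ordered_index] Rep_ordered_index_inject
    by (auto simp: bij_betw_def inj_on_def)
  ultimately show ?thesis using bij_betw_trans by blast
qed

lemma swapidseq_conjugate: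
  assumes "swapidseq n p" "bij \<sigma>"
  shows "swapidseq n (inv \<sigma> \<circ> p \<circ> \<sigma>)"
  using assms(1)
proof induction
  case id
  have eq: "inv \<sigma> \<circ> id \<circ> \<sigma> = id" using assms(2) by (auto simp: fun_eq_iff bij_is_inj)
  show ?case unfolding eq by (rule swapidseq.id)
next
  case (comp_Suc n p a b)
  have "inv \<sigma> \<circ> (Transposition.transpose a b \<circ> p) \<circ> \<sigma> = Transposition.transpose (inv \<sigma> a) (inv \<sigma> b) \<circ> (inv \<sigma> \<circ> p \<circ> \<sigma>)"
  proof
    fix x
    show "(inv \<sigma> \<circ> (Transposition.transpose a b \<circ> p) \<circ> \<sigma>) x = (Transposition.transpose (inv \<sigma> a) (inv \<sigma> b) \<circ> (inv \<sigma> \<circ> p \<circ> \<sigma>)) x"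
      using assms(2) by (auto simp: Transposition.transpose_def) (metis bij_inv_eq_iff)+
  qed
  moreover have "inv \<sigma> a \<noteq> inv \<sigma> b" using comp_Suc assms(2) by (metis bij_inv_eq_iff)
  ultimately show ?case using comp_Suc swapidseq.comp_Suc by metis
qed

text \<open>Conjugation by a bijection \<open>\<sigma>\<close> between two types carries transpositions to transpositions, so it
  preserves signs, and the determinant does not depend on the names of the indices.\<close>

lemma sign_conjugate:
  fixes p :: "'n::finite \<Rightarrow> 'n" and \<sigma> :: "'m \<Rightarrow> 'n"
  assumes p: "p permutes UNIV" and "bij \<sigma>"
  shows "sign (inv \<sigma> \<circ> p \<circ> \<sigma>) = sign p"
proof -
  have "permutation p" using p by (auto simp: permutation_permutes)
  then obtain n where n: "swapidseq n p" by (auto simp: permutation_def)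
  have "evenperm p = even n" using n by (rule evenperm_unique) simp
  moreover have "evenperm (inv \<sigma> \<circ> p \<circ> \<sigma>) = even n"
    using swapidseq_conjugate[OF n assms(2)] by (rule evenperm_unique) simp
  ultimately show ?thesis by (simp add: sign_def)
qed

lemma det_reindex:
  fixes A :: "real ^ 'n ^ 'n" and \<sigma> :: "'m::finite \<Rightarrow> 'n::finite"
  assumes \<sigma>: "bij \<sigma>"
  shows "det (\<chi> i j. A $ \<sigma> i $ \<sigma> j) = det A"
proof -
  let ?c = "\<lambda>p. inv \<sigma> \<circ> p \<circ> \<sigma>"
  have "bij_betw ?c {p. p permutes (UNIV :: 'n set)} {p. p permutes (UNIV :: 'm set)}"
  proof (rule bij_betw_byWitness[where f' = "\<lambda>p. \<sigma> \<circ> p \<circ> inv \<sigma>"])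
    show "?c ` {p. p permutes UNIV} \<subseteq> {p. p permutes UNIV}"
      using \<sigma> by (auto simp: permutes_univ[symmetric] simp del: permutes_univ simp: bij_imp_permutes intro!: bij_imp_permutes bij_comp bij_imp_bij_inv dest: permutes_bij)
    show "(\<lambda>p. \<sigma> \<circ> p \<circ> inv \<sigma>) ` {p. p permutes UNIV} \<subseteq> {p. p permutes UNIV}"
      using \<sigma> by (auto intro!: bij_imp_permutes bij_comp bij_imp_bij_inv dest: permutes_bij)
  qed (use \<sigma> in \<open>auto simp: fun_eq_iff bij_is_inj bij_is_surj surj_f_inv_f\<close>)
  then have "det (\<chi> i j. A $ \<sigma> i $ \<sigma> j) =
    (\<Sum>p | p permutes (UNIV :: 'n set). of_int (sign (?c p)) * (\<Prod>i\<in>UNIV. A $ \<sigma> i $ \<sigma> (?c p i)))"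
    unfolding det_def by (subst sum.reindex_bij_betw[symmetric, where h="?c"]) auto
  also have "\<dots> = (\<Sum>p | p permutes (UNIV :: 'n set). of_int (sign p) * (\<Prod>i\<in>UNIV. A $ i $ p i))"
  proof (intro sum.cong refl arg_cong2[where f="(*)"])
    fix p :: "'n \<Rightarrow> 'n" assume p: "p \<in> {p. p permutes UNIV}"
    then show "(of_int (sign (?c p)) :: real) = of_int (sign p)" using sign_conjugate[OF _ \<sigma>] by simp
    have "(\<Prod>i\<in>UNIV. A $ \<sigma> i $ \<sigma> (?c p i)) = (\<Prod>i\<in>UNIV. A $ \<sigma> i $ p (\<sigma> i))"
      using \<sigma> by (simp add: bij_is_surj surj_f_inv_f)
    also have "\<dots> = (\<Prod>i\<in>UNIV. A $ i $ p i)" using \<sigma> by (rule prod.reindex_bij_betw)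
    finally show "(\<Prod>i\<in>UNIV. A $ \<sigma> i $ \<sigma> (?c p i)) = (\<Prod>i\<in>UNIV. A $ i $ p i)" .
  qed
  finally show ?thesis by (simp add: det_def)
qed

definition permute_coords :: "('m \<Rightarrow> 'n) \<Rightarrow> real ^ 'n \<Rightarrow> real ^ 'm" where
  "permute_coords \<sigma> x = (\<chi> i. x $ \<sigma> i)"

lemma bounded_linear_permute_coords: "bounded_linear (permute_coords \<sigma> :: real ^ 'n::finite \<Rightarrow> real ^ 'm::finite)"
  unfolding permute_coords_def
  by (rule linear_conv_bounded_linear[THEN iffD1]) (auto intro!: linearI simp: vec_eq_iff)

lemma permute_coords_inverse:
  assumes "bij \<sigma>"
  shows "permute_coords (inv \<sigma>) (permute_coords \<sigma> x) = x" "permute_coords \<sigma> (permute_coords (inv \<sigma>) y) = y"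
  using assms by (auto simp: permute_coords_def vec_eq_iff bij_is_inj bij_is_surj surj_f_inv_f)

lemma measurable_permute_coords [measurable]:
  "permute_coords \<sigma> \<in> borel_measurable (borel :: (real ^ 'n::finite) measure)"
  by (intro borel_measurable_continuous_onI linear_continuous_on bounded_linear_permute_coords)

lemma prod_Basis_cart:
  fixes x :: "real ^ 'n::finite"
  shows "(\<Prod>b\<in>Basis. x \<bullet> b) = (\<Prod>i\<in>UNIV. x $ i)"
proof -
  have "(Basis :: (real ^ 'n) set) = (\<lambda>i. axis i 1) ` UNIV" by (auto simp: Basis_vec_def)
  moreover have "inj (\<lambda>i::'n. axis i (1::real))" by (auto simp: inj_on_def axis_eq_axis)
  ultimately have "(\<Prod>b\<in>Basis. x \<bullet> b) = (\<Prod>i\<in>UNIV. x \<bullet> axis i 1)"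
    using prod.reindex[of "\<lambda>i::'n. axis i (1::real)" UNIV "\<lambda>b. x \<bullet> b"] by (simp add: o_def)
  then show ?thesis by (simp add: inner_axis)
qed

lemma lborel_permute_coords:
  fixes \<sigma> :: "'m::finite \<Rightarrow> 'n::finite"
  assumes \<sigma>: "bij \<sigma>"
  shows "distr lborel borel (permute_coords \<sigma>) = lborel"
proof (rule sym, rule lborel_eqI)
  fix l u :: "real ^ 'm" assume "\<And>b. b \<in> Basis \<Longrightarrow> l \<bullet> b \<le> u \<bullet> b"
  then have lu: "l $ i \<le> u $ i" for i by (auto simp: cart_eq_inner_axis axis_in_Basis_iff)
  let ?l = "permute_coords (inv \<sigma>) l" and ?u = "permute_coords (inv \<sigma>) u"
  have "x \<in> box ?l ?u \<longleftrightarrow> permute_coords \<sigma> x \<in> box l u" for x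
  proof -
    have "(\<forall>j. l $ inv \<sigma> j < x $ j \<and> x $ j < u $ inv \<sigma> j) \<longleftrightarrow> (\<forall>i. l $ i < x $ \<sigma> i \<and> x $ \<sigma> i < u $ i)"
      using \<sigma> by (metis bij_inv_eq_iff)
    then show ?thesis by (simp add: mem_box_cart permute_coords_def)
  qed
  then have "permute_coords \<sigma> -` box l u \<inter> space lborel = box ?l ?u" by auto
  then have "emeasure (distr lborel borel (permute_coords \<sigma>)) (box l u) = emeasure lborel (box ?l ?u)"
    by (subst emeasure_distr) auto
  also have "\<dots> = ennreal (\<Prod>b\<in>Basis. (?u - ?l) \<bullet> b)"
    using lu by (intro emeasure_lborel_box) (auto simp: Basis_vec_def inner_axis permute_coords_def)
  also have "(\<Prod>b\<in>Basis. (?u - ?l) \<bullet> b) = (\<Prod>j\<in>UNIV. (u - l) $ inv \<sigma> j)"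
    unfolding prod_Basis_cart by (simp add: permute_coords_def)
  also have "\<dots> = (\<Prod>i\<in>UNIV. (u - l) $ i)"
    using bij_imp_bij_inv[OF \<sigma>] by (rule prod.reindex_bij_betw)
  also have "\<dots> = (\<Prod>b\<in>Basis. (u - l) \<bullet> b)" unfolding prod_Basis_cart ..
  finally show "emeasure (distr lborel borel (permute_coords \<sigma>)) (box l u) = (\<Prod>b\<in>Basis. (u - l) \<bullet> b)" .
qed simp

text \<open>The change of variables formula concerns absolutely integrable functions.  For non-negative
  functions this includes its extension to the value infinity, as each side is finite if and only if the function
  in question is absolutely integrable.\<close>

lemma absolutely_integrable_nonneg_iff:
  fixes w :: "'a::euclidean_space \<Rightarrow> real"
  assumes meas: "(\<lambda>x. indicator S x * w x) \<in> borel_measurable borel" and nonneg: "\<And>x. x \<in> S \<Longrightarrow> 0 \<le> w x"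
  shows "w absolutely_integrable_on S \<longleftrightarrow> (\<integral>\<^sup>+x\<in>S. ennreal (w x) \<partial>lborel) < \<infinity>"
    and "w absolutely_integrable_on S \<Longrightarrow> (\<integral>\<^sup>+x\<in>S. ennreal (w x) \<partial>lborel) = ennreal (integral S w)"
proof -
  let ?w = "\<lambda>x. indicator S x * w x"
  have m[measurable]: "?w \<in> borel_measurable lborel" using meas by simp
  have nn: "0 \<le> ?w x" for x using nonneg by (auto simp: indicator_def)
  have e: "(\<integral>\<^sup>+x\<in>S. ennreal (w x) \<partial>lborel) = (\<integral>\<^sup>+x. ennreal (?w x) \<partial>lborel)"
    by (intro nn_integral_cong) (auto simp: indicator_def)
  have a: "w absolutely_integrable_on S \<longleftrightarrow> integrable lborel ?w"
    unfolding set_integrable_def using integrable_completion[OF m] by simp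
  show "w absolutely_integrable_on S \<longleftrightarrow> (\<integral>\<^sup>+x\<in>S. ennreal (w x) \<partial>lborel) < \<infinity>"
    unfolding a e using nn by (simp add: integrable_iff_bounded)
  assume w: "w absolutely_integrable_on S"
  then have i: "integrable lborel ?w" by (simp add: a)
  have "(\<integral>\<^sup>+x. ennreal (?w x) \<partial>lborel) = ennreal (\<integral>x. ?w x \<partial>lborel)"
    by (intro nn_integral_eq_integral i) (simp add: nn)
  also have "(\<integral>x. ?w x \<partial>lborel) = (\<integral>x. ?w x \<partial>lebesgue)" by (simp add: integral_completion)
  also have "\<dots> = integral S w"
    using set_lebesgue_integral_eq_integral(2)[OF w] by (simp add: set_lebesgue_integral_def)
  finally show "(\<integral>\<^sup>+x\<in>S. ennreal (w x) \<partial>lborel) = ennreal (integral S w)" unfolding e .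
qed

lemma nn_integral_change_of_variables_wellorder:
  fixes f :: "real ^ 'm::{finite,wellorder} \<Rightarrow> real ^ 'm::{finite,wellorder}" and h :: "real ^ 'm::{finite,wellorder} \<Rightarrow> real"
  assumes S: "S \<in> sets borel" and fS: "f ` S \<in> sets borel"
    and der: "\<And>x. x \<in> S \<Longrightarrow> (f has_derivative f' x) (at x within S)" and inj: "inj_on f S"
    and h: "(\<lambda>y. indicator (f ` S) y * h y) \<in> borel_measurable borel" "\<And>y. y \<in> f ` S \<Longrightarrow> 0 \<le> h y"
    and m: "(\<lambda>x. indicator S x * (\<bar>det (matrix (f' x))\<bar> * h (f x))) \<in> borel_measurable borel"
  shows "(\<integral>\<^sup>+y\<in>f ` S. ennreal (h y) \<partial>lborel) = (\<integral>\<^sup>+x\<in>S. ennreal (\<bar>det (matrix (f' x))\<bar> * h (f x)) \<partial>lborel)"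
proof -
  let ?w = "\<lambda>x. \<bar>det (matrix (f' x))\<bar> * h (f x)"
  have L: "S \<in> sets lebesgue" using S by simp
  have cov: "?w absolutely_integrable_on S \<and> integral S ?w = b \<longleftrightarrow> h absolutely_integrable_on (f ` S) \<and> integral (f ` S) h = b" for b
    using has_absolute_integral_change_of_variables[OF L der inj, of "\<lambda>y. vec (h y) :: real ^ 1" "vec b"]
    by (simp add: absolutely_integrable_on_1_iff integral_on_1_eq vec_eq_iff)
  have nn: "0 \<le> ?w x" if "x \<in> S" for x using that h(2) by auto
  have I: "h absolutely_integrable_on (f ` S) \<longleftrightarrow> (\<integral>\<^sup>+y\<in>f ` S. ennreal (h y) \<partial>lborel) < \<infinity>"
    "?w absolutely_integrable_on S \<longleftrightarrow> (\<integral>\<^sup>+x\<in>S. ennreal (?w x) \<partial>lborel) < \<infinity>"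
    using absolutely_integrable_nonneg_iff(1)[OF h(1)] absolutely_integrable_nonneg_iff(1)[OF m] h(2) nn by blast+
  have I': "(\<integral>\<^sup>+y\<in>f ` S. ennreal (h y) \<partial>lborel) = ennreal (integral (f ` S) h)" if "h absolutely_integrable_on (f ` S)"
    using absolutely_integrable_nonneg_iff(2)[OF h(1) _ that] h(2) by blast
  have I'': "(\<integral>\<^sup>+x\<in>S. ennreal (?w x) \<partial>lborel) = ennreal (integral S ?w)" if "?w absolutely_integrable_on S"
    using absolutely_integrable_nonneg_iff(2)[OF m _ that] nn by blast
  show ?thesis
  proof (cases "h absolutely_integrable_on (f ` S)")
    case True
    then have "?w absolutely_integrable_on S" "integral S ?w = integral (f ` S) h" using cov[of "integral (f ` S) h"] by auto
    then show ?thesis using I'[OF True] I'' by simp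
  next
    case False
    then have "\<not> ?w absolutely_integrable_on S" using cov[of "integral S ?w"] by auto
    then show ?thesis using False I by (simp add: less_top[symmetric])
  qed
qed

lemma nn_integral_change_of_variables:
  fixes f :: "real ^ 'n::finite \<Rightarrow> real ^ 'n" and h :: "real ^ 'n \<Rightarrow> real"
  assumes S: "S \<in> sets borel" and fS: "f ` S \<in> sets borel"
    and der: "\<And>x. x \<in> S \<Longrightarrow> (f has_derivative f' x) (at x)" and inj: "inj_on f S"
    and h: "(\<lambda>y. indicator (f ` S) y * h y) \<in> borel_measurable borel" "\<And>y. y \<in> f ` S \<Longrightarrow> 0 \<le> h y"
    and m: "(\<lambda>x. indicator S x * (\<bar>det (matrix (f' x))\<bar> * h (f x))) \<in> borel_measurable borel"
  shows "(\<integral>\<^sup>+y\<in>f ` S. ennreal (h y) \<partial>lborel) = (\<integral>\<^sup>+x\<in>S. ennreal (\<bar>det (matrix (f' x))\<bar> * h (f x)) \<partial>lborel)"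
proof -
  obtain \<sigma> :: "'n ordered_index \<Rightarrow> 'n" where \<sigma>: "bij \<sigma>" using ex_index_bij by blast
  define T where "T = (permute_coords \<sigma> :: real ^ 'n \<Rightarrow> _)"
  define R where "R = permute_coords (inv \<sigma>)"
  have RT [simp]: "R (T x) = x" "T (R y) = y" for x y
    unfolding R_def T_def using permute_coords_inverse[OF \<sigma>] by auto
  have [measurable]: "T \<in> borel_measurable borel" "R \<in> borel_measurable borel" unfolding T_def R_def by measurable
  have blT: "bounded_linear T" and blR: "bounded_linear R"
    unfolding T_def R_def by (auto intro: bounded_linear_permute_coords)
  have lT: "distr lborel borel T = lborel" unfolding T_def by (rule lborel_permute_coords[OF \<sigma>])
  have TS: "T ` X = R -` X" for X by (auto simp: image_iff) (metis RT(2))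
  have T_borel: "T ` X \<in> sets borel" if "X \<in> sets borel" for X
    unfolding TS using measurable_sets[OF _ that, of R borel] by simp
  have transfer: "(\<integral>\<^sup>+y\<in>T ` X. ennreal (w y) \<partial>lborel) = (\<integral>\<^sup>+x\<in>X. ennreal (w (T x)) \<partial>lborel)"
    if "X \<in> sets borel" and w: "(\<lambda>x. indicator X x * w (T x)) \<in> borel_measurable borel" for X w
  proof -
    have e: "ennreal (w y) * indicator (T ` X) y = ennreal (indicator X (R y) * w (T (R y)))" for y
      by (auto simp: indicator_def TS)
    have "(\<lambda>y. indicator X (R y) * w (T (R y))) \<in> borel_measurable borel"
      by (rule measurable_compose[OF \<open>R \<in> borel_measurable borel\<close> w])
    then have meas: "(\<lambda>y. ennreal (indicator X (R y) * w (T (R y)))) \<in> borel_measurable borel"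
      by (rule measurable_compose) simp
    have "(\<integral>\<^sup>+y\<in>T ` X. ennreal (w y) \<partial>lborel) = (\<integral>\<^sup>+y. ennreal (indicator X (R y) * w (T (R y))) \<partial>distr lborel borel T)"
      unfolding lT e ..
    also have "\<dots> = (\<integral>\<^sup>+x. ennreal (indicator X (R (T x)) * w (T (R (T x)))) \<partial>lborel)"
      using meas by (intro nn_integral_distr) simp_all
    also have "\<dots> = (\<integral>\<^sup>+x\<in>X. ennreal (w (T x)) \<partial>lborel)"
      by (intro nn_integral_cong) (auto simp: indicator_def)
    finally show ?thesis .
  qed
  define F where "F = T \<circ> f \<circ> R"
  define F' where "F' y = T \<circ> f' (R y) \<circ> R" for y
  have det_eq: "det (matrix (F' (T x))) = det (matrix (f' x))" for x
  proof -
    have "matrix (F' (T x)) = (\<chi> i j. matrix (f' x) $ \<sigma> i $ \<sigma> j)"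
    proof -
      have "inv \<sigma> i = j \<longleftrightarrow> i = \<sigma> j" for i j using \<sigma> by (metis bij_inv_eq_iff)
      then have ax: "R (axis j 1) = axis (\<sigma> j) 1" for j
        by (simp add: R_def permute_coords_def vec_eq_iff axis_def)
      have T_nth: "T y $ i = y $ \<sigma> i" for y i by (simp add: T_def permute_coords_def)
      have "F' (T x) (axis j 1) $ i = f' x (axis (\<sigma> j) 1) $ \<sigma> i" for i j
        by (simp add: F'_def ax T_nth)
      then show ?thesis unfolding matrix_def by (simp add: vec_eq_iff)
    qed
    then show ?thesis using det_reindex[OF \<sigma>, of "matrix (f' x)"] by simp
  qed
  have FT: "F (T x) = T (f x)" for x by (simp add: F_def)
  have FS: "F ` (T ` S) = T ` (f ` S)" by (auto simp: FT image_image)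
  have "(\<integral>\<^sup>+y\<in>f ` S. ennreal (h y) \<partial>lborel) = (\<integral>\<^sup>+y\<in>T ` f ` S. ennreal (h (R y)) \<partial>lborel)"
    using h fS by (subst transfer) auto
  also have "\<dots> = (\<integral>\<^sup>+x\<in>T ` S. ennreal (\<bar>det (matrix (F' x))\<bar> * h (R (F x))) \<partial>lborel)"
    unfolding FS[symmetric]
  proof (rule nn_integral_change_of_variables_wellorder[where f=F and f'=F' and h="\<lambda>y. h (R y)" and S="T ` S"])
    show "T ` S \<in> sets borel" "F ` T ` S \<in> sets borel" unfolding FS using S fS T_borel by auto
    show "(F has_derivative F' x) (at x within T ` S)" if "x \<in> T ` S" for x
    proof -
      have "R x \<in> S" using that by auto
      have dR: "(R has_derivative R) (at x within T ` S)" by (rule bounded_linear_imp_has_derivative[OF blR])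
      have "((f \<circ> R) has_derivative (f' (R x) \<circ> R)) (at x within T ` S)"
        using diff_chain_within[OF dR] der[OF \<open>R x \<in> S\<close>] has_derivative_at_withinI by blast
      from diff_chain_within[OF this bounded_linear_imp_has_derivative[OF blT]]
      show ?thesis by (simp add: F_def F'_def o_assoc)
    qed
    show "inj_on F (T ` S)"
    proof (rule inj_onI)
      fix x y assume "x \<in> T ` S" "y \<in> T ` S" and eq: "F x = F y"
      then obtain a b where ab: "x = T a" "y = T b" "a \<in> S" "b \<in> S" by auto
      then have "T (f a) = T (f b)" using eq by (simp add: FT)
      then have "f a = f b" by (metis RT(1))
      then show "x = y" using ab inj by (auto dest: inj_onD)
    qed
    have "(\<lambda>y. indicator (f ` S) (R y) * h (R y)) \<in> borel_measurable borel"
      using measurable_compose[OF \<open>R \<in> borel_measurable borel\<close> h(1)] by simp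
    then show "(\<lambda>y. indicator (F ` T ` S) y * h (R y)) \<in> borel_measurable borel"
      unfolding FS TS[of "f ` S"] by (simp add: indicator_vimage o_def)
    show "0 \<le> h (R y)" if y: "y \<in> F ` T ` S" for y
    proof -
      from y obtain x where "x \<in> S" "y = T (f x)" unfolding FS by blast
      then show ?thesis using h(2) by simp
    qed
    have "(\<lambda>x. indicator S (R x) * (\<bar>det (matrix (f' (R x)))\<bar> * h (f (R x)))) \<in> borel_measurable borel"
      using measurable_compose[OF \<open>R \<in> borel_measurable borel\<close> m] by simp
    moreover have "det (matrix (F' x)) = det (matrix (f' (R x)))" for x
      using det_eq[of "R x"] by simp
    ultimately show "(\<lambda>x. indicator (T ` S) x * (\<bar>det (matrix (F' x))\<bar> * h (R (F x)))) \<in> borel_measurable borel"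
      unfolding TS by (simp add: indicator_vimage F_def o_def)
  qed
  also have "\<dots> = (\<integral>\<^sup>+x\<in>S. ennreal (\<bar>det (matrix (f' x))\<bar> * h (f x)) \<partial>lborel)"
    using S m by (subst transfer) (auto simp: det_eq FT)
  finally show ?thesis .
qed

section \<open>Charts\<close>

lemma chart_homeomorphism:
  assumes "smooth_atlas A" "c \<in> A"
  shows "homeomorphism (fst c) (snd c ` fst c) (snd c) (chart_inv c)"
  using assms by (auto simp: smooth_atlas_def is_chart_def)

lemma chart_open:
  assumes "smooth_atlas A" "c \<in> A"
  shows "open (fst c)" "open (snd c ` fst c)"
  using assms by (auto simp: smooth_atlas_def is_chart_def)

lemma chart_inv_chart:
  assumes "smooth_atlas A" "c \<in> A" "p \<in> fst c"
  shows "chart_inv c (snd c p) = p"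
  using chart_homeomorphism[OF assms(1,2)] assms(3) by (auto simp: homeomorphism_def)

lemma chart_chart_inv:
  assumes "smooth_atlas A" "c \<in> A" "x \<in> snd c ` fst c"
  shows "chart_inv c x \<in> fst c" "snd c (chart_inv c x) = x"
  using chart_homeomorphism[OF assms(1,2)] assms(3) by (auto simp: homeomorphism_def)

lemma chart_inj:
  assumes "smooth_atlas A" "c \<in> A"
  shows "inj_on (snd c) (fst c)"
  using chart_inv_chart[OF assms] by (rule inj_on_inverseI)

lemma chart_ex: "smooth_atlas A \<Longrightarrow> \<exists>c\<in>A. p \<in> fst c"
  by (auto simp: smooth_atlas_def)

lemma continuous_on_chart:
  assumes "smooth_atlas A" "c \<in> A"
  shows "continuous_on (fst c) (snd c)" "continuous_on (snd c ` fst c) (chart_inv c)"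
  using chart_homeomorphism[OF assms] by (auto simp: homeomorphism_def)

lemma chart_image_eq:
  assumes "smooth_atlas A" "c \<in> A" "B \<subseteq> fst c"
  shows "snd c ` B = (snd c ` fst c) \<inter> chart_inv c -` B"
  using chart_inv_chart[OF assms(1,2)] assms(3) by force

lemma open_chart_image:
  assumes "smooth_atlas A" "c \<in> A" "open B" "B \<subseteq> fst c"
  shows "open (snd c ` B)"
  unfolding chart_image_eq[OF assms(1,2,4)]
  using continuous_on_chart(2)[OF assms(1,2)] chart_open(2)[OF assms(1,2)] assms(3)
  by (metis continuous_on_open_vimage inf_commute)

lemma open_chart_inv_image:
  assumes "smooth_atlas A" "c \<in> A" "open X" "X \<subseteq> snd c ` fst c"
  shows "open (chart_inv c ` X)"
proof -
  have "chart_inv c ` X = fst c \<inter> snd c -` X"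
    using assms(4) chart_inv_chart[OF assms(1,2)] chart_chart_inv[OF assms(1,2)] by force
  then show ?thesis
    using continuous_on_chart(1)[OF assms(1,2)] chart_open(1)[OF assms(1,2)] assms(3)
    by (metis continuous_on_open_vimage inf_commute)
qed

lemma chart_image_borel:
  assumes "smooth_atlas A" "c \<in> A" "B \<in> sets borel" "B \<subseteq> fst c"
  shows "snd c ` B \<in> sets borel"
proof -
  have "chart_inv c \<in> measurable (restrict_space borel (snd c ` fst c)) borel"
    by (intro borel_measurable_continuous_on_restrict continuous_on_chart(2)[OF assms(1,2)])
  then have "chart_inv c -` B \<inter> space (restrict_space borel (snd c ` fst c)) \<in> sets (restrict_space borel (snd c ` fst c))"
    using assms(3) by (rule measurable_sets)
  then have "snd c ` fst c \<inter> chart_inv c -` B \<in> sets (restrict_space borel (snd c ` fst c))"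
    by (simp add: space_restrict_space Int_commute)
  then show ?thesis
    unfolding chart_image_eq[OF assms(1,2,4)]
    using chart_open(2)[OF assms(1,2)] by (subst (asm) sets_restrict_space_iff) auto
qed

section \<open>Volume\<close>

lemma continuous_on_metric:
  assumes "riemannian_metric A g" "c \<in> A"
  shows "continuous_on (snd c ` fst c) (\<lambda>x. g c (chart_inv c x))"
proof -
  have "smooth_on (snd c ` fst c) (\<lambda>x. g c (chart_inv c x))"
    using assms by (auto simp: riemannian_metric_def)
  then have "Ck_on 0 (snd c ` fst c) (\<lambda>x. g c (chart_inv c x))" unfolding smooth_on_def by blast
  then show ?thesis by simp
qed

lemma continuous_on_det:
  fixes M :: "'a::topological_space \<Rightarrow> real ^ 'n ^ 'n"
  assumes "continuous_on S M"
  shows "continuous_on S (\<lambda>x. det (M x))"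
  unfolding det_def by (intro continuous_intros assms)

definition vol_density :: "('m, 'n::finite) metric_field \<Rightarrow> ('m, 'n) chart \<Rightarrow> real ^ 'n \<Rightarrow> real" where
  "vol_density g c x = sqrt (det (g c (chart_inv c x)))"

definition chart_vol :: "('m, 'n::finite) metric_field \<Rightarrow> ('m, 'n) chart \<Rightarrow> 'm set \<Rightarrow> ennreal" where
  "chart_vol g c B = (\<integral>\<^sup>+x\<in>snd c ` B. ennreal (vol_density g c x) \<partial>lborel)"

lemma vol_density_measurable:
  assumes "smooth_atlas A" "riemannian_metric A g" "c \<in> A"
  shows "(\<lambda>x. indicator (snd c ` fst c) x * vol_density g c x) \<in> borel_measurable borel"
proof -
  have "continuous_on (snd c ` fst c) (vol_density g c)"
    unfolding vol_density_def[abs_def]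
    by (intro continuous_intros continuous_on_det continuous_on_metric[OF assms(2,3)])
  then show ?thesis
    using borel_measurable_continuous_on_indicator[of "snd c ` fst c" "vol_density g c"] chart_open(2)[OF assms(1,3)]
    by simp
qed

lemma chart_vol_eq_emeasure:
  assumes "smooth_atlas A" "riemannian_metric A g" "c \<in> A" "B \<in> sets borel" "B \<subseteq> fst c"
  shows "chart_vol g c B = emeasure (density lborel (\<lambda>x. ennreal (indicator (snd c ` fst c) x * vol_density g c x))) (snd c ` B)"
proof -
  have "emeasure (density lborel (\<lambda>x. ennreal (indicator (snd c ` fst c) x * vol_density g c x))) (snd c ` B) =
    (\<integral>\<^sup>+x\<in>snd c ` B. ennreal (indicator (snd c ` fst c) x * vol_density g c x) \<partial>lborel)"
    using vol_density_measurable[OF assms(1-3)] chart_image_borel[OF assms(1,3-5)]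
    by (intro emeasure_density) simp_all
  also have "\<dots> = chart_vol g c B"
    unfolding chart_vol_def using assms(5) by (intro nn_integral_cong) (auto simp: indicator_def)
  finally show ?thesis ..
qed

lemma chart_vol_UN:
  assumes A: "smooth_atlas A" "riemannian_metric A g" "c \<in> A"
    and B: "\<And>n::nat. B n \<in> sets borel" "\<And>n. B n \<subseteq> fst c" and disj: "disjoint_family B"
  shows "chart_vol g c (\<Union>n. B n) = (\<Sum>n. chart_vol g c (B n))"
proof -
  let ?D = "density lborel (\<lambda>x. ennreal (indicator (snd c ` fst c) x * vol_density g c x))"
  have UB: "(\<Union>n. B n) \<in> sets borel" "(\<Union>n. B n) \<subseteq> fst c" using B by auto
  have "disjoint_family (\<lambda>n. snd c ` B n)"
    unfolding disjoint_family_on_def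
  proof (intro ballI impI)
    fix m n :: nat assume "m \<noteq> n"
    then have "B m \<inter> B n = {}" using disj by (auto simp: disjoint_family_on_def)
    then show "snd c ` B m \<inter> snd c ` B n = {}"
      using inj_on_image_Int[OF chart_inj[OF A(1,3)] B(2) B(2), of m n] by simp
  qed
  then have "(\<Sum>n. emeasure ?D (snd c ` B n)) = emeasure ?D (\<Union>n. snd c ` B n)"
    using chart_image_borel[OF A(1,3) B] by (intro suminf_emeasure) auto
  then show ?thesis
    by (simp add: chart_vol_eq_emeasure[OF A UB] chart_vol_eq_emeasure[OF A B] image_UN)
qed

lemma open_transition_domain:
  assumes A: "smooth_atlas A" and f: "continuous_on UNIV f" and c: "c \<in> A" "d \<in> A"
  shows "open (fst c \<inter> f -` fst d)" "open (snd c ` (fst c \<inter> f -` fst d))"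
proof -
  show "open (fst c \<inter> f -` fst d)"
    using f chart_open(1)[OF A] c by (intro open_Int open_vimage) auto
  then show "open (snd c ` (fst c \<inter> f -` fst d))"
    by (intro open_chart_image[OF A c(1)]) auto
qed

lemma smooth_map_loc_rep:
  assumes f: "smooth_map A f" and "c \<in> A" "d \<in> A" "p \<in> fst c" "f p \<in> fst d"
  shows "(loc_rep c d f has_derivative frechet_derivative (loc_rep c d f) (at (snd c p))) (at (snd c p))"
proof -
  have "smooth_on (snd c ` (fst c \<inter> f -` fst d)) (loc_rep c d f)"
    using assms by (auto simp: smooth_map_def)
  then have "Ck_on (Suc 0) (snd c ` (fst c \<inter> f -` fst d)) (loc_rep c d f)" unfolding smooth_on_def by blast
  then have "loc_rep c d f differentiable (at (snd c p))" using assms by auto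
  then show ?thesis by (simp add: frechet_derivative_works)
qed

lemma smooth_map_derivative_continuous:
  assumes f: "smooth_map A f" and "c \<in> A" "d \<in> A"
  shows "continuous_on (snd c ` (fst c \<inter> f -` fst d)) (\<lambda>x. frechet_derivative (loc_rep c d f) (at x) v)"
proof -
  have "smooth_on (snd c ` (fst c \<inter> f -` fst d)) (loc_rep c d f)"
    using assms by (auto simp: smooth_map_def)
  then have "Ck_on (Suc 0) (snd c ` (fst c \<inter> f -` fst d)) (loc_rep c d f)" unfolding smooth_on_def by blast
  then show ?thesis by simp
qed

text \<open>The pull-back law for the metric multiplies its determinant by the square of the Jacobian
  determinant, which is what the change of variables formula compensates.  The case of the identity
  says that the volume does not depend on the chart, the case of an isometry that isometries
  preserve it.  The density is truncated at zero, which makes it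
  non-negative and does not change the integrals.\<close>

lemma chart_vol_image:
  assumes A: "smooth_atlas A" "riemannian_metric A g"
    and f: "smooth_map A f" "inj f" "preserves_metric A g f" and c: "c \<in> A" "d \<in> A"
    and B: "B \<in> sets borel" "B \<subseteq> fst c" "f ` B \<in> sets borel" "f ` B \<subseteq> fst d"
  shows "chart_vol g d (f ` B) = chart_vol g c B"
proof -
  let ?F = "loc_rep c d f" and ?S = "snd c ` B"
  let ?F' = "\<lambda>x. frechet_derivative ?F (at x)"
  have FS: "?F ` ?S = snd d ` f ` B"
    using chart_inv_chart[OF A(1) c(1)] B(2) by (force simp: loc_rep_def image_image)
  have S: "?S \<in> sets borel" by (rule chart_image_borel[OF A(1) c(1) B(1,2)])
  have T: "snd d ` f ` B \<in> sets borel" by (rule chart_image_borel[OF A(1) c(2) B(3,4)])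
  have density: "max 0 (vol_density g c x) = \<bar>det (matrix (?F' x))\<bar> * max 0 (vol_density g d (?F x))" if x: "x \<in> ?S" for x
  proof -
    obtain p where p: "p \<in> B" "x = snd c p" using x by blast
    have pc: "chart_inv c x = p" "p \<in> fst c" using p B(2) chart_inv_chart[OF A(1) c(1)] by auto
    have fp: "f p \<in> fst d" using p B(4) by auto
    have dF: "chart_inv d (?F x) = f p" unfolding loc_rep_def using pc chart_inv_chart[OF A(1) c(2) fp] by simp
    have "g c p = transpose (jacobian c d f p) ** g d (f p) ** jacobian c d f p"
      using f(3) c pc fp by (auto simp: preserves_metric_def)
    then have "det (g c p) = (det (jacobian c d f p))\<^sup>2 * det (g d (f p))"
      by (simp add: det_mul det_transpose power2_eq_square)
    then have "vol_density g c x = \<bar>det (jacobian c d f p)\<bar> * vol_density g d (?F x)"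
      unfolding vol_density_def pc dF by (simp add: real_sqrt_mult)
    then show ?thesis
      unfolding jacobian_def p(2)[symmetric] by (simp add: max_mult_distrib_left)
  qed
  have dens_meas: "(\<lambda>x. indicator (snd c ` B) x * max 0 (vol_density g c x)) \<in> borel_measurable borel"
    if "c \<in> A" "snd c ` B \<in> sets borel" "B \<subseteq> fst c" for c B
  proof -
    note vol_density_measurable[OF A that(1), measurable] that(2)[measurable]
    have "(\<lambda>x. indicator (snd c ` B) x * max 0 (indicator (snd c ` fst c) x * vol_density g c x)) \<in> borel_measurable borel"
      by measurable
    also have "(\<lambda>x. indicator (snd c ` B) x * max 0 (indicator (snd c ` fst c) x * vol_density g c x)) =
      (\<lambda>x. indicator (snd c ` B) x * max 0 (vol_density g c x))"
      using that(3) by (auto simp: fun_eq_iff indicator_def)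
    finally show ?thesis .
  qed
  have "(\<integral>\<^sup>+y\<in>?F ` ?S. ennreal (max 0 (vol_density g d y)) \<partial>lborel) =
    (\<integral>\<^sup>+x\<in>?S. ennreal (\<bar>det (matrix (?F' x))\<bar> * max 0 (vol_density g d (?F x))) \<partial>lborel)"
  proof (rule nn_integral_change_of_variables)
    show "?S \<in> sets borel" "?F ` ?S \<in> sets borel" using S T by (auto simp: FS)
    show "(?F has_derivative ?F' x) (at x)" if "x \<in> ?S" for x
      using that B by (auto intro!: smooth_map_loc_rep[OF f(1) c])
    show "inj_on ?F ?S"
    proof (rule inj_onI)
      fix x y assume xy: "x \<in> ?S" "y \<in> ?S" "?F x = ?F y"
      then obtain p r where pr: "x = snd c p" "y = snd c r" "p \<in> B" "r \<in> B" by blast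
      then have "snd d (f p) = snd d (f r)"
        using xy(3) B(2) chart_inv_chart[OF A(1) c(1)] by (auto simp: loc_rep_def subset_eq)
      then have "f p = f r" using inj_onD[OF chart_inj[OF A(1) c(2)]] B(4) pr by blast
      then show "x = y" using f(2) pr by (auto dest: injD)
    qed
    show "(\<lambda>y. indicator (?F ` ?S) y * max 0 (vol_density g d y)) \<in> borel_measurable borel"
      unfolding FS by (rule dens_meas[OF c(2) T B(4)])
    have "(\<lambda>x. indicator ?S x * (\<bar>det (matrix (?F' x))\<bar> * max 0 (vol_density g d (?F x)))) =
      (\<lambda>x. indicator ?S x * max 0 (vol_density g c x))"
      using density by (auto simp: fun_eq_iff indicator_def)
    then show "(\<lambda>x. indicator ?S x * (\<bar>det (matrix (?F' x))\<bar> * max 0 (vol_density g d (?F x)))) \<in> borel_measurable borel"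
      using dens_meas[OF c(1) S B(2)] by simp
  qed simp
  also have "\<dots> = (\<integral>\<^sup>+x\<in>?S. ennreal (max 0 (vol_density g c x)) \<partial>lborel)"
  proof (rule nn_integral_cong)
    fix x
    show "ennreal (\<bar>det (matrix (?F' x))\<bar> * max 0 (vol_density g d (?F x))) * indicator ?S x =
        ennreal (max 0 (vol_density g c x)) * indicator ?S x"
      by (cases "x \<in> ?S") (simp_all only: density indicator_simps mult_zero_right not_False_eq_True if_False)
  qed
  finally show ?thesis
    unfolding chart_vol_def FS by simp
qed

definition is_volume :: "('m::topological_space, 'n::finite) chart set \<Rightarrow> ('m, 'n) metric_field \<Rightarrow> 'm measure \<Rightarrow> bool" where
  "is_volume A g \<mu> \<longleftrightarrow> sets \<mu> = sets borel \<and>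
     (\<forall>c\<in>A. \<forall>B\<in>sets borel. B \<subseteq> fst c \<longrightarrow> emeasure \<mu> B = chart_vol g c B)"

lemma preserves_metric_id: "riemannian_metric A g \<Longrightarrow> preserves_metric A g id"
  by (simp add: riemannian_metric_def)

lemma smooth_map_id: "smooth_atlas A \<Longrightarrow> smooth_map A id"
  by (simp add: smooth_atlas_def)

lemma chart_vol_chart_independent:
  assumes "smooth_atlas A" "riemannian_metric A g" "c \<in> A" "d \<in> A" "B \<in> sets borel" "B \<subseteq> fst c" "B \<subseteq> fst d"
  shows "chart_vol g d B = chart_vol g c B"
  using chart_vol_image[OF assms(1,2) smooth_map_id _ preserves_metric_id, of c d B] assms by simp

text \<open>Second countability allows countably many charts; making their domains disjoint reduces global
  questions about the volume to a single chart.\<close>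

lemma countable_chart_partition:
  fixes A :: "('m::second_countable_topology, 'n::finite) chart set"
  assumes A: "smooth_atlas A"
  shows "\<exists>(c :: nat \<Rightarrow> ('m, 'n) chart) D. (\<forall>i. c i \<in> A \<and> D i \<in> sets borel \<and> D i \<subseteq> fst (c i)) \<and>
    disjoint_family D \<and> (\<Union>i. D i) = UNIV"
proof -
  obtain F where F: "F \<subseteq> fst ` A" "countable F" "\<Union>F = \<Union>(fst ` A)"
  proof (rule Lindelof[of "fst ` A"])
    show "open S" if "S \<in> fst ` A" for S using that chart_open(1)[OF A] by blast
  qed
  have UF: "\<Union>F = UNIV" using F(3) A by (auto simp: smooth_atlas_def)
  then have "F \<noteq> {}" by auto
  obtain e :: "nat \<Rightarrow> 'm set" where e: "range e = F" using F(2) \<open>F \<noteq> {}\<close> by (metis range_from_nat_into)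
  have "\<forall>i. \<exists>c\<in>A. fst c = e i" using F(1) e by (metis imageE rangeI subsetD)
  then obtain c where c: "\<And>i. c i \<in> A" "\<And>i. fst (c i) = e i" by metis
  have [measurable]: "e i \<in> sets borel" for i using chart_open(1)[OF A c(1), of i] c(2) by auto
  have "disjointed e i \<in> sets borel" for i unfolding disjointed_def by measurable
  moreover have "disjointed e i \<subseteq> fst (c i)" for i using disjointed_subset[of e i] c(2) by simp
  moreover have "(\<Union>i. disjointed e i) = UNIV" using UF e by (simp add: UN_disjointed_eq)
  ultimately show ?thesis using c(1) disjoint_family_disjointed[of e] by blast
qed

lemma ennreal_suminf_swap:
  fixes f :: "nat \<Rightarrow> nat \<Rightarrow> ennreal"
  shows "(\<Sum>i. \<Sum>j. f i j) = (\<Sum>j. \<Sum>i. f i j)"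
  using nn_integral_suminf[of "\<lambda>j i. f i j" "count_space UNIV"]
  by (simp add: nn_integral_count_space_nat)

lemma volume_exists:
  fixes A :: "('m::second_countable_topology, 'n::finite) chart set"
  assumes A: "smooth_atlas A" "riemannian_metric A g"
  shows "\<exists>\<mu>. is_volume A g \<mu>"
proof -
  from countable_chart_partition[OF A(1)] obtain c :: "nat \<Rightarrow> ('m, 'n) chart" where
    "\<exists>D. (\<forall>i. c i \<in> A \<and> D i \<in> sets borel \<and> D i \<subseteq> fst (c i)) \<and> disjoint_family D \<and> (\<Union>i. D i) = UNIV" ..
  then obtain D where cD: "(\<forall>i. c i \<in> A \<and> D i \<in> sets borel \<and> D i \<subseteq> fst (c i)) \<and> disjoint_family D \<and> (\<Union>i. D i) = UNIV" ..
  then have disj: "disjoint_family D" and UN: "(\<Union>i. D i) = UNIV" by simp_all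
  have c: "c i \<in> A" and D[measurable]: "D i \<in> sets borel" and Dc: "D i \<subseteq> fst (c i)" for i
    using cD by simp_all
  define m where "m B = (\<Sum>i. chart_vol g (c i) (B \<inter> D i))" for B
  let ?M = "measure_of UNIV (sets borel) m"
  have sub: "B \<inter> D i \<subseteq> fst (c i)" for B i using Dc by auto
  have em: "emeasure ?M B = m B" if "B \<in> sets borel" for B
  proof (rule emeasure_measure_of_sigma)
    show "sigma_algebra UNIV (sets (borel :: 'm measure))" using sets.sigma_algebra_axioms[of borel] by simp
    show "positive (sets borel) m" by (simp add: positive_def m_def chart_vol_def)
    show "countably_additive (sets borel) m"
      unfolding countably_additive_def
    proof (intro allI impI)
      fix B :: "nat \<Rightarrow> 'm set" assume B: "range B \<subseteq> sets borel" "disjoint_family B"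
      then have [measurable]: "B n \<in> sets borel" for n by auto
      have "chart_vol g (c i) (\<Union>n. B n \<inter> D i) = (\<Sum>n. chart_vol g (c i) (B n \<inter> D i))" for i
        using B(2) sub by (intro chart_vol_UN[OF A c]) (auto simp: disjoint_family_on_def)
      then have "m (\<Union>n. B n) = (\<Sum>i. \<Sum>n. chart_vol g (c i) (B n \<inter> D i))"
        unfolding m_def by simp
      moreover have "(\<Sum>n. m (B n)) = (\<Sum>i. \<Sum>n. chart_vol g (c i) (B n \<inter> D i))"
        unfolding m_def by (rule ennreal_suminf_swap)
      ultimately show "(\<Sum>n. m (B n)) = m (\<Union>n. B n)" by simp
    qed
  qed fact
  have "is_volume A g ?M"
    unfolding is_volume_def
  proof (intro conjI ballI impI)
    show "sets ?M = sets borel" using sets.sets_measure_of_eq[of "borel :: 'm measure"] by simp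
    fix d B assume d: "d \<in> A" and B[measurable]: "B \<in> sets borel" and Bd: "B \<subseteq> fst d"
    have "emeasure ?M B = (\<Sum>i. chart_vol g (c i) (B \<inter> D i))" using em[OF B] by (simp add: m_def)
    also have "\<dots> = (\<Sum>i. chart_vol g d (B \<inter> D i))"
      using sub Bd by (intro suminf_cong chart_vol_chart_independent[OF A d c]) auto
    also have "\<dots> = chart_vol g d (\<Union>i. B \<inter> D i)"
      using disj Bd by (intro chart_vol_UN[OF A d, symmetric]) (auto simp: disjoint_family_on_def)
    also have "(\<Union>i. B \<inter> D i) = B" using UN by auto
    finally show "emeasure ?M B = chart_vol g d B" .
  qed
  then show ?thesis by blast
qed

lemma volume_unique:
  fixes A :: "('m::second_countable_topology, 'n::finite) chart set"
  assumes A: "smooth_atlas A" "riemannian_metric A g" and v: "is_volume A g \<mu>" "is_volume A g \<mu>'"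
  shows "\<mu> = \<mu>'"
proof (rule measure_eqI)
  from countable_chart_partition[OF A(1)] obtain c :: "nat \<Rightarrow> ('m, 'n) chart" where
    "\<exists>D. (\<forall>i. c i \<in> A \<and> D i \<in> sets borel \<and> D i \<subseteq> fst (c i)) \<and> disjoint_family D \<and> (\<Union>i. D i) = UNIV" ..
  then obtain D where cD: "(\<forall>i. c i \<in> A \<and> D i \<in> sets borel \<and> D i \<subseteq> fst (c i)) \<and> disjoint_family D \<and> (\<Union>i. D i) = UNIV" ..
  then have disj: "disjoint_family D" and UN: "(\<Union>i. D i) = UNIV" by simp_all
  have c: "c i \<in> A" and D[measurable]: "D i \<in> sets borel" and Dc: "D i \<subseteq> fst (c i)" for i
    using cD by simp_all
  show "sets \<mu> = sets \<mu>'" using v by (simp add: is_volume_def)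
  fix B assume "B \<in> sets \<mu>"
  then have B[measurable]: "B \<in> sets borel" using v by (simp add: is_volume_def)
  have eq: "emeasure \<mu> B = (\<Sum>i. chart_vol g (c i) (B \<inter> D i))" if "is_volume A g \<mu>" for \<mu>
  proof -
    have s: "sets \<mu> = sets borel" using that by (simp add: is_volume_def)
    have "(\<Sum>i. emeasure \<mu> (B \<inter> D i)) = emeasure \<mu> (\<Union>i. B \<inter> D i)"
      using disj by (intro suminf_emeasure) (auto simp: s disjoint_family_on_def)
    also have "(\<Union>i. B \<inter> D i) = B" using UN by auto
    finally have "emeasure \<mu> B = (\<Sum>i. emeasure \<mu> (B \<inter> D i))" ..
    moreover have "emeasure \<mu> (B \<inter> D i) = chart_vol g (c i) (B \<inter> D i)" for i
      using that c[of i] Dc[of i] unfolding is_volume_def by (auto simp: le_infI2)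
    ultimately show ?thesis by simp
  qed
  show "emeasure \<mu> B = emeasure \<mu>' B" using eq v by simp
qed

lemma is_volume_rvol:
  fixes A :: "('m::second_countable_topology, 'n::finite) chart set"
  assumes A: "smooth_atlas A" "riemannian_metric A g"
  shows "is_volume A g (rvol A g)"
proof -
  have eq: "rvol A g = (THE \<mu>. is_volume A g \<mu>)"
    by (simp add: rvol_def is_volume_def chart_vol_def vol_density_def)
  show ?thesis unfolding eq
    using volume_exists[OF A] volume_unique[OF A] by (metis (mono_tags, lifting) theI')
qed

text \<open>The pieces \<open>B \<inter> D i \<inter> f -` D j\<close> lie in one chart and have their images in one chart, as
  \<open>chart_vol_image\<close> requires.\<close>

lemma rvol_isometry:
  fixes A :: "('m::{t2_space,second_countable_topology}, 'n::finite) chart set"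
  assumes A: "smooth_atlas A" "riemannian_metric A g" and f: "riemannian_isometry A g f" and B: "B \<in> sets borel"
  shows "emeasure (rvol A g) (f ` B) = emeasure (rvol A g) B"
proof -
  have bij: "bij f" and sf: "smooth_map A f" and si: "smooth_map A (inv f)" and pm: "preserves_metric A g f"
    using f by (auto simp: riemannian_isometry_def)
  have [measurable]: "f \<in> borel_measurable borel" "inv f \<in> borel_measurable borel"
    using sf si by (auto simp: smooth_map_def intro: borel_measurable_continuous_onI)
  have img: "f ` X = inv f -` X" for X using bij by (simp add: bij_vimage_eq_inv_image bij_imp_bij_inv inv_inv_eq)
  have f_borel: "f ` X \<in> sets borel" if "X \<in> sets borel" for X
    unfolding img using measurable_sets[OF _ that, of "inv f" borel] by simp
  from countable_chart_partition[OF A(1)] obtain c :: "nat \<Rightarrow> ('m, 'n) chart" where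
    "\<exists>D. (\<forall>i. c i \<in> A \<and> D i \<in> sets borel \<and> D i \<subseteq> fst (c i)) \<and> disjoint_family D \<and> (\<Union>i. D i) = UNIV" ..
  then obtain D where cD: "(\<forall>i. c i \<in> A \<and> D i \<in> sets borel \<and> D i \<subseteq> fst (c i)) \<and> disjoint_family D \<and> (\<Union>i. D i) = UNIV" ..
  then have disj: "disjoint_family D" and UN: "(\<Union>i. D i) = UNIV" by simp_all
  have c: "c i \<in> A" and D[measurable]: "D i \<in> sets borel" and Dc: "D i \<subseteq> fst (c i)" for i
    using cD by simp_all
  note B[measurable]
  have v: "sets (rvol A g) = sets borel" "\<And>c B. c \<in> A \<Longrightarrow> B \<in> sets borel \<Longrightarrow> B \<subseteq> fst c \<Longrightarrow> emeasure (rvol A g) B = chart_vol g c B"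
    using is_volume_rvol[OF A] by (auto simp: is_volume_def)
  have split: "emeasure (rvol A g) X = (\<Sum>i. emeasure (rvol A g) (X \<inter> F i))"
    if X[measurable]: "X \<in> sets borel" and F[measurable]: "\<And>i. F i \<in> sets borel" and "disjoint_family F" "(\<Union>i. F i) = UNIV"
    for X :: "'m set" and F :: "nat \<Rightarrow> 'm set"
  proof -
    have "(\<Sum>i. emeasure (rvol A g) (X \<inter> F i)) = emeasure (rvol A g) (\<Union>i. X \<inter> F i)"
      using that(3) by (intro suminf_emeasure) (auto simp: v disjoint_family_on_def)
    also have "(\<Union>i. X \<inter> F i) = X" using that(4) by auto
    finally show ?thesis ..
  qed
  have piece: "emeasure (rvol A g) (f ` (B \<inter> D i \<inter> f -` D j)) = emeasure (rvol A g) (B \<inter> D i \<inter> f -` D j)" for i j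
  proof -
    have fD: "f -` D j \<in> sets borel" using measurable_sets[of f borel borel "D j"] by simp
    let ?X = "B \<inter> D i \<inter> f -` D j"
    have X: "?X \<in> sets borel" "?X \<subseteq> fst (c i)" "f ` ?X \<in> sets borel" "f ` ?X \<subseteq> fst (c j)"
      using Dc fD by (auto intro!: f_borel)
    have "emeasure (rvol A g) (f ` ?X) = chart_vol g (c j) (f ` ?X)" by (rule v(2)[OF c X(3,4)])
    also have "\<dots> = chart_vol g (c i) ?X"
      by (rule chart_vol_image[OF A sf bij_is_inj[OF bij] pm c c X])
    also have "\<dots> = emeasure (rvol A g) ?X" by (rule v(2)[OF c X(1,2), symmetric])
    finally show ?thesis .
  qed
  have fD: "f -` D j \<in> sets borel" for j using measurable_sets[of f borel borel "D j"] by simp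
  have "emeasure (rvol A g) (f ` B) = (\<Sum>j. emeasure (rvol A g) (f ` B \<inter> D j))"
    by (intro split f_borel B D disj UN)
  also have "\<dots> = (\<Sum>j. \<Sum>i. emeasure (rvol A g) (f ` B \<inter> D j \<inter> f ` D i))"
  proof (intro suminf_cong split)
    show "disjoint_family (\<lambda>i. f ` D i)" using disj bij_is_inj[OF bij]
      by (simp add: disjoint_family_on_def image_Int[symmetric])
    show "(\<Union>i. f ` D i) = UNIV" using UN bij_is_surj[OF bij] by (simp add: image_UN[symmetric])
  qed (auto intro!: f_borel B)
  also have "\<dots> = (\<Sum>j. \<Sum>i. emeasure (rvol A g) (f ` (B \<inter> D i \<inter> f -` D j)))"
    using bij_is_inj[OF bij] by (intro suminf_cong arg_cong[where f="emeasure (rvol A g)"]) (auto dest: injD)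
  also have "\<dots> = (\<Sum>j. \<Sum>i. emeasure (rvol A g) (B \<inter> f -` D j \<inter> D i))"
    unfolding piece by (simp only: Int_ac)
  also have "\<dots> = (\<Sum>j. emeasure (rvol A g) (B \<inter> f -` D j))"
    using fD by (intro suminf_cong split[symmetric] D disj UN) auto
  also have "\<dots> = emeasure (rvol A g) B"
  proof (intro split[symmetric] B fD)
    show "disjoint_family (\<lambda>j. f -` D j)" using disj by (auto simp: disjoint_family_on_def)
    show "(\<Union>j. f -` D j) = UNIV" using UN by (simp add: vimage_UN[symmetric])
  qed
  finally show ?thesis .
qed

lemma rvol_singleton:
  fixes A :: "('m::{t2_space,second_countable_topology}, 'n::finite) chart set"
  assumes A: "smooth_atlas A" "riemannian_metric A g"
  shows "emeasure (rvol A g) {x} = 0"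
proof -
  obtain c where c: "c \<in> A" "x \<in> fst c" using chart_ex[OF A(1)] by blast
  then have "emeasure (rvol A g) {x} = chart_vol g c {x}"
    using is_volume_rvol[OF A] by (auto simp: is_volume_def)
  also have "\<dots> = (\<integral>\<^sup>+y. ennreal (vol_density g c y) * indicator {snd c x} y \<partial>lborel)"
    by (simp add: chart_vol_def)
  also have "\<dots> = (\<integral>\<^sup>+y. 0 \<partial>(lborel :: (real ^ 'n) measure))"
  proof (rule nn_integral_cong_AE)
    have "AE y in lborel. y \<noteq> snd c x" by (rule AE_lborel_singleton)
    then show "AE y in lborel. ennreal (vol_density g c y) * indicator {snd c x} y = 0"
      by eventually_elim simp
  qed
  finally show ?thesis by simp
qed

lemma rvol_compact_in_chart_finite:
  fixes A :: "('m::{t2_space,second_countable_topology}, 'n::finite) chart set"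
  assumes A: "smooth_atlas A" "riemannian_metric A g" and c: "c \<in> A"
    and K: "compact K" "K \<subseteq> snd c ` fst c"
  shows "chart_inv c ` K \<in> sets borel" "emeasure (rvol A g) (chart_inv c ` K) < \<infinity>"
proof -
  have "compact (chart_inv c ` K)"
    using K continuous_on_chart(2)[OF A(1) c] by (intro compact_continuous_image) (auto intro: continuous_on_subset)
  then show borel: "chart_inv c ` K \<in> sets borel" by (intro borel_closed compact_imp_closed)
  have sub: "chart_inv c ` K \<subseteq> fst c" using K(2) chart_chart_inv(1)[OF A(1) c] by auto
  have img: "snd c ` chart_inv c ` K = K" using K(2) chart_chart_inv(2)[OF A(1) c] by force
  have "continuous_on K (vol_density g c)"
    unfolding vol_density_def[abs_def]
    by (intro continuous_intros continuous_on_det continuous_on_subset[OF continuous_on_metric[OF A(2) c] K(2)])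
  then have "bounded (vol_density g c ` K)" by (intro compact_imp_bounded compact_continuous_image K)
  then obtain b where b: "\<And>x. x \<in> K \<Longrightarrow> \<bar>vol_density g c x\<bar> \<le> b" by (auto simp: bounded_iff)
  have "emeasure (rvol A g) (chart_inv c ` K) = (\<integral>\<^sup>+x\<in>K. ennreal (vol_density g c x) \<partial>lborel)"
    using is_volume_rvol[OF A] c borel sub unfolding is_volume_def chart_vol_def by (simp add: img)
  also have "\<dots> \<le> (\<integral>\<^sup>+x. ennreal b * indicator K x \<partial>lborel)"
    using abs_le_D1[OF b] by (intro nn_integral_mono) (auto simp: indicator_def intro!: ennreal_leI)
  also have "\<dots> = ennreal b * emeasure lborel K"
    using K(1) by (intro nn_integral_cmult_indicator) (simp add: borel_closed compact_imp_closed)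
  also have "\<dots> < \<infinity>"
    using emeasure_compact_finite[OF K(1)] by (simp add: ennreal_mult_less_top)
  finally show "emeasure (rvol A g) (chart_inv c ` K) < \<infinity>" .
qed

section \<open>Curves and their lengths\<close>

definition tangent_norm :: "('m, 'n::finite) metric_field \<Rightarrow> ('m, 'n) chart \<Rightarrow> 'm \<Rightarrow> real ^ 'n \<Rightarrow> real" where
  "tangent_norm g c p v = sqrt (v \<bullet> (g c p *v v))"

lemma tangent_norm_scaleR: "tangent_norm g c p (r *\<^sub>R v) = \<bar>r\<bar> * tangent_norm g c p v"
proof -
  have "(r *\<^sub>R v) \<bullet> (g c p *v (r *\<^sub>R v)) = r\<^sup>2 * (v \<bullet> (g c p *v v))"
    by (simp add: matrix_vector_mult_scaleR power2_eq_square)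
  then show ?thesis by (simp add: tangent_norm_def real_sqrt_mult)
qed

lemma tangent_norm_nonneg:
  assumes "riemannian_metric A g" "c \<in> A" "p \<in> fst c"
  shows "0 \<le> tangent_norm g c p v"
proof (cases "v = 0")
  case False
  then have "v \<bullet> (g c p *v v) > 0" using assms by (auto simp: riemannian_metric_def)
  then show ?thesis by (simp add: tangent_norm_def)
qed (simp add: tangent_norm_def)

text \<open>The chain rule for the image of a curve under a smooth map.  Applied to the identity it describes
  the change of charts; the same double use is made of most lemmas about smooth maps below.\<close>

lemma curve_image_has_vector_derivative:
  assumes A: "smooth_atlas A" and f: "smooth_map A f" and c: "c \<in> A" "d \<in> A"
    and t: "t \<in> T" "\<gamma> t \<in> fst c" "f (\<gamma> t) \<in> fst d"
    and cont: "continuous (at t within T) \<gamma>" and der: "(snd c \<circ> \<gamma> has_vector_derivative v) (at t within T)"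
  shows "(snd d \<circ> (f \<circ> \<gamma>) has_vector_derivative frechet_derivative (loc_rep c d f) (at (snd c (\<gamma> t))) v) (at t within T)"
proof -
  let ?F = "loc_rep c d f"
  let ?F' = "frechet_derivative ?F (at (snd c (\<gamma> t)))"
  have F: "(?F has_derivative ?F') (at (snd c (\<gamma> t)))"
    by (rule smooth_map_loc_rep[OF f c t(2,3)])
  have "((?F \<circ> (snd c \<circ> \<gamma>)) has_derivative ?F' \<circ> (\<lambda>x. x *\<^sub>R v)) (at t within T)"
    using der unfolding has_vector_derivative_def
    by (rule diff_chain_within) (use has_derivative_at_withinI[OF F] in simp)
  then have "((?F \<circ> (snd c \<circ> \<gamma>)) has_derivative (\<lambda>x. x *\<^sub>R ?F' v)) (at t within T)"
    using linear_cmul[OF has_derivative_linear[OF F]] by (simp add: o_def)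
  moreover have "eventually (\<lambda>s. (?F \<circ> (snd c \<circ> \<gamma>)) s = (snd d \<circ> (f \<circ> \<gamma>)) s) (at t within T)"
  proof -
    have "eventually (\<lambda>s. \<gamma> s \<in> fst c) (at t within T)"
      using cont chart_open(1)[OF A c(1)] t(2) unfolding continuous_within by (rule topological_tendstoD)
    then show ?thesis
      by eventually_elim (simp add: loc_rep_def chart_inv_chart[OF A c(1)])
  qed
  ultimately show ?thesis
    unfolding has_vector_derivative_def
    using t by (elim has_derivative_transform_eventually) (auto simp: loc_rep_def chart_inv_chart[OF A c(1)])
qed

lemma tangent_norm_image:
  assumes f: "smooth_map A f" "preserves_metric A g f" and c: "c \<in> A" "d \<in> A" and p: "p \<in> fst c" "f p \<in> fst d"
  shows "tangent_norm g d (f p) (frechet_derivative (loc_rep c d f) (at (snd c p)) v) = tangent_norm g c p v"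
proof -
  let ?J = "jacobian c d f p" and ?F' = "frechet_derivative (loc_rep c d f) (at (snd c p))"
  have "linear ?F'" using smooth_map_loc_rep[OF f(1) c p] by (rule has_derivative_linear)
  then have J: "?J *v v = ?F' v" by (simp add: jacobian_def matrix_works)
  have "g c p = transpose ?J ** g d (f p) ** ?J"
    using f(2) c p by (auto simp: preserves_metric_def)
  then have "v \<bullet> (g c p *v v) = v \<bullet> (transpose ?J *v (g d (f p) *v (?J *v v)))"
    by (simp add: matrix_vector_mul_assoc matrix_mul_assoc)
  also have "\<dots> = (?J *v v) \<bullet> (g d (f p) *v (?J *v v))"
    by (simp add: dot_lmul_matrix inner_commute[of v])
      (simp add: inner_commute)
  finally show ?thesis by (simp add: tangent_norm_def J)
qed

text \<open>In contrast to \<^const>\<open>speed\<close> the derivative is two-sided and not tied to the parameter interval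
  \<open>{0..1}\<close>, so that curves can be cut, joined and reparametrised.  On that interval the two can
  differ at the end points only.\<close>

definition curve_speed :: "('m, 'n::finite) chart set \<Rightarrow> ('m, 'n) metric_field \<Rightarrow> (real \<Rightarrow> 'm) \<Rightarrow> real \<Rightarrow> real" where
  "curve_speed A g \<gamma> t = (let c = (SOME c. c \<in> A \<and> \<gamma> t \<in> fst c) in
     tangent_norm g c (\<gamma> t) (vector_derivative (snd c \<circ> \<gamma>) (at t)))"

definition arc_length :: "('m, 'n::finite) chart set \<Rightarrow> ('m, 'n) metric_field \<Rightarrow> real \<Rightarrow> real \<Rightarrow> (real \<Rightarrow> 'm) \<Rightarrow> real" where
  "arc_length A g a b \<gamma> = integral {a..b} (curve_speed A g \<gamma>)"

definition pw_C1_on :: "('m::topological_space, 'n::finite) chart set \<Rightarrow> real \<Rightarrow> real \<Rightarrow> (real \<Rightarrow> 'm) \<Rightarrow> bool" where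
  "pw_C1_on A a b \<gamma> \<longleftrightarrow> continuous_on {a..b} \<gamma> \<and>
     (\<exists>S. finite S \<and> (\<forall>u v. a \<le> u \<and> u < v \<and> v \<le> b \<and> {u<..<v} \<inter> S = {} \<longrightarrow> C1_curve_on A {u..v} \<gamma>))"

lemma some_chart:
  assumes "smooth_atlas A"
  shows "(SOME c. c \<in> A \<and> p \<in> fst c) \<in> A \<and> p \<in> fst (SOME c. c \<in> A \<and> p \<in> fst c)"
  using someI_ex[of "\<lambda>c. c \<in> A \<and> p \<in> fst c"] chart_ex[OF assms] by blast

lemma curve_speed_image:
  assumes A: "smooth_atlas A" and f: "smooth_map A f" "preserves_metric A g f" and c: "c \<in> A" "\<gamma> t \<in> fst c"
    and cont: "isCont \<gamma> t" and der: "(snd c \<circ> \<gamma> has_vector_derivative v) (at t)"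
  shows "curve_speed A g (f \<circ> \<gamma>) t = tangent_norm g c (\<gamma> t) v"
proof -
  let ?e = "SOME e. e \<in> A \<and> (f \<circ> \<gamma>) t \<in> fst e"
  have e: "?e \<in> A" "f (\<gamma> t) \<in> fst ?e" using some_chart[OF A, of "(f \<circ> \<gamma>) t"] by auto
  have "(snd ?e \<circ> (f \<circ> \<gamma>) has_vector_derivative frechet_derivative (loc_rep c ?e f) (at (snd c (\<gamma> t))) v) (at t)"
    by (rule curve_image_has_vector_derivative[OF A f(1) c(1) e(1) UNIV_I c(2) e(2) cont der])
  then have "vector_derivative (snd ?e \<circ> (f \<circ> \<gamma>)) (at t) = frechet_derivative (loc_rep c ?e f) (at (snd c (\<gamma> t))) v"
    by (rule vector_derivative_at)
  then show ?thesis
    using tangent_norm_image[where v=v, OF f c(1) e(1) c(2) e(2)] by (simp add: curve_speed_def Let_def)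
qed

lemma curve_speed_eq:
  assumes "smooth_atlas A" "riemannian_metric A g" "c \<in> A" "\<gamma> t \<in> fst c"
    and "isCont \<gamma> t" "(snd c \<circ> \<gamma> has_vector_derivative v) (at t)"
  shows "curve_speed A g \<gamma> t = tangent_norm g c (\<gamma> t) v"
  using curve_speed_image[OF assms(1) smooth_map_id[OF assms(1)] preserves_metric_id[OF assms(2)] assms(3-)] by simp

lemma at_within_openin: "openin (top_of_set I) T \<Longrightarrow> t \<in> T \<Longrightarrow> at t within T = at t within I"
  by (auto simp: openin_open intro: at_within_nhd)

lemma openin_chart_times:
  assumes "smooth_atlas A" "c \<in> A" "continuous_on I \<gamma>"
  shows "openin (top_of_set I) {t\<in>I. \<gamma> t \<in> fst c}"
  using continuous_openin_preimage_gen[OF assms(3) chart_open(1)[OF assms(1,2)]] by (simp add: vimage_def Int_def)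

lemma C1_curve_on_iff:
  assumes A: "smooth_atlas A"
  shows "C1_curve_on A I \<gamma> \<longleftrightarrow> continuous_on I \<gamma> \<and>
     (\<forall>c\<in>A. \<exists>D. (\<forall>t\<in>I. \<gamma> t \<in> fst c \<longrightarrow> (snd c \<circ> \<gamma> has_vector_derivative D t) (at t within I)) \<and>
        continuous_on {t\<in>I. \<gamma> t \<in> fst c} D)"
proof -
  have "at t within {t\<in>I. \<gamma> t \<in> fst c} = at t within I"
    if "continuous_on I \<gamma>" "c \<in> A" "t \<in> I" "\<gamma> t \<in> fst c" for c t
    by (rule at_within_openin[OF openin_chart_times[OF A that(2,1)]]) (use that in simp)
  then have "(\<forall>t\<in>{t\<in>I. \<gamma> t \<in> fst c}. (snd c \<circ> \<gamma> has_vector_derivative D t) (at t within {t\<in>I. \<gamma> t \<in> fst c}))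
    \<longleftrightarrow> (\<forall>t\<in>I. \<gamma> t \<in> fst c \<longrightarrow> (snd c \<circ> \<gamma> has_vector_derivative D t) (at t within I))"
    if "continuous_on I \<gamma>" "c \<in> A" for c D
    using that by auto
  then show ?thesis unfolding C1_curve_on_def Let_def by (intro conj_cong refl ball_cong ex_cong) simp_all
qed

text \<open>It suffices to check differentiability in one chart around each time; the other charts follow by
  the chain rule.  The derivatives are expanded in the coordinate directions because smoothness
  gives continuity of each directional derivative separately.\<close>

lemma C1_curve_on_image:
  assumes A: "smooth_atlas A" and f: "smooth_map A f" and uv: "u < v" and cont: "continuous_on {u..v} \<gamma>"
    and loc: "\<And>t. t \<in> {u..v} \<Longrightarrow> \<exists>c\<in>A. \<gamma> t \<in> fst c \<and>
      (\<exists>D. (\<forall>s\<in>{u..v}. \<gamma> s \<in> fst c \<longrightarrow> (snd c \<circ> \<gamma> has_vector_derivative D s) (at s within {u..v})) \<and>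
        continuous_on {s\<in>{u..v}. \<gamma> s \<in> fst c} D)"
  shows "C1_curve_on A {u..v} (f \<circ> \<gamma>)"
  unfolding C1_curve_on_iff[OF A]
proof (intro conjI ballI)
  let ?I = "{u..v}"
  have cf: "continuous_on UNIV f" using f by (simp add: smooth_map_def)
  then show contf: "continuous_on ?I (f \<circ> \<gamma>)" by (intro continuous_on_compose cont continuous_on_subset[OF cf]) auto
  fix d assume d: "d \<in> A"
  let ?D = "\<lambda>t. vector_derivative (snd d \<circ> (f \<circ> \<gamma>)) (at t within ?I)"
  let ?T = "{t\<in>?I. (f \<circ> \<gamma>) t \<in> fst d}"
  have opT: "openin (top_of_set ?I) ?T" by (rule openin_chart_times[OF A d contf])
  have main: "(snd d \<circ> (f \<circ> \<gamma>) has_vector_derivative ?D t) (at t within ?I) \<and> continuous (at t within ?T) ?D" if t: "t \<in> ?T" for t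
  proof -
    obtain c D where c: "c \<in> A" "\<gamma> t \<in> fst c"
      and D: "\<And>s. s \<in> ?I \<Longrightarrow> \<gamma> s \<in> fst c \<Longrightarrow> (snd c \<circ> \<gamma> has_vector_derivative D s) (at s within ?I)"
      and contD: "continuous_on {s\<in>?I. \<gamma> s \<in> fst c} D"
      using loc[of t] t by blast
    let ?Tc = "{s\<in>?I. \<gamma> s \<in> fst c}" and ?F' = "\<lambda>x. frechet_derivative (loc_rep c d f) (at x)"
    let ?U = "?Tc \<inter> ?T"
    have opU: "openin (top_of_set ?I) ?U" by (intro openin_Int opT openin_chart_times[OF A c(1) cont])
    have tU: "t \<in> ?U" using t c by auto
    have der: "(snd d \<circ> (f \<circ> \<gamma>) has_vector_derivative ?F' (snd c (\<gamma> s)) (D s)) (at s within ?I)" if "s \<in> ?U" for s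
      using that D cont
      by (intro curve_image_has_vector_derivative[OF A f c(1) d]) (auto simp: continuous_on_eq_continuous_within)
    have eq: "?D s = ?F' (snd c (\<gamma> s)) (D s)" if "s \<in> ?U" for s
      by (rule vector_derivative_within_closed_interval[OF uv _ der[OF that]]) (use that in auto)
    have lin: "?F' (snd c (\<gamma> s)) w = (\<Sum>i\<in>UNIV. (w $ i) *\<^sub>R ?F' (snd c (\<gamma> s)) (axis i 1))" if "s \<in> ?U" for s w
    proof -
      have "linear (?F' (snd c (\<gamma> s)))"
        using that by (intro has_derivative_linear[OF smooth_map_loc_rep[OF f c(1) d]]) auto
      then have "?F' (snd c (\<gamma> s)) (\<Sum>i\<in>UNIV. (w $ i) *\<^sub>R axis i 1) = (\<Sum>i\<in>UNIV. (w $ i) *\<^sub>R ?F' (snd c (\<gamma> s)) (axis i 1))"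
        by (simp add: linear_sum linear_cmul)
      moreover have "(\<Sum>i\<in>UNIV. (w $ i) *\<^sub>R axis i 1) = w" by (simp add: basis_expansion scalar_mult_eq_scaleR[symmetric])
      ultimately show ?thesis by simp
    qed
    have "continuous_on ?U (\<lambda>s. \<Sum>i\<in>UNIV. (D s $ i) *\<^sub>R ?F' (snd c (\<gamma> s)) (axis i 1))"
    proof (intro continuous_intros)
      show "continuous_on ?U D" by (rule continuous_on_subset[OF contD]) auto
      fix i
      have "continuous_on ?U \<gamma>" by (rule continuous_on_subset[OF cont]) auto
      then have "continuous_on ?U (\<lambda>s. snd c (\<gamma> s))"
        by (rule continuous_on_compose2[OF continuous_on_chart(1)[OF A c(1)]]) auto
      then show "continuous_on ?U (\<lambda>s. ?F' (snd c (\<gamma> s)) (axis i 1))"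
        by (rule continuous_on_compose2[OF smooth_map_derivative_continuous[OF f c(1) d]]) auto
    qed
    then have "continuous_on ?U ?D"
      by (rule continuous_on_eq) (simp add: eq lin[symmetric])
    then have "continuous (at t within ?U) ?D" using tU by (simp add: continuous_on_eq_continuous_within)
    also have "at t within ?U = at t within ?I" by (rule at_within_openin[OF opU tU])
    also have "\<dots> = at t within ?T" by (rule at_within_openin[OF opT t, symmetric])
    finally have "continuous (at t within ?T) ?D" .
    then show ?thesis by (intro conjI) (simp only: eq[OF tU] der[OF tU])
  qed
  show "\<exists>D. (\<forall>t\<in>?I. (f \<circ> \<gamma>) t \<in> fst d \<longrightarrow> (snd d \<circ> (f \<circ> \<gamma>) has_vector_derivative D t) (at t within ?I)) \<and>
       continuous_on ?T D"
    using main by (intro exI[of _ ?D]) (auto simp: continuous_on_eq_continuous_within)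
qed

lemma pw_C1_on_image:
  assumes A: "smooth_atlas A" and f: "smooth_map A f" and \<gamma>: "pw_C1_on A a b \<gamma>"
  shows "pw_C1_on A a b (f \<circ> \<gamma>)"
proof -
  obtain S where S: "finite S" "\<And>u v. a \<le> u \<Longrightarrow> u < v \<Longrightarrow> v \<le> b \<Longrightarrow> {u<..<v} \<inter> S = {} \<Longrightarrow> C1_curve_on A {u..v} \<gamma>"
    using \<gamma> by (auto simp: pw_C1_on_def)
  have "C1_curve_on A {u..v} (f \<circ> \<gamma>)" if "a \<le> u" "u < v" "v \<le> b" "{u<..<v} \<inter> S = {}" for u v
  proof (rule C1_curve_on_image[OF A f \<open>u < v\<close>])
    note C = S(2)[OF that, unfolded C1_curve_on_iff[OF A]]
    show "continuous_on {u..v} \<gamma>" using C by blast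
    fix t
    obtain c where "c \<in> A" "\<gamma> t \<in> fst c" using chart_ex[OF A] by blast
    then show "\<exists>c\<in>A. \<gamma> t \<in> fst c \<and>
      (\<exists>D. (\<forall>s\<in>{u..v}. \<gamma> s \<in> fst c \<longrightarrow> (snd c \<circ> \<gamma> has_vector_derivative D s) (at s within {u..v})) \<and>
        continuous_on {s\<in>{u..v}. \<gamma> s \<in> fst c} D)" using C by blast
  qed
  moreover have "continuous_on {a..b} (f \<circ> \<gamma>)"
  proof (rule continuous_on_compose)
    show "continuous_on {a..b} \<gamma>" using \<gamma> by (simp add: pw_C1_on_def)
    show "continuous_on (\<gamma> ` {a..b}) f" using f continuous_on_subset by (auto simp: smooth_map_def)
  qed
  ultimately show ?thesis using S(1) by (auto simp: pw_C1_on_def)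
qed

lemma pw_C1_on_regular:
  assumes A: "smooth_atlas A" and \<gamma>: "pw_C1_on A a b \<gamma>"
  shows "\<exists>S. finite S \<and> a \<in> S \<and> b \<in> S \<and> (\<forall>t\<in>{a..b} - S. isCont \<gamma> t \<and>
    (\<forall>c\<in>A. \<gamma> t \<in> fst c \<longrightarrow> (\<exists>v. (snd c \<circ> \<gamma> has_vector_derivative v) (at t))))"
proof -
  obtain S where S: "finite S" "\<And>u v. a \<le> u \<Longrightarrow> u < v \<Longrightarrow> v \<le> b \<Longrightarrow> {u<..<v} \<inter> S = {} \<Longrightarrow> C1_curve_on A {u..v} \<gamma>"
    using \<gamma> by (auto simp: pw_C1_on_def)
  have regular: "isCont \<gamma> t \<and> (\<forall>c\<in>A. \<gamma> t \<in> fst c \<longrightarrow> (\<exists>v. (snd c \<circ> \<gamma> has_vector_derivative v) (at t)))"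
    if t: "t \<in> {a..b} - insert a (insert b S)" for t
  proof -
    have "open ({a<..<b} - S)" using S(1) by (intro open_Diff finite_imp_closed) auto
    moreover have "t \<in> {a<..<b} - S" using t by auto
    ultimately obtain e where e: "e > 0" "cball t e \<subseteq> {a<..<b} - S" using open_contains_cball by blast
    have "t - e \<in> cball t e" "t + e \<in> cball t e" using e(1) by (auto simp: dist_real_def)
    then have "t - e \<in> {a<..<b}" "t + e \<in> {a<..<b}" using e(2) by blast+
    then have ab: "a \<le> t - e" "t + e \<le> b" by auto
    have disj: "{t-e<..<t+e} \<inter> S = {}"
    proof -
      have "{t-e<..<t+e} \<subseteq> cball t e" by (auto simp: dist_real_def)
      then show ?thesis using e(2) by blast
    qed
    have C: "C1_curve_on A {t-e..t+e} \<gamma>" by (rule S(2)[OF ab(1) _ ab(2) disj]) (use e in simp)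
    have at: "at t within {t-e..t+e} = at t"
      by (rule at_within_interior) (use e(1) in \<open>simp add: interior_atLeastAtMost_real\<close>)
    have tI: "t \<in> {t-e..t+e}" using e(1) by simp
    have "continuous_on {t-e..t+e} \<gamma>" using C by (simp add: C1_curve_on_def)
    then have "continuous (at t within {t-e..t+e}) \<gamma>" using tI by (simp add: continuous_on_eq_continuous_within)
    then have "isCont \<gamma> t" unfolding at .
    moreover have "\<exists>v. (snd c \<circ> \<gamma> has_vector_derivative v) (at t)" if c: "c \<in> A" "\<gamma> t \<in> fst c" for c
    proof -
      obtain D where "\<forall>s\<in>{t-e..t+e}. \<gamma> s \<in> fst c \<longrightarrow> (snd c \<circ> \<gamma> has_vector_derivative D s) (at s within {t-e..t+e})"
        using C c(1) unfolding C1_curve_on_iff[OF A] by blast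
      then have "(snd c \<circ> \<gamma> has_vector_derivative D t) (at t within {t-e..t+e})" using tI c(2) by blast
      then show ?thesis unfolding at by blast
    qed
    ultimately show ?thesis by (intro conjI ballI impI)
  qed
  show ?thesis
    by (intro exI[of _ "insert a (insert b S)"] conjI ballI regular) (use S(1) in simp_all)
qed

lemma continuous_on_tangent_norm:
  assumes A: "smooth_atlas A" "riemannian_metric A g" and c: "c \<in> A"
    and "continuous_on T \<gamma>" "\<gamma> ` T \<subseteq> fst c" "continuous_on T D"
  shows "continuous_on T (\<lambda>s. tangent_norm g c (\<gamma> s) (D s))"
proof -
  have "continuous_on T (\<lambda>s. snd c (\<gamma> s))"
    using assms(4,5) by (intro continuous_on_compose2[OF continuous_on_chart(1)[OF A(1) c]]) auto
  then have "continuous_on T (\<lambda>s. g c (chart_inv c (snd c (\<gamma> s))))"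
    by (rule continuous_on_compose2[OF continuous_on_metric[OF A(2) c]]) (use assms(5) in auto)
  then have "continuous_on T (\<lambda>s. g c (\<gamma> s))"
    by (rule continuous_on_eq) (use assms(5) chart_inv_chart[OF A(1) c] in auto)
  then show ?thesis
    unfolding tangent_norm_def matrix_vector_mult_def using assms(6) by (intro continuous_intros) auto
qed

text \<open>Additive properties of intervals pass from the intervals between break points to all intervals.\<close>

lemma interval_split_induct:
  fixes Q :: "real \<Rightarrow> real \<Rightarrow> bool"
  assumes S: "finite S" and "a < b"
    and base: "\<And>u v. a \<le> u \<Longrightarrow> u < v \<Longrightarrow> v \<le> b \<Longrightarrow> {u<..<v} \<inter> S = {} \<Longrightarrow> Q u v"
    and join: "\<And>u v w. u < v \<Longrightarrow> v < w \<Longrightarrow> Q u v \<Longrightarrow> Q v w \<Longrightarrow> Q u w"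
  shows "Q a b"
proof -
  have "Q u v" if "a \<le> u" "u < v" "v \<le> b" for u v
    using that
  proof (induction "card ({u<..<v} \<inter> S)" arbitrary: u v rule: less_induct)
    case less
    show ?case
    proof (cases "{u<..<v} \<inter> S = {}")
      case False
      then obtain s where s: "s \<in> S" "u < s" "s < v" by auto
      have "card ({u<..<s} \<inter> S) < card ({u<..<v} \<inter> S)" "card ({s<..<v} \<inter> S) < card ({u<..<v} \<inter> S)"
        using S s by (auto intro!: psubset_card_mono)
      then show ?thesis using less s by (intro join[of u s v]) auto
    qed (use less base in auto)
  qed
  then show ?thesis using \<open>a < b\<close> by auto
qed

lemma curve_speed_integrable_C1:
  assumes A: "smooth_atlas A" "riemannian_metric A g" and uv: "u < v" and C: "C1_curve_on A {u..v} \<gamma>"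
  shows "curve_speed A g \<gamma> integrable_on {u..v}"
  unfolding interval_cbox
proof (rule integrable_on_little_subintervals, intro ballI)
  fix x assume x: "x \<in> cbox u v"
  obtain c where c: "c \<in> A" "\<gamma> x \<in> fst c" using chart_ex[OF A(1)] by blast
  have cont: "continuous_on {u..v} \<gamma>" using C by (simp add: C1_curve_on_def)
  let ?T = "{s\<in>{u..v}. \<gamma> s \<in> fst c}"
  obtain D where D: "\<And>s. s \<in> {u..v} \<Longrightarrow> \<gamma> s \<in> fst c \<Longrightarrow> (snd c \<circ> \<gamma> has_vector_derivative D s) (at s within {u..v})"
    and contD: "continuous_on ?T D"
    using C c(1) unfolding C1_curve_on_iff[OF A(1)] by blast
  have "openin (top_of_set {u..v}) ?T" by (rule openin_chart_times[OF A(1) c(1) cont])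
  moreover have "x \<in> ?T" using x c by auto
  ultimately obtain e where e: "e > 0" "ball x e \<inter> {u..v} \<subseteq> ?T" unfolding openin_contains_ball by blast
  have "curve_speed A g \<gamma> integrable_on cbox u' v'" if sub: "cbox u' v' \<subseteq> ball x e" "cbox u' v' \<subseteq> cbox u v" for u' v'
  proof (rule integrable_spike_finite)
    let ?h = "\<lambda>s. tangent_norm g c (\<gamma> s) (D s)"
    have T: "cbox u' v' \<subseteq> ?T" using sub e(2) by auto
    have "continuous_on ?T ?h"
      using cont contD by (intro continuous_on_tangent_norm[OF A c(1)]) (auto intro: continuous_on_subset)
    then show "?h integrable_on cbox u' v'" using T by (intro integrable_continuous) (rule continuous_on_subset)
    show "finite {u, v}" by simp
    fix s assume s: "s \<in> cbox u' v' - {u, v}"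
    then have sT: "s \<in> ?T" "u < s" "s < v" using T by (force+)
    have at: "at s within {u..v} = at s" by (rule at_within_interior) (use sT in simp)
    show "curve_speed A g \<gamma> s = ?h s"
    proof (rule curve_speed_eq[OF A c(1)])
      show "\<gamma> s \<in> fst c" using sT by auto
      show "isCont \<gamma> s" using cont sT at by (auto simp: continuous_on_eq_continuous_within dest!: bspec[of _ _ s])
      show "(snd c \<circ> \<gamma> has_vector_derivative D s) (at s)" using D[of s] sT at by auto
    qed
  qed
  then show "\<exists>d>0. \<forall>u' v'. x \<in> cbox u' v' \<and> cbox u' v' \<subseteq> ball x d \<and> cbox u' v' \<subseteq> cbox u v \<longrightarrow>
      curve_speed A g \<gamma> integrable_on cbox u' v'"
    using e(1) by blast
qed

lemma curve_speed_integrable: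
  assumes A: "smooth_atlas A" "riemannian_metric A g" and \<gamma>: "pw_C1_on A a b \<gamma>"
  shows "curve_speed A g \<gamma> integrable_on {a..b}"
proof (cases "a < b")
  case True
  obtain S where S: "finite S" "\<And>u v. a \<le> u \<Longrightarrow> u < v \<Longrightarrow> v \<le> b \<Longrightarrow> {u<..<v} \<inter> S = {} \<Longrightarrow> C1_curve_on A {u..v} \<gamma>"
    using \<gamma> by (auto simp: pw_C1_on_def)
  show ?thesis
  proof (rule interval_split_induct[OF S(1) True])
    show "curve_speed A g \<gamma> integrable_on {u..v}" if "a \<le> u" "u < v" "v \<le> b" "{u<..<v} \<inter> S = {}" for u v
      by (rule curve_speed_integrable_C1[OF A that(2) S(2)[OF that]])
    show "curve_speed A g \<gamma> integrable_on {u..w}" if "u < v" "v < w" "curve_speed A g \<gamma> integrable_on {u..v}"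
      "curve_speed A g \<gamma> integrable_on {v..w}" for u v w
      by (rule Henstock_Kurzweil_Integration.integrable_combine[of u v w]) (use that in auto)
  qed
next
  case False
  then show ?thesis using integrable_on_refl[of "curve_speed A g \<gamma>" b] by (cases "a = b") auto
qed

lemma curve_speed_nonneg:
  assumes "smooth_atlas A" "riemannian_metric A g"
  shows "0 \<le> curve_speed A g \<gamma> t"
  unfolding curve_speed_def Let_def using some_chart[OF assms(1), of "\<gamma> t"]
  by (auto intro: tangent_norm_nonneg[OF assms(2)])

lemma arc_length_nonneg:
  assumes "smooth_atlas A" "riemannian_metric A g" "pw_C1_on A a b \<gamma>"
  shows "0 \<le> arc_length A g a b \<gamma>"
  unfolding arc_length_def
  by (intro integral_nonneg curve_speed_integrable[OF assms] curve_speed_nonneg[OF assms(1,2)])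

lemma arc_length_image:
  assumes A: "smooth_atlas A" "riemannian_metric A g" and f: "smooth_map A f" "preserves_metric A g f"
    and \<gamma>: "pw_C1_on A a b \<gamma>"
  shows "arc_length A g a b (f \<circ> \<gamma>) = arc_length A g a b \<gamma>"
proof -
  from pw_C1_on_regular[OF A(1) \<gamma>] obtain S where
    *: "finite S \<and> a \<in> S \<and> b \<in> S \<and> (\<forall>t\<in>{a..b} - S. isCont \<gamma> t \<and>
      (\<forall>c\<in>A. \<gamma> t \<in> fst c \<longrightarrow> (\<exists>v. (snd c \<circ> \<gamma> has_vector_derivative v) (at t))))" ..
  then have S: "\<forall>t\<in>{a..b} - S. isCont \<gamma> t \<and> (\<forall>c\<in>A. \<gamma> t \<in> fst c \<longrightarrow> (\<exists>v. (snd c \<circ> \<gamma> has_vector_derivative v) (at t)))"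
    by (elim conjE)
  show ?thesis
    unfolding arc_length_def
  proof (rule integral_spike[OF negligible_finite[OF conjunct1[OF *]]])
    fix t assume t: "t \<in> {a..b} - S"
    obtain c where c: "c \<in> A" "\<gamma> t \<in> fst c" using chart_ex[OF A(1)] by blast
    then obtain v where v: "(snd c \<circ> \<gamma> has_vector_derivative v) (at t)" "isCont \<gamma> t" using bspec[OF S t] by blast
    show "curve_speed A g \<gamma> t = curve_speed A g (f \<circ> \<gamma>) t"
      using curve_speed_eq[OF A c v(2,1)] curve_speed_image[OF A(1) f c v(2,1)] by simp
  qed
qed

lemma C1_curve_on_cong:
  assumes A: "smooth_atlas A" and C: "C1_curve_on A I \<gamma>" and eq: "\<And>t. t \<in> I \<Longrightarrow> \<gamma>' t = \<gamma> t"
  shows "C1_curve_on A I \<gamma>'"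
  unfolding C1_curve_on_iff[OF A]
proof (intro conjI ballI)
  note C' = C[unfolded C1_curve_on_iff[OF A]]
  show "continuous_on I \<gamma>'" using C' eq by (metis continuous_on_cong)
  fix c assume c: "c \<in> A"
  obtain D where D: "\<And>t. t \<in> I \<Longrightarrow> \<gamma> t \<in> fst c \<Longrightarrow> (snd c \<circ> \<gamma> has_vector_derivative D t) (at t within I)"
    "continuous_on {t\<in>I. \<gamma> t \<in> fst c} D" using C' c by blast
  have "{t\<in>I. \<gamma>' t \<in> fst c} = {t\<in>I. \<gamma> t \<in> fst c}" using eq by auto
  moreover have "(snd c \<circ> \<gamma>' has_vector_derivative D t) (at t within I)" if "t \<in> I" "\<gamma>' t \<in> fst c" for t
    by (rule has_vector_derivative_transform[OF that(1) _ D(1)]) (use eq that in auto)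
  ultimately show "\<exists>D. (\<forall>t\<in>I. \<gamma>' t \<in> fst c \<longrightarrow> (snd c \<circ> \<gamma>' has_vector_derivative D t) (at t within I)) \<and>
      continuous_on {t\<in>I. \<gamma>' t \<in> fst c} D" using D(2) by (intro exI[of _ D]) auto
qed

lemma pw_C1_on_cong:
  assumes A: "smooth_atlas A" and \<gamma>: "pw_C1_on A a b \<gamma>" and eq: "\<And>t. t \<in> {a..b} \<Longrightarrow> \<gamma>' t = \<gamma> t"
  shows "pw_C1_on A a b \<gamma>'"
proof -
  obtain S where S: "finite S" "\<And>u v. a \<le> u \<Longrightarrow> u < v \<Longrightarrow> v \<le> b \<Longrightarrow> {u<..<v} \<inter> S = {} \<Longrightarrow> C1_curve_on A {u..v} \<gamma>"
    using \<gamma> by (auto simp: pw_C1_on_def)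
  have "C1_curve_on A {u..v} \<gamma>'" if "a \<le> u" "u < v" "v \<le> b" "{u<..<v} \<inter> S = {}" for u v
    by (rule C1_curve_on_cong[OF A S(2)[OF that]]) (use that eq in auto)
  moreover have "continuous_on {a..b} \<gamma>'"
    using \<gamma> eq unfolding pw_C1_on_def by (metis continuous_on_cong)
  ultimately show ?thesis using S(1) unfolding pw_C1_on_def by blast
qed

lemma pw_C1_on_speed:
  assumes A: "smooth_atlas A" "riemannian_metric A g" and \<gamma>: "pw_C1_on A a b \<gamma>"
  shows "\<exists>S. finite S \<and> a \<in> S \<and> b \<in> S \<and> (\<forall>t\<in>{a..b} - S. isCont \<gamma> t \<and>
    (\<exists>c\<in>A. \<exists>v. \<gamma> t \<in> fst c \<and> (snd c \<circ> \<gamma> has_vector_derivative v) (at t) \<and> curve_speed A g \<gamma> t = tangent_norm g c (\<gamma> t) v))"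
proof -
  from pw_C1_on_regular[OF A(1) \<gamma>] obtain S where
    S: "finite S \<and> a \<in> S \<and> b \<in> S \<and> (\<forall>t\<in>{a..b} - S. isCont \<gamma> t \<and>
      (\<forall>c\<in>A. \<gamma> t \<in> fst c \<longrightarrow> (\<exists>v. (snd c \<circ> \<gamma> has_vector_derivative v) (at t))))" ..
  have "isCont \<gamma> t \<and> (\<exists>c\<in>A. \<exists>v. \<gamma> t \<in> fst c \<and> (snd c \<circ> \<gamma> has_vector_derivative v) (at t) \<and>
      curve_speed A g \<gamma> t = tangent_norm g c (\<gamma> t) v)" if t: "t \<in> {a..b} - S" for t
  proof -
    obtain c where c: "c \<in> A" "\<gamma> t \<in> fst c" using chart_ex[OF A(1)] by blast
    then obtain v where v: "isCont \<gamma> t" "(snd c \<circ> \<gamma> has_vector_derivative v) (at t)" using S t by blast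
    show ?thesis using curve_speed_eq[OF A c v] c v by blast
  qed
  then show ?thesis using S by (intro exI[of _ S]) simp
qed

lemma arc_length_cong:
  assumes A: "smooth_atlas A" "riemannian_metric A g" and \<gamma>: "pw_C1_on A a b \<gamma>"
    and eq: "\<And>t. t \<in> {a..b} \<Longrightarrow> \<gamma>' t = \<gamma> t"
  shows "arc_length A g a b \<gamma>' = arc_length A g a b \<gamma>"
proof -
  from pw_C1_on_speed[OF A \<gamma>] obtain S where
    S: "finite S \<and> a \<in> S \<and> b \<in> S \<and> (\<forall>t\<in>{a..b} - S. isCont \<gamma> t \<and>
    (\<exists>c\<in>A. \<exists>v. \<gamma> t \<in> fst c \<and> (snd c \<circ> \<gamma> has_vector_derivative v) (at t) \<and> curve_speed A g \<gamma> t = tangent_norm g c (\<gamma> t) v))" ..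
  have neg: "negligible S" using S by (intro negligible_finite) simp
  show ?thesis
    unfolding arc_length_def
  proof (rule integral_spike[OF neg])
    fix t assume t: "t \<in> {a..b} - S"
    then obtain c v where c: "c \<in> A" "\<gamma> t \<in> fst c" "isCont \<gamma> t" and v: "(snd c \<circ> \<gamma> has_vector_derivative v) (at t)"
      and sp: "curve_speed A g \<gamma> t = tangent_norm g c (\<gamma> t) v" using S by blast
    have t': "t \<in> {a<..<b}" using t S by (metis DiffE atLeastAtMost_iff greaterThanLessThan_iff order_less_le)
    have ev: "eventually (\<lambda>s. \<gamma>' s = \<gamma> s) (nhds t)"
      using t' eq by (auto simp: eventually_nhds intro!: exI[of _ "{a<..<b}"])
    have "isCont \<gamma>' t" using c(3) isCont_cong[OF ev] by simp
    moreover have "(snd c \<circ> \<gamma>' has_vector_derivative v) (at t)"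
      using has_vector_derivative_transform_within_open[OF v _ t'] eq by fastforce
    moreover have "\<gamma>' t = \<gamma> t" using t eq by auto
    ultimately show "curve_speed A g \<gamma> t = curve_speed A g \<gamma>' t"
      using curve_speed_eq[OF A c(1), of \<gamma>' t v] c(2) sp by simp
  qed
qed

lemma C1_curve_on_affine:
  assumes A: "smooth_atlas A" and C: "C1_curve_on A ((\<lambda>s. m * s + q) ` I) \<gamma>"
  shows "C1_curve_on A I (\<lambda>s. \<gamma> (m * s + q))"
  unfolding C1_curve_on_iff[OF A]
proof (intro conjI ballI)
  let ?h = "\<lambda>s. m * s + q :: real"
  note C' = C[unfolded C1_curve_on_iff[OF A]]
  have ch: "continuous_on T ?h" for T by (intro continuous_intros)
  show "continuous_on I (\<lambda>s. \<gamma> (?h s))"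
    by (rule continuous_on_compose2[OF conjunct1[OF C'] ch]) auto
  fix c assume c: "c \<in> A"
  obtain D where D: "\<And>t. t \<in> ?h ` I \<Longrightarrow> \<gamma> t \<in> fst c \<Longrightarrow> (snd c \<circ> \<gamma> has_vector_derivative D t) (at t within ?h ` I)"
    "continuous_on {t\<in>?h ` I. \<gamma> t \<in> fst c} D" using C' c by blast
  have "(snd c \<circ> (\<lambda>s. \<gamma> (?h s)) has_vector_derivative m *\<^sub>R D (?h s)) (at s within I)" if "s \<in> I" "\<gamma> (?h s) \<in> fst c" for s
  proof -
    have "(?h has_vector_derivative m) (at s within I)"
      by (auto intro!: derivative_eq_intros simp: has_real_derivative_iff_has_vector_derivative[symmetric])
    moreover have "(snd c \<circ> \<gamma> has_vector_derivative D (?h s)) (at (?h s) within ?h ` I)"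
      by (rule D(1)) (use that in auto)
    ultimately have "(snd c \<circ> \<gamma> \<circ> ?h has_vector_derivative m *\<^sub>R D (?h s)) (at s within I)"
      by (rule vector_diff_chain_within)
    then show ?thesis by (simp add: o_def)
  qed
  moreover have "continuous_on {s\<in>I. \<gamma> (?h s) \<in> fst c} (\<lambda>s. m *\<^sub>R D (?h s))"
    by (intro continuous_intros continuous_on_compose2[OF D(2) ch]) auto
  ultimately show "\<exists>D. (\<forall>t\<in>I. \<gamma> (?h t) \<in> fst c \<longrightarrow> (snd c \<circ> (\<lambda>s. \<gamma> (?h s)) has_vector_derivative D t) (at t within I)) \<and>
      continuous_on {t\<in>I. \<gamma> (?h t) \<in> fst c} D"
    by (intro exI[of _ "\<lambda>s. m *\<^sub>R D (?h s)"] conjI ballI impI)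
qed

lemma pw_C1_on_affine:
  assumes A: "smooth_atlas A" and \<gamma>: "pw_C1_on A a b \<gamma>" and m: "m \<noteq> 0" and img: "(\<lambda>s. m * s + q) ` {a'..b'} = {a..b}"
  shows "pw_C1_on A a' b' (\<lambda>s. \<gamma> (m * s + q))"
proof -
  let ?h = "\<lambda>s. m * s + q :: real"
  obtain S where S: "finite S" "\<And>u v. a \<le> u \<Longrightarrow> u < v \<Longrightarrow> v \<le> b \<Longrightarrow> {u<..<v} \<inter> S = {} \<Longrightarrow> C1_curve_on A {u..v} \<gamma>"
    using \<gamma> by (auto simp: pw_C1_on_def)
  have inj: "inj ?h" using m by (auto simp: inj_def)
  have "C1_curve_on A {u..v} (\<lambda>s. \<gamma> (?h s))" if uv: "a' \<le> u" "u < v" "v \<le> b'" "{u<..<v} \<inter> ?h -` S = {}" for u v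
  proof (rule C1_curve_on_affine[OF A])
    have "u \<in> {a'..b'}" "v \<in> {a'..b'}" using uv by auto
    then have "?h u \<in> {a..b}" "?h v \<in> {a..b}" unfolding img[symmetric] by (blast intro: imageI)+
    then have in_ab: "a \<le> ?h u" "?h u \<le> b" "a \<le> ?h v" "?h v \<le> b" by auto
    show "C1_curve_on A (?h ` {u..v}) \<gamma>"
    proof (cases "0 < m")
      case True
      have "?h ` {u..v} = {?h u..?h v}" using True uv(2) by (simp add: image_affinity_atLeastAtMost)
      moreover have "?h u < ?h v" using True uv(2) by simp
      moreover have "{?h u<..<?h v} \<inter> S = {}"
      proof safe
        fix x assume x: "x \<in> {?h u<..<?h v}" "x \<in> S"
        then have "(x - q) / m \<in> {u<..<v}" using True by (auto simp: field_simps)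
        moreover have "?h ((x - q) / m) = x" using m by simp
        ultimately show "x \<in> {}" using uv(4) x(2) by blast
      qed
      ultimately show ?thesis using S(2) in_ab by simp
    next
      case False
      then have m0: "m < 0" using m by simp
      have "?h ` {u..v} = {?h v..?h u}" using m0 uv(2) by (simp add: image_affinity_atLeastAtMost)
      moreover have "?h v < ?h u" using m0 uv(2) by simp
      moreover have "{?h v<..<?h u} \<inter> S = {}"
      proof safe
        fix x assume x: "x \<in> {?h v<..<?h u}" "x \<in> S"
        then have "(x - q) / m \<in> {u<..<v}" using m0 by (auto simp: field_simps)
        moreover have "?h ((x - q) / m) = x" using m by simp
        ultimately show "x \<in> {}" using uv(4) x(2) by blast
      qed
      ultimately show ?thesis using S(2) in_ab by simp
    qed
  qed
  moreover have "finite (?h -` S)" using S(1) inj by (rule finite_vimageI)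
  moreover have "continuous_on {a'..b'} (\<lambda>s. \<gamma> (?h s))"
  proof (rule continuous_on_compose2[of "{a..b}" \<gamma>])
    show "continuous_on {a..b} \<gamma>" using \<gamma> by (simp add: pw_C1_on_def)
    show "continuous_on {a'..b'} ?h" by (intro continuous_intros)
    show "?h ` {a'..b'} \<subseteq> {a..b}" by (simp add: img)
  qed
  ultimately show ?thesis unfolding pw_C1_on_def by blast
qed

lemma arc_length_affine:
  assumes A: "smooth_atlas A" "riemannian_metric A g" and \<gamma>: "pw_C1_on A a b \<gamma>"
    and m: "m \<noteq> 0" and img: "(\<lambda>s. m * s + q) ` {a'..b'} = {a..b}"
  shows "arc_length A g a' b' (\<lambda>s. \<gamma> (m * s + q)) = arc_length A g a b \<gamma>"
proof -
  let ?h = "\<lambda>s. m * s + q :: real"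
  from pw_C1_on_speed[OF A \<gamma>] obtain S where
    S: "finite S \<and> a \<in> S \<and> b \<in> S \<and> (\<forall>t\<in>{a..b} - S. isCont \<gamma> t \<and>
    (\<exists>c\<in>A. \<exists>v. \<gamma> t \<in> fst c \<and> (snd c \<circ> \<gamma> has_vector_derivative v) (at t) \<and> curve_speed A g \<gamma> t = tangent_norm g c (\<gamma> t) v))" ..
  have inj: "inj ?h" using m by (auto simp: inj_def)
  have neg: "negligible (?h -` S)" using S inj by (intro negligible_finite finite_vimageI) auto
  have "(curve_speed A g \<gamma> has_integral arc_length A g a b \<gamma>) (cbox a b)"
    unfolding arc_length_def using curve_speed_integrable[OF A \<gamma>] by (simp add: integrable_integral)
  from has_integral_affinity[OF this m, of q]
  have "((\<lambda>s. curve_speed A g \<gamma> (?h s)) has_integral (1 / \<bar>m\<bar>) * arc_length A g a b \<gamma>) ((\<lambda>x. (1 / m) * x + - ((1 / m) * q)) ` {a..b})"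
    by simp
  also have "(\<lambda>x. (1 / m) * x + - ((1 / m) * q)) ` {a..b} = {a'..b'}"
    unfolding img[symmetric] image_image using m by (simp add: field_simps)
  finally have "((\<lambda>s. \<bar>m\<bar> * curve_speed A g \<gamma> (?h s)) has_integral \<bar>m\<bar> * ((1 / \<bar>m\<bar>) * arc_length A g a b \<gamma>)) {a'..b'}"
    by (rule has_integral_mult_right)
  then have I: "((\<lambda>s. \<bar>m\<bar> * curve_speed A g \<gamma> (?h s)) has_integral arc_length A g a b \<gamma>) {a'..b'}"
    using m by simp
  have "(curve_speed A g (\<lambda>s. \<gamma> (?h s)) has_integral arc_length A g a b \<gamma>) {a'..b'}"
  proof (rule has_integral_spike[OF neg _ I])
    fix s assume s: "s \<in> {a'..b'} - ?h -` S"
    then have "?h s \<in> {a..b} - S" unfolding img[symmetric] by auto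
    then obtain c v where c: "c \<in> A" "\<gamma> (?h s) \<in> fst c" "isCont \<gamma> (?h s)"
      and v: "(snd c \<circ> \<gamma> has_vector_derivative v) (at (?h s))"
      and sp: "curve_speed A g \<gamma> (?h s) = tangent_norm g c (\<gamma> (?h s)) v" using S by blast
    have "(?h has_vector_derivative m) (at s)"
      by (auto intro!: derivative_eq_intros simp: has_real_derivative_iff_has_vector_derivative[symmetric])
    from vector_diff_chain_at[OF this v] have "(snd c \<circ> (\<lambda>s. \<gamma> (?h s)) has_vector_derivative m *\<^sub>R v) (at s)"
      by (simp add: o_def)
    moreover have "isCont (\<lambda>s. \<gamma> (?h s)) s"
      using c(3) by (intro isCont_o2[of s ?h \<gamma>] continuous_intros) auto
    ultimately show "curve_speed A g (\<lambda>s. \<gamma> (?h s)) s = \<bar>m\<bar> * curve_speed A g \<gamma> (?h s)"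
      using curve_speed_eq[OF A c(1), of "\<lambda>s. \<gamma> (?h s)" s "m *\<^sub>R v"] c(2) by (simp add: tangent_norm_scaleR sp)
  qed
  then show ?thesis unfolding arc_length_def[of _ _ a'] by (rule integral_unique)
qed

lemma pw_C1_on_subinterval:
  assumes "pw_C1_on A a b \<gamma>" "a \<le> a'" "b' \<le> b"
  shows "pw_C1_on A a' b' \<gamma>"
proof -
  obtain S where S: "finite S" "\<And>u v. a \<le> u \<Longrightarrow> u < v \<Longrightarrow> v \<le> b \<Longrightarrow> {u<..<v} \<inter> S = {} \<Longrightarrow> C1_curve_on A {u..v} \<gamma>"
    using assms(1) by (auto simp: pw_C1_on_def)
  have "C1_curve_on A {u..v} \<gamma>" if "a' \<le> u" "u < v" "v \<le> b'" "{u<..<v} \<inter> S = {}" for u v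
    by (rule S(2)) (use that assms in auto)
  moreover have "continuous_on {a'..b'} \<gamma>"
    using assms by (auto simp: pw_C1_on_def intro: continuous_on_subset)
  ultimately show ?thesis using S(1) unfolding pw_C1_on_def by blast
qed

lemma pw_C1_on_join:
  assumes ab: "pw_C1_on A a b \<gamma>" and bc: "pw_C1_on A b c \<gamma>" and le: "a \<le> b" "b \<le> c"
  shows "pw_C1_on A a c \<gamma>"
proof -
  obtain S where S: "finite S" "\<And>u v. a \<le> u \<Longrightarrow> u < v \<Longrightarrow> v \<le> b \<Longrightarrow> {u<..<v} \<inter> S = {} \<Longrightarrow> C1_curve_on A {u..v} \<gamma>"
    using ab by (auto simp: pw_C1_on_def)
  obtain T where T: "finite T" "\<And>u v. b \<le> u \<Longrightarrow> u < v \<Longrightarrow> v \<le> c \<Longrightarrow> {u<..<v} \<inter> T = {} \<Longrightarrow> C1_curve_on A {u..v} \<gamma>"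
    using bc by (auto simp: pw_C1_on_def)
  have "C1_curve_on A {u..v} \<gamma>" if uv: "a \<le> u" "u < v" "v \<le> c" "{u<..<v} \<inter> insert b (S \<union> T) = {}" for u v
  proof -
    have "v \<le> b \<or> b \<le> u" using uv(4) by (meson disjoint_iff greaterThanLessThan_iff insertI1 leI)
    then show ?thesis
    proof
      assume "v \<le> b"
      then show ?thesis using uv by (intro S(2)) auto
    next
      assume "b \<le> u"
      then show ?thesis using uv by (intro T(2)) auto
    qed
  qed
  moreover have "continuous_on {a..c} \<gamma>"
  proof -
    have "{a..c} = {a..b} \<union> {b..c}" using le by auto
    then show ?thesis using ab bc by (simp add: pw_C1_on_def continuous_on_closed_Un)
  qed
  ultimately show ?thesis using S(1) T(1) unfolding pw_C1_on_def by (intro conjI exI[of _ "insert b (S \<union> T)"]) auto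
qed

lemma arc_length_join:
  assumes A: "smooth_atlas A" "riemannian_metric A g"
    and \<gamma>: "pw_C1_on A a c \<gamma>" and le: "a \<le> b" "b \<le> c"
  shows "arc_length A g a c \<gamma> = arc_length A g a b \<gamma> + arc_length A g b c \<gamma>"
  unfolding arc_length_def
  by (rule Henstock_Kurzweil_Integration.integral_combine[OF le curve_speed_integrable[OF A \<gamma>], symmetric])

section \<open>The Riemannian distance\<close>

lemma curve_length_eq_arc_length: "curve_length A g \<gamma> = arc_length A g 0 1 \<gamma>"
  unfolding curve_length_def arc_length_def
proof (rule integral_spike[of "{0, 1}"])
  fix t :: real assume t: "t \<in> {0..1} - {0, 1}"
  then have "at t within {0..1} = at t" by (intro at_within_interior) auto
  then show "curve_speed A g \<gamma> t = speed A g \<gamma> t"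
    by (simp add: speed_def curve_speed_def tangent_norm_def Let_def)
qed simp

lemma pw_C1_curve_eq: "pw_C1_curve A \<gamma> \<longleftrightarrow> pw_C1_on A 0 1 \<gamma>"
  by (simp add: pw_C1_curve_def pw_C1_on_def)

lemma rdist_eq:
  "rdist A g x y = Inf {arc_length A g 0 1 \<gamma> | \<gamma>. pw_C1_on A 0 1 \<gamma> \<and> \<gamma> 0 = x \<and> \<gamma> 1 = y}"
  by (simp add: rdist_def curve_length_eq_arc_length pw_C1_curve_eq)

lemma segment_curve:
  assumes A: "smooth_atlas A" "riemannian_metric A g" and c: "c \<in> A"
    and seg: "closed_segment x y \<subseteq> snd c ` fst c"
    and B: "\<And>z v. z \<in> closed_segment x y \<Longrightarrow> tangent_norm g c (chart_inv c z) v \<le> B * norm v"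
  shows "pw_C1_on A 0 1 (\<lambda>s. chart_inv c (linepath x y s))"
    and "arc_length A g 0 1 (\<lambda>s. chart_inv c (linepath x y s)) \<le> B * norm (y - x)"
proof -
  let ?\<gamma> = "\<lambda>s. chart_inv c (linepath x y s)"
  have inseg: "linepath x y s \<in> closed_segment x y" if "s \<in> {0..1}" for s
    using linepath_image_01[of x y] that by blast
  have inU: "?\<gamma> s \<in> fst c" "snd c (?\<gamma> s) = linepath x y s" if "s \<in> {0..1}" for s
    using inseg[OF that] seg chart_chart_inv[OF A(1) c] by blast+
  have cont: "continuous_on {0..1} ?\<gamma>"
    by (rule continuous_on_compose2[OF continuous_on_chart(2)[OF A(1) c] continuous_on_linepath]) (use inseg seg in blast)
  have vd: "(snd c \<circ> ?\<gamma> has_vector_derivative (y - x)) (at s within {u..v})" if "s \<in> {u..v}" "{u..v} \<subseteq> {0..1}" for s u v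
  proof (rule has_vector_derivative_transform[OF that(1)])
    show "(linepath x y has_vector_derivative (y - x)) (at s within {u..v})"
      by (rule has_vector_derivative_linepath_within)
    show "(snd c \<circ> ?\<gamma>) r = linepath x y r" if "r \<in> {u..v}" for r using inU(2)[of r] that \<open>{u..v} \<subseteq> {0..1}\<close> by auto
  qed
  have "C1_curve_on A {u..v} (id \<circ> ?\<gamma>)" if uv: "0 \<le> u" "u < v" "v \<le> 1" for u v
  proof (rule C1_curve_on_image[OF A(1) smooth_map_id[OF A(1)] uv(2)])
    have sub: "{u..v} \<subseteq> {0..1}" using uv by auto
    show "continuous_on {u..v} ?\<gamma>" by (rule continuous_on_subset[OF cont sub])
    fix t assume "t \<in> {u..v}"
    then have "?\<gamma> t \<in> fst c" using inU(1) sub by blast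
    then show "\<exists>c\<in>A. ?\<gamma> t \<in> fst c \<and> (\<exists>D. (\<forall>s\<in>{u..v}. ?\<gamma> s \<in> fst c \<longrightarrow> (snd c \<circ> ?\<gamma> has_vector_derivative D s) (at s within {u..v})) \<and>
        continuous_on {s\<in>{u..v}. ?\<gamma> s \<in> fst c} D)"
      using vd[OF _ sub] by (intro bexI[OF _ c] conjI exI[of _ "\<lambda>_. y - x"]) (auto intro: continuous_intros)
  qed
  then show C1: "pw_C1_on A 0 1 ?\<gamma>"
    unfolding pw_C1_on_def using cont by (intro conjI exI[of _ "{}"]) auto
  have "integral {0..1} (curve_speed A g ?\<gamma>) \<le> integral {0..1::real} (\<lambda>t. if t \<in> {0, 1} then curve_speed A g ?\<gamma> t else B * norm (y - x))"
  proof (rule integral_le)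
    show "curve_speed A g ?\<gamma> integrable_on {0..1}" by (rule curve_speed_integrable[OF A C1])
    show "(\<lambda>t. if t \<in> {0, 1} then curve_speed A g ?\<gamma> t else B * norm (y - x)) integrable_on {0..1}"
      by (rule integrable_spike_finite[of "{0, 1}" _ _ "\<lambda>_. B * norm (y - x)"]) auto
    fix t :: real assume t: "t \<in> {0..1}"
    show "curve_speed A g ?\<gamma> t \<le> (if t \<in> {0, 1} then curve_speed A g ?\<gamma> t else B * norm (y - x))"
    proof (cases "t \<in> {0, 1}")
      case False
      then have at: "at t within {0..1} = at t" using t by (intro at_within_interior) auto
      have "isCont ?\<gamma> t" using cont t at by (auto simp: continuous_on_eq_continuous_within dest!: bspec[of _ _ t])
      moreover have "(snd c \<circ> ?\<gamma> has_vector_derivative (y - x)) (at t)" using vd[OF t] at by simp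
      ultimately have "curve_speed A g ?\<gamma> t = tangent_norm g c (?\<gamma> t) (y - x)"
        by (rule curve_speed_eq[where \<gamma>="?\<gamma>", OF A c inU(1)[OF t]])
      then show ?thesis using B[OF inseg[OF t]] False by simp
    qed simp
  qed
  also have "\<dots> = integral {0..1::real} (\<lambda>_. B * norm (y - x))"
    by (rule integral_spike[of "{0, 1}"]) auto
  finally show "arc_length A g 0 1 ?\<gamma> \<le> B * norm (y - x)"
    unfolding arc_length_def by simp
qed

text \<open>On a compact set of coordinates the Riemannian norm is comparable to the Euclidean one, by
  compactness of the unit sphere bundle.\<close>

lemma metric_bounds:
  assumes A: "smooth_atlas A" "riemannian_metric A g" and c: "c \<in> A" and K: "compact K" "K \<subseteq> snd c ` fst c"
  shows "\<exists>m B. 0 < m \<and> 0 < B \<and> (\<forall>z\<in>K. \<forall>v. m * norm v \<le> tangent_norm g c (chart_inv c z) v \<and>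
    tangent_norm g c (chart_inv c z) v \<le> B * norm v)"
proof (cases "K = {}")
  case True
  then show ?thesis by (auto intro!: exI[of _ 1])
next
  case False
  let ?X = "K \<times> sphere (0 :: real ^ 'b) 1"
  let ?f = "\<lambda>(z, v). tangent_norm g c (chart_inv c z) v"
  have cX: "compact ?X" by (intro compact_Times K compact_sphere)
  have "axis undefined 1 \<in> sphere (0 :: real ^ 'b) 1" by simp
  then have ne: "?X \<noteq> {}" using False by auto
  have pos: "0 < ?f p" if "p \<in> ?X" for p
  proof -
    obtain z v where p: "p = (z, v)" by (cases p)
    then have "z \<in> K" "v \<noteq> 0" using that by auto
    then have "chart_inv c z \<in> fst c" using K(2) chart_chart_inv(1)[OF A(1) c] by blast
    then have "v \<bullet> (g c (chart_inv c z) *v v) > 0" using A(2) c \<open>v \<noteq> 0\<close> by (auto simp: riemannian_metric_def)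
    then show ?thesis by (simp add: p tangent_norm_def)
  qed
  have cont: "continuous_on ?X ?f"
  proof -
    have "continuous_on ?X (\<lambda>p. g c (chart_inv c (fst p)))"
      by (rule continuous_on_compose2[OF continuous_on_subset[OF continuous_on_metric[OF A(2) c] K(2)] continuous_on_fst[OF continuous_on_id]]) auto
    then show ?thesis
      unfolding tangent_norm_def matrix_vector_mult_def case_prod_unfold by (intro continuous_intros) auto
  qed
  obtain p where p: "p \<in> ?X" "\<And>r. r \<in> ?X \<Longrightarrow> ?f p \<le> ?f r"
    using continuous_attains_inf[OF cX ne cont] by blast
  obtain r where r: "r \<in> ?X" "\<And>p. p \<in> ?X \<Longrightarrow> ?f p \<le> ?f r"
    using continuous_attains_sup[OF cX ne cont] by blast
  have "?f p * norm v \<le> tangent_norm g c (chart_inv c z) v \<and> tangent_norm g c (chart_inv c z) v \<le> ?f r * norm v"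
    if z: "z \<in> K" for z v
  proof (cases "v = 0")
    case True
    then show ?thesis by (simp add: tangent_norm_def)
  next
    case False
    let ?u = "(1 / norm v) *\<^sub>R v"
    have "(z, ?u) \<in> ?X" using z False by simp
    then have "?f p \<le> ?f (z, ?u)" "?f (z, ?u) \<le> ?f r" using p r by blast+
    moreover have "?f (z, ?u) * norm v = tangent_norm g c (chart_inv c z) v"
      using False by (simp only: case_prod_conv tangent_norm_scaleR) simp
    ultimately show ?thesis
      using mult_right_mono[of "?f p" "?f (z, ?u)" "norm v"] mult_right_mono[of "?f (z, ?u)" "?f r" "norm v"] by simp
  qed
  then show ?thesis using pos[OF p(1)] pos[OF r(1)] by blast
qed

text \<open>The inverse preserves the metric since, by the chain rule, its Jacobian is inverse to that of
  \<open>f\<close>.\<close>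

lemma isometry_inv:
  assumes A: "smooth_atlas A" and f: "riemannian_isometry A g f"
  shows "riemannian_isometry A g (inv f)"
proof -
  have bij: "bij f" and sf: "smooth_map A f" and si: "smooth_map A (inv f)" and pm: "preserves_metric A g f"
    using f by (auto simp: riemannian_isometry_def)
  have ff: "f (inv f p) = p" for p using bij by (simp add: bij_is_surj surj_f_inv_f)
  have "g c p = transpose (jacobian c d (inv f) p) ** g d (inv f p) ** jacobian c d (inv f) p"
    if c: "c \<in> A" "d \<in> A" and p: "p \<in> fst c" "inv f p \<in> fst d" for c d p
  proof -
    let ?G = "loc_rep c d (inv f)" and ?F = "loc_rep d c f"
    let ?J = "jacobian d c f (inv f p)" and ?J' = "jacobian c d (inv f) p"
    let ?W = "snd c ` (fst c \<inter> inv f -` fst d)"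
    have Gp: "?G (snd c p) = snd d (inv f p)"
      by (simp add: loc_rep_def chart_inv_chart[OF A c(1) p(1)])
    have dG: "(?G has_derivative frechet_derivative ?G (at (snd c p))) (at (snd c p))"
      by (rule smooth_map_loc_rep[OF si c p])
    have dF: "(?F has_derivative frechet_derivative ?F (at (snd d (inv f p)))) (at (?G (snd c p)))"
      unfolding Gp by (rule smooth_map_loc_rep[OF sf c(2,1) p(2)]) (simp add: ff p)
    have comp: "((?F \<circ> ?G) has_derivative (frechet_derivative ?F (at (snd d (inv f p))) \<circ> frechet_derivative ?G (at (snd c p)))) (at (snd c p))"
      by (rule diff_chain_at[OF dG dF])
    have oW: "open ?W"
      using si by (intro open_transition_domain(2)[OF A _ c]) (simp add: smooth_map_def)
    have pW: "snd c p \<in> ?W" using p by blast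
    have idW: "(?F \<circ> ?G) x = id x" if "x \<in> ?W" for x
      using that by (auto simp: loc_rep_def chart_inv_chart[OF A c(1)] chart_inv_chart[OF A c(2)] ff)
    have "(id has_derivative (frechet_derivative ?F (at (snd d (inv f p))) \<circ> frechet_derivative ?G (at (snd c p)))) (at (snd c p))"
      by (rule has_derivative_transform_within_open[OF comp oW pW idW])
    then have eq: "frechet_derivative ?F (at (snd d (inv f p))) \<circ> frechet_derivative ?G (at (snd c p)) = id"
      using has_derivative_unique has_derivative_id by blast
    have "?J ** ?J' = matrix (frechet_derivative ?F (at (snd d (inv f p))) \<circ> frechet_derivative ?G (at (snd c p)))"
      unfolding jacobian_def by (rule matrix_compose[symmetric]) (use dG dF in \<open>auto intro: has_derivative_linear\<close>)
    then have JJ: "?J ** ?J' = mat 1" unfolding eq by (simp add: matrix_id_mat_1)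
    have "g d (inv f p) = transpose ?J ** g c p ** ?J"
      using pm c p by (simp add: preserves_metric_def ff)
    then have "transpose ?J' ** g d (inv f p) ** ?J' = transpose (?J ** ?J') ** g c p ** (?J ** ?J')"
      by (simp add: matrix_transpose_mul matrix_mul_assoc)
    then show ?thesis by (simp add: JJ transpose_mat)
  qed
  then have "preserves_metric A g (inv f)" unfolding preserves_metric_def by blast
  then show ?thesis
    using sf si bij by (simp add: riemannian_isometry_def bij_imp_bij_inv inv_inv_eq)
qed

locale connected_riemannian_manifold =
  fixes A :: "('m::{t2_space,second_countable_topology}, 'n::finite) chart set" and g :: "('m, 'n) metric_field"
  assumes atlas: "smooth_atlas A" and metric: "riemannian_metric A g" and conn: "connected (UNIV :: 'm set)"
begin

text \<open>The distance is the infimum of the \<open>l\<close> with \<open>joins x y l\<close>.  The relation hides the curves: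
  reversal, concatenation and subdivision of curves become symmetry, additivity and divisibility
  of \<open>joins\<close>.\<close>

definition joins :: "'m \<Rightarrow> 'm \<Rightarrow> real \<Rightarrow> bool" where
  "joins x y l \<longleftrightarrow> (\<exists>\<gamma>. pw_C1_on A 0 1 \<gamma> \<and> \<gamma> 0 = x \<and> \<gamma> 1 = y \<and> arc_length A g 0 1 \<gamma> = l)"

lemma joinsI:
  assumes \<gamma>: "pw_C1_on A a b \<gamma>" and ab: "a < b"
  shows "joins (\<gamma> a) (\<gamma> b) (arc_length A g a b \<gamma>)"
proof -
  have img: "(\<lambda>s. (b - a) * s + a) ` {0..1} = {a..b}"
    using ab by (simp add: image_affinity_atLeastAtMost)
  have m: "b - a \<noteq> 0" using ab by simp
  show ?thesis unfolding joins_def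
    by (intro exI[of _ "\<lambda>s. \<gamma> ((b - a) * s + a)"] conjI pw_C1_on_affine[OF atlas \<gamma> m img]
      arc_length_affine[OF atlas metric \<gamma> m img]) simp_all
qed

lemma joins_nonneg:
  assumes "joins x y l"
  shows "0 \<le> l"
proof -
  obtain \<gamma> where "pw_C1_on A 0 1 \<gamma>" "arc_length A g 0 1 \<gamma> = l" using assms by (auto simp: joins_def)
  then show ?thesis using arc_length_nonneg[OF atlas metric] by blast
qed

lemma joins_sym:
  assumes "joins x y l"
  shows "joins y x l"
proof -
  obtain \<gamma> where \<gamma>: "pw_C1_on A 0 1 \<gamma>" "\<gamma> 0 = x" "\<gamma> 1 = y" "arc_length A g 0 1 \<gamma> = l"
    using assms by (auto simp: joins_def)
  have img: "(\<lambda>s. (- 1) * s + 1) ` {0..1} = {0..1::real}"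
    by (subst image_affinity_atLeastAtMost) simp
  have m: "- 1 \<noteq> (0::real)" by simp
  show ?thesis unfolding joins_def
    by (intro exI[of _ "\<lambda>s. \<gamma> ((- 1) * s + 1)"] conjI pw_C1_on_affine[OF atlas \<gamma>(1) m img])
      (use arc_length_affine[OF atlas metric \<gamma>(1) m img] \<gamma> in simp_all)
qed

lemma joins_trans:
  assumes "joins x y l" "joins y z l'"
  shows "joins x z (l + l')"
proof -
  obtain \<gamma> where \<gamma>: "pw_C1_on A 0 1 \<gamma>" "\<gamma> 0 = x" "\<gamma> 1 = y" "arc_length A g 0 1 \<gamma> = l"
    using assms(1) by (auto simp: joins_def)
  obtain \<beta> where \<beta>: "pw_C1_on A 0 1 \<beta>" "\<beta> 0 = y" "\<beta> 1 = z" "arc_length A g 0 1 \<beta> = l'"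
    using assms(2) by (auto simp: joins_def)
  have img: "(\<lambda>s. 1 * s + (- 1)) ` {1..2} = {0..1::real}"
    by (subst image_affinity_atLeastAtMost) simp
  let ?\<beta> = "\<lambda>s. \<beta> (1 * s + (- 1))"
  have m: "1 \<noteq> (0::real)" by simp
  have \<beta>1: "pw_C1_on A 1 2 ?\<beta>" "arc_length A g 1 2 ?\<beta> = l'"
    using pw_C1_on_affine[OF atlas \<beta>(1) m img] arc_length_affine[OF atlas metric \<beta>(1) m img] \<beta>(4) by simp_all
  define \<alpha> where "\<alpha> s = (if s \<le> 1 then \<gamma> s else ?\<beta> s)" for s
  have eq1: "\<alpha> s = \<gamma> s" if "s \<in> {0..1}" for s using that by (simp add: \<alpha>_def)
  have eq2: "\<alpha> s = ?\<beta> s" if "s \<in> {1..2}" for s using that \<gamma>(3) \<beta>(2) by (cases "s = 1") (auto simp: \<alpha>_def)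
  note a1 = pw_C1_on_cong[OF atlas \<gamma>(1) eq1] and a2 = pw_C1_on_cong[OF atlas \<beta>1(1) eq2]
  have a: "pw_C1_on A 0 2 \<alpha>" by (rule pw_C1_on_join[OF a1 a2]) auto
  have "arc_length A g 0 2 \<alpha> = arc_length A g 0 1 \<alpha> + arc_length A g 1 2 \<alpha>"
    by (rule arc_length_join[OF atlas metric a]) auto
  also have "\<dots> = l + l'"
    using arc_length_cong[OF atlas metric \<gamma>(1) eq1] arc_length_cong[OF atlas metric \<beta>1(1) eq2] \<gamma>(4) \<beta>1(2) by simp
  finally show ?thesis
    using joinsI[OF a] \<gamma>(2) \<beta>(3) by (simp add: \<alpha>_def)
qed

text \<open>Coordinate segments are short curves to all nearby points.\<close>

lemma joins_near:
  assumes "0 < e"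
  shows "\<exists>W. open W \<and> y \<in> W \<and> (\<forall>y'\<in>W. \<exists>l<e. joins y y' l)"
proof -
  obtain c where c: "c \<in> A" "y \<in> fst c" using chart_ex[OF atlas] by blast
  let ?z = "snd c y"
  have "?z \<in> snd c ` fst c" using c by blast
  then obtain r where r: "0 < r" "cball ?z r \<subseteq> snd c ` fst c"
    using chart_open(2)[OF atlas c(1)] open_contains_cball by blast
  from metric_bounds[OF atlas metric c(1) compact_cball r(2)] obtain B where
    B: "0 < B" "\<And>z v. z \<in> cball ?z r \<Longrightarrow> tangent_norm g c (chart_inv c z) v \<le> B * norm v" by blast
  define \<rho> where "\<rho> = min r (e / B)"
  have \<rho>: "0 < \<rho>" "\<rho> \<le> r" "B * \<rho> \<le> e" using r(1) B(1) assms by (auto simp: \<rho>_def min_def field_simps)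
  have bsub: "ball ?z \<rho> \<subseteq> snd c ` fst c" using r(2) \<rho>(2) by (meson ball_subset_cball subset_ball order_trans)
  let ?W = "chart_inv c ` ball ?z \<rho>"
  have "\<exists>l<e. joins y y' l" if "y' \<in> ?W" for y'
  proof -
    obtain z where z: "z \<in> ball ?z \<rho>" "y' = chart_inv c z" using \<open>y' \<in> ?W\<close> by blast
    have seg: "closed_segment ?z z \<subseteq> cball ?z r"
      using z \<rho> by (intro closed_segment_subset convex_cball) (auto simp: r(1) less_imp_le)
    have B': "tangent_norm g c (chart_inv c w) v \<le> B * norm v" if "w \<in> closed_segment ?z z" for w v
      using B(2) seg that by blast
    let ?\<gamma> = "\<lambda>s. chart_inv c (linepath ?z z s)"
    note sc = segment_curve[OF atlas metric c(1) order_trans[OF seg r(2)] B']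
    have "joins (?\<gamma> 0) (?\<gamma> 1) (arc_length A g 0 1 ?\<gamma>)" by (rule joinsI[of 0 1 ?\<gamma>, OF sc(1) zero_less_one])
    then have "joins y y' (arc_length A g 0 1 ?\<gamma>)"
      using z chart_inv_chart[OF atlas c] by (simp add: linepath_def)
    moreover have "arc_length A g 0 1 ?\<gamma> < e"
    proof -
      have "norm (z - ?z) < \<rho>" using z(1) by (simp add: dist_norm norm_minus_commute)
      then have "B * norm (z - ?z) < B * \<rho>" using B(1) by simp
      then show ?thesis using sc(2) \<rho>(3) by simp
    qed
    ultimately show ?thesis by blast
  qed
  moreover have "open ?W" by (rule open_chart_inv_image[OF atlas c(1) open_ball bsub])
  moreover have "y \<in> ?W" using \<rho>(1) chart_inv_chart[OF atlas c] by (intro image_eqI[of _ _ ?z]) simp_all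
  ultimately show ?thesis by blast
qed

text \<open>The points that can be reached from \<open>x\<close> form an open set, and so do the others.  Without this
  lemma the distance could be the infimum of the empty set.\<close>

lemma joins_ex: "\<exists>l. joins x y l"
proof -
  let ?R = "{y. \<exists>l. joins x y l}"
  have "open ?R"
  proof (subst open_subopen, intro ballI)
    fix y assume "y \<in> ?R"
    then obtain l where l: "joins x y l" by blast
    obtain W where W: "open W" "y \<in> W" "\<And>y'. y' \<in> W \<Longrightarrow> \<exists>l<1. joins y y' l"
      using joins_near[of 1 y] by auto
    then have "W \<subseteq> ?R" using joins_trans[OF l] by blast
    then show "\<exists>T. open T \<and> y \<in> T \<and> T \<subseteq> ?R" using W by blast
  qed
  moreover have "open (- ?R)"
  proof (subst open_subopen, intro ballI)
    fix y assume y: "y \<in> - ?R"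
    obtain W where W: "open W" "y \<in> W" "\<And>y'. y' \<in> W \<Longrightarrow> \<exists>l<1. joins y y' l"
      using joins_near[of 1 y] by auto
    have "y' \<notin> ?R" if y': "y' \<in> W" for y'
    proof
      assume "y' \<in> ?R"
      then obtain l l' where "joins x y' l" "joins y y' l'" using W(3)[OF y'] by blast
      then have "joins x y (l + l')" using joins_trans joins_sym by blast
      then show False using y by blast
    qed
    then show "\<exists>T. open T \<and> y \<in> T \<and> T \<subseteq> - ?R" using W by blast
  qed
  ultimately have "?R \<inter> UNIV = {} \<or> - ?R \<inter> UNIV = {}"
    using connectedD[OF conn] by blast
  moreover have "?R \<noteq> {}"
    using joins_near[of 1 x] joins_sym by fastforce
  ultimately show ?thesis by blast
qed

lemma joins_refl: "joins x x 0"
proof -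
  obtain c where c: "c \<in> A" "x \<in> fst c" using chart_ex[OF atlas] by blast
  let ?z = "snd c x"
  have seg: "closed_segment ?z ?z \<subseteq> snd c ` fst c" using c by simp
  from metric_bounds[OF atlas metric c(1) compact_segment seg] obtain B where
    B: "\<And>z v. z \<in> closed_segment ?z ?z \<Longrightarrow> tangent_norm g c (chart_inv c z) v \<le> B * norm v" by blast
  let ?\<gamma> = "\<lambda>s. chart_inv c (linepath ?z ?z s)"
  note sc = segment_curve[OF atlas metric c(1) seg B]
  have "joins (?\<gamma> 0) (?\<gamma> 1) (arc_length A g 0 1 ?\<gamma>)" by (rule joinsI[of 0 1 ?\<gamma>, OF sc(1) zero_less_one])
  moreover have "arc_length A g 0 1 ?\<gamma> = 0"
    using sc(2) arc_length_nonneg[OF atlas metric sc(1)] by simp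
  ultimately show ?thesis using chart_inv_chart[OF atlas c] by (simp add: linepath_def)
qed

text \<open>The length of the initial part of a curve depends continuously on the end of that part and thus
  takes the value \<open>s\<close>.\<close>

lemma joins_split:
  assumes "joins x y l" "0 \<le> s" "s \<le> l"
  shows "\<exists>w. joins x w s \<and> joins w y (l - s)"
proof -
  obtain \<gamma> where \<gamma>: "pw_C1_on A 0 1 \<gamma>" "\<gamma> 0 = x" "\<gamma> 1 = y" "arc_length A g 0 1 \<gamma> = l"
    using assms(1) by (auto simp: joins_def)
  have "continuous_on {0..1} (\<lambda>u. arc_length A g 0 u \<gamma>)"
    unfolding arc_length_def by (rule indefinite_integral_continuous_1[OF curve_speed_integrable[OF atlas metric \<gamma>(1)]])
  moreover have "arc_length A g 0 0 \<gamma> = 0" by (simp add: arc_length_def)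
  ultimately obtain u where u: "0 \<le> u" "u \<le> 1" "arc_length A g 0 u \<gamma> = s"
    using IVT'[of "\<lambda>u. arc_length A g 0 u \<gamma>" 0 s 1] assms \<gamma>(4) by auto
  have l: "l = s + arc_length A g u 1 \<gamma>"
    using arc_length_join[OF atlas metric \<gamma>(1) u(1,2)] u(3) \<gamma>(4) by simp
  have "joins x (\<gamma> u) s"
  proof (cases "u = 0")
    case True
    then show ?thesis using joins_refl[of x] \<gamma>(2) u(3) by (simp add: arc_length_def)
  next
    case False
    then show ?thesis
      using joinsI[of 0 u \<gamma>] pw_C1_on_subinterval[OF \<gamma>(1), of 0 u] u \<gamma>(2) by simp
  qed
  moreover have "joins (\<gamma> u) y (l - s)"
  proof (cases "u = 1")
    case True
    then show ?thesis using joins_refl[of y] \<gamma>(3) l by (simp add: arc_length_def)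
  next
    case False
    then show ?thesis
      using joinsI[of u 1 \<gamma>] pw_C1_on_subinterval[OF \<gamma>(1), of u 1] u \<gamma>(3) l by simp
  qed
  ultimately show ?thesis by blast
qed

lemma joins_isometry:
  assumes f: "riemannian_isometry A g f" and "joins x y l"
  shows "joins (f x) (f y) l"
proof -
  obtain \<gamma> where \<gamma>: "pw_C1_on A 0 1 \<gamma>" "\<gamma> 0 = x" "\<gamma> 1 = y" "arc_length A g 0 1 \<gamma> = l"
    using assms(2) by (auto simp: joins_def)
  have sf: "smooth_map A f" "preserves_metric A g f" using f by (auto simp: riemannian_isometry_def)
  show ?thesis
    unfolding joins_def
    by (intro exI[of _ "f \<circ> \<gamma>"])
      (use pw_C1_on_image[OF atlas sf(1) \<gamma>(1)] arc_length_image[OF atlas metric sf \<gamma>(1)] \<gamma> in simp)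
qed

abbreviation dist_g :: "'m \<Rightarrow> 'm \<Rightarrow> real" where "dist_g \<equiv> rdist A g"

lemma rdist_joins: "dist_g x y = Inf {l. joins x y l}"
proof -
  have "{arc_length A g 0 1 \<gamma> | \<gamma>. pw_C1_on A 0 1 \<gamma> \<and> \<gamma> 0 = x \<and> \<gamma> 1 = y} = {l. joins x y l}"
    unfolding joins_def by blast
  then show ?thesis by (simp only: rdist_eq)
qed

lemma bdd_below_joins: "bdd_below {l. joins x y l}"
proof (rule bdd_belowI)
  show "0 \<le> l" if "l \<in> {l. joins x y l}" for l using that joins_nonneg by simp
qed

lemma rdist_le:
  assumes "joins x y l"
  shows "dist_g x y \<le> l"
  unfolding rdist_joins by (rule cInf_lower[OF _ bdd_below_joins]) (simp add: assms)

lemma joins_nonempty: "{l. joins x y l} \<noteq> {}"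
  using joins_ex[of x y] by blast

lemma rdist_less:
  assumes "dist_g x y < r"
  shows "\<exists>l<r. joins x y l"
  using cInf_lessD[OF joins_nonempty assms[unfolded rdist_joins]] by blast

lemma rdist_ge:
  assumes "\<And>l. joins x y l \<Longrightarrow> b \<le> l"
  shows "b \<le> dist_g x y"
  unfolding rdist_joins by (rule cInf_greatest[OF joins_nonempty]) (simp add: assms)

lemma rdist_nonneg: "0 \<le> dist_g x y"
  by (rule rdist_ge) (rule joins_nonneg)

lemma rdist_self: "dist_g x x = 0"
  by (rule antisym[OF rdist_le[OF joins_refl] rdist_nonneg])

lemma rdist_sym: "dist_g x y = dist_g y x"
proof (rule antisym)
  show "dist_g x y \<le> dist_g y x" by (rule rdist_ge) (rule rdist_le, rule joins_sym)
  show "dist_g y x \<le> dist_g x y" by (rule rdist_ge) (rule rdist_le, rule joins_sym)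
qed

lemma rdist_triangle: "dist_g x z \<le> dist_g x y + dist_g y z"
proof (rule field_le_epsilon)
  fix e :: real assume "0 < e"
  then obtain l l' where "l < dist_g x y + e / 2" "joins x y l" "l' < dist_g y z + e / 2" "joins y z l'"
    using rdist_less[of x y "dist_g x y + e / 2"] rdist_less[of y z "dist_g y z + e / 2"] by auto
  then show "dist_g x z \<le> dist_g x y + dist_g y z + e"
    using rdist_le[OF joins_trans[of x y l z l']] by simp
qed

lemma rdist_isometry:
  assumes f: "riemannian_isometry A g f"
  shows "dist_g (f x) (f y) = dist_g x y"
proof (rule antisym)
  show "dist_g (f x) (f y) \<le> dist_g x y"
    by (rule rdist_ge, rule rdist_le, rule joins_isometry[OF f])
  have inj: "inv f (f z) = z" for z using f by (simp add: riemannian_isometry_def bij_is_inj)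
  have "joins x y l" if "joins (f x) (f y) l" for l
    using joins_isometry[OF isometry_inv[OF atlas f] that] by (simp add: inj)
  then show "dist_g x y \<le> dist_g (f x) (f y)" by (intro rdist_ge rdist_le)
qed

lemma rdist_near:
  assumes "0 < e"
  shows "\<exists>W. open W \<and> y \<in> W \<and> (\<forall>y'\<in>W. dist_g y y' < e)"
proof -
  from joins_near[OF assms, of y] obtain W where W: "open W \<and> y \<in> W \<and> (\<forall>y'\<in>W. \<exists>l<e. joins y y' l)" ..
  have "dist_g y y' < e" if y': "y' \<in> W" for y'
  proof -
    obtain l where "l < e" "joins y y' l" using W y' by blast
    then show ?thesis using rdist_le[of y y' l] by simp
  qed
  then show ?thesis using W by blast
qed

lemma closed_rcball: "closed {y. dist_g x y \<le> r}"
  unfolding closed_def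
proof (subst open_subopen, intro ballI)
  fix y assume "y \<in> - {y. dist_g x y \<le> r}"
  then have "0 < dist_g x y - r" by simp
  from rdist_near[OF this, of y] obtain W where
    W: "open W" "y \<in> W" "\<And>y'. y' \<in> W \<Longrightarrow> dist_g y y' < dist_g x y - r" by blast
  have "r < dist_g x y'" if "y' \<in> W" for y'
    using W(3)[OF that] rdist_triangle[of x y y'] rdist_sym[of y y'] by simp
  then have "W \<subseteq> - {y. dist_g x y \<le> r}" by (force simp: not_le)
  then show "\<exists>T. open T \<and> y \<in> T \<and> T \<subseteq> - {y. dist_g x y \<le> r}" using W(1,2) by blast
qed

text \<open>The coordinate displacement is the integral of the coordinate velocity, whose Euclidean norm is at
  most the speed divided by \<open>m\<close>.\<close>

lemma arc_length_ge_chart_distance: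
  assumes c: "c \<in> A" and \<gamma>: "pw_C1_on A 0 \<tau> \<gamma>" and \<tau>: "0 \<le> \<tau>" and inU: "\<And>s. s \<in> {0..\<tau>} \<Longrightarrow> \<gamma> s \<in> fst c"
    and m: "0 < m" "\<And>s v. s \<in> {0..\<tau>} \<Longrightarrow> m * norm v \<le> tangent_norm g c (\<gamma> s) v"
  shows "m * norm (snd c (\<gamma> \<tau>) - snd c (\<gamma> 0)) \<le> arc_length A g 0 \<tau> \<gamma>"
proof -
  let ?\<phi> = "snd c \<circ> \<gamma>"
  from pw_C1_on_regular[OF atlas \<gamma>] obtain S where
    S: "finite S \<and> 0 \<in> S \<and> \<tau> \<in> S \<and> (\<forall>t\<in>{0..\<tau>} - S. isCont \<gamma> t \<and>
      (\<forall>c\<in>A. \<gamma> t \<in> fst c \<longrightarrow> (\<exists>v. (snd c \<circ> \<gamma> has_vector_derivative v) (at t))))" ..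
  define D where "D t = (if t \<in> S then 0 else vector_derivative ?\<phi> (at t))" for t
  have reg: "isCont \<gamma> t" "(?\<phi> has_vector_derivative D t) (at t)" if t: "t \<in> {0..\<tau>} - S" for t
  proof -
    obtain v where "isCont \<gamma> t" "(?\<phi> has_vector_derivative v) (at t)" using S t c inU[of t] by blast
    then show "isCont \<gamma> t" "(?\<phi> has_vector_derivative D t) (at t)"
      using t vector_derivative_at[of ?\<phi> v t] by (simp_all add: D_def)
  qed
  have "continuous_on {0..\<tau>} (\<lambda>s. snd c (\<gamma> s))"
    using \<gamma> inU by (intro continuous_on_compose2[OF continuous_on_chart(1)[OF atlas c]]) (auto simp: pw_C1_on_def)
  then have "(D has_integral (?\<phi> \<tau> - ?\<phi> 0)) {0..\<tau>}"
    using S reg \<tau> by (intro fundamental_theorem_of_calculus_interior_strong[of S]) (auto simp: o_def)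
  then have I: "D integrable_on {0..\<tau>}" "integral {0..\<tau>} D = ?\<phi> \<tau> - ?\<phi> 0" by (auto simp: has_integral_iff)
  have "norm (integral {0..\<tau>} D) \<le> integral {0..\<tau>} (\<lambda>t. (1 / m) * curve_speed A g \<gamma> t)"
  proof (rule integral_norm_bound_integral[OF I(1)])
    show "(\<lambda>t. (1 / m) * curve_speed A g \<gamma> t) integrable_on {0..\<tau>}"
      by (intro integrable_on_mult_right curve_speed_integrable[OF atlas metric \<gamma>])
    fix t assume t: "t \<in> {0..\<tau>}"
    show "norm (D t) \<le> (1 / m) * curve_speed A g \<gamma> t"
    proof (cases "t \<in> S")
      case True
      then show ?thesis using curve_speed_nonneg[OF atlas metric] m(1) by (simp add: D_def)
    next
      case False
      then have "curve_speed A g \<gamma> t = tangent_norm g c (\<gamma> t) (D t)"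
        using t reg by (intro curve_speed_eq[OF atlas metric c inU]) auto
      then show ?thesis using m(2)[OF t, of "D t"] m(1) by (simp add: field_simps)
    qed
  qed
  also have "\<dots> = (1 / m) * arc_length A g 0 \<tau> \<gamma>" by (simp add: arc_length_def)
  finally show ?thesis using m(1) by (simp add: I(2) field_simps)
qed

text \<open>A curve that leaves a coordinate ball has to traverse its radius, whence its length is bounded from
  below.  This separates points and shows that small balls are relatively compact.\<close>

lemma small_ball_in_chart:
  assumes c: "c \<in> A" "x \<in> fst c" and r: "cball (snd c x) r \<subseteq> snd c ` fst c"
  shows "\<exists>m>0. \<forall>\<rho> y. 0 < \<rho> \<and> \<rho> \<le> r \<and> dist_g x y < m * \<rho> \<longrightarrow> y \<in> chart_inv c ` ball (snd c x) \<rho>"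
proof -
  let ?z = "snd c x"
  from metric_bounds[OF atlas metric c(1) compact_cball r] obtain m where
    m: "0 < m" "\<And>z v. z \<in> cball ?z r \<Longrightarrow> m * norm v \<le> tangent_norm g c (chart_inv c z) v" by blast
  have "y \<in> chart_inv c ` ball ?z \<rho>" if \<rho>: "0 < \<rho>" "\<rho> \<le> r" and d: "dist_g x y < m * \<rho>" for \<rho> y
  proof (rule ccontr)
    let ?W = "chart_inv c ` ball ?z \<rho>" and ?K = "chart_inv c ` cball ?z \<rho>"
    assume y: "y \<notin> ?W"
    obtain l where l: "l < m * \<rho>" "joins x y l" using rdist_less[OF d] by blast
    then obtain \<gamma> where \<gamma>: "pw_C1_on A 0 1 \<gamma>" "\<gamma> 0 = x" "\<gamma> 1 = y" "arc_length A g 0 1 \<gamma> = l"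
      by (auto simp: joins_def)
    have sub: "cball ?z \<rho> \<subseteq> snd c ` fst c" "cball ?z \<rho> \<subseteq> cball ?z r" using r \<rho> by auto
    have oW: "open ?W" using sub(1) by (intro open_chart_inv_image[OF atlas c(1)]) auto
    have cK: "closed ?K"
      using sub(1) by (intro compact_imp_closed compact_continuous_image compact_cball
          continuous_on_subset[OF continuous_on_chart(2)[OF atlas c(1)]])
    have cont: "continuous_on {0..1} \<gamma>" using \<gamma>(1) by (simp add: pw_C1_on_def)
    \<comment> \<open>\<open>Inf T\<close> is the time of the first exit from the open coordinate ball\<close>
    define T where "T = {0..1} \<inter> \<gamma> -` (- ?W)"
    have cT: "closed T" unfolding T_def using oW by (intro continuous_closed_preimage cont) auto
    have "1 \<in> T" using y \<gamma>(3) by (simp add: T_def)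
    moreover have bT: "bdd_below T" by (rule bdd_belowI[of _ 0]) (simp add: T_def)
    ultimately have \<tau>T: "Inf T \<in> T" using cT by (intro closed_contains_Inf) auto
    define \<tau> where "\<tau> = Inf T"
    have \<tau>: "0 \<le> \<tau>" "\<tau> \<le> 1" "\<gamma> \<tau> \<notin> ?W" using \<tau>T by (auto simp: \<tau>_def T_def)
    have before: "\<gamma> s \<in> ?W" if s: "0 \<le> s" "s < \<tau>" for s
    proof (rule ccontr)
      assume "\<gamma> s \<notin> ?W"
      then have "s \<in> T" using s \<tau>(2) by (simp add: T_def)
      then have "\<tau> \<le> s" unfolding \<tau>_def using bT by (rule cInf_lower)
      then show False using s by simp
    qed
    have "x \<in> ?W" using \<rho>(1) chart_inv_chart[OF atlas c] by (intro image_eqI[of _ _ ?z]) simp_all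
    then have "0 < \<tau>" using \<tau> \<gamma>(2) by (cases "\<tau> = 0") auto
    have "closed ({0..1} \<inter> \<gamma> -` ?K)" using cK by (intro continuous_closed_preimage cont) auto
    moreover have "{0..<\<tau>} \<subseteq> {0..1} \<inter> \<gamma> -` ?K" using before \<tau>(2) by force
    ultimately have "closure {0..<\<tau>} \<subseteq> {0..1} \<inter> \<gamma> -` ?K" by (intro closure_minimal)
    then have inK: "\<gamma> s \<in> ?K" if "s \<in> {0..\<tau>}" for s
      using that \<open>0 < \<tau>\<close> by (auto simp: closure_atLeastLessThan)
    have inU: "\<gamma> s \<in> fst c" "snd c (\<gamma> s) \<in> cball ?z \<rho>" "chart_inv c (snd c (\<gamma> s)) = \<gamma> s" if s: "s \<in> {0..\<tau>}" for s
    proof -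
      obtain z where z: "z \<in> cball ?z \<rho>" "\<gamma> s = chart_inv c z" using inK[OF s] by blast
      then have "z \<in> snd c ` fst c" using sub(1) by blast
      then show "\<gamma> s \<in> fst c" "snd c (\<gamma> s) \<in> cball ?z \<rho>" "chart_inv c (snd c (\<gamma> s)) = \<gamma> s"
        using z chart_chart_inv[OF atlas c(1), of z] by simp_all
    qed
    have \<tau>I: "\<tau> \<in> {0..\<tau>}" using \<tau> by simp
    have "snd c (\<gamma> \<tau>) \<notin> ball ?z \<rho>" using \<tau>(3) inU(3)[OF \<tau>I] by (metis image_eqI)
    then have far: "\<rho> \<le> norm (snd c (\<gamma> \<tau>) - ?z)" by (simp add: dist_norm norm_minus_commute)
    have "m * \<rho> \<le> m * norm (snd c (\<gamma> \<tau>) - snd c (\<gamma> 0))"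
      using far m(1) \<gamma>(2) by simp
    also have "\<dots> \<le> arc_length A g 0 \<tau> \<gamma>"
    proof (rule arc_length_ge_chart_distance[OF c(1) _ \<tau>(1) inU(1) m(1)])
      show "pw_C1_on A 0 \<tau> \<gamma>" using \<tau> by (intro pw_C1_on_subinterval[OF \<gamma>(1)]) auto
      show "m * norm v \<le> tangent_norm g c (\<gamma> s) v" if s: "s \<in> {0..\<tau>}" for s v
      proof -
        have "snd c (\<gamma> s) \<in> cball ?z r" using inU(2)[OF s] sub(2) by blast
        then show ?thesis using m(2)[of "snd c (\<gamma> s)" v] inU(3)[OF s] by simp
      qed
    qed
    also have "\<dots> \<le> arc_length A g 0 1 \<gamma>"
    proof -
      have "pw_C1_on A \<tau> 1 \<gamma>" using \<tau> by (intro pw_C1_on_subinterval[OF \<gamma>(1)]) auto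
      then show ?thesis
        using arc_length_join[OF atlas metric \<gamma>(1) \<tau>(1,2)] arc_length_nonneg[OF atlas metric] by fastforce
    qed
    finally show False using l(1) \<gamma>(4) by simp
  qed
  then show ?thesis using m(1) by blast
qed

lemma rdist_eq_0: "dist_g x y = 0 \<longleftrightarrow> x = y"
proof
  assume d: "dist_g x y = 0"
  obtain c where c: "c \<in> A" "x \<in> fst c" using chart_ex[OF atlas] by blast
  let ?z = "snd c x"
  have "?z \<in> snd c ` fst c" using c by blast
  then obtain r where r: "0 < r" "cball ?z r \<subseteq> snd c ` fst c"
    using chart_open(2)[OF atlas c(1)] open_contains_cball by blast
  obtain m where m: "0 < m" "\<And>\<rho> y. 0 < \<rho> \<Longrightarrow> \<rho> \<le> r \<Longrightarrow> dist_g x y < m * \<rho> \<Longrightarrow> y \<in> chart_inv c ` ball ?z \<rho>"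
    using small_ball_in_chart[OF c r(2)] by blast
  have near: "y \<in> fst c \<and> dist ?z (snd c y) < \<rho>" if \<rho>: "0 < \<rho>" "\<rho> \<le> r" for \<rho>
  proof -
    have "dist_g x y < m * \<rho>" using d m(1) \<rho>(1) by simp
    then have "y \<in> chart_inv c ` ball ?z \<rho>" by (rule m(2)[OF \<rho>])
    then obtain w where w: "w \<in> ball ?z \<rho>" "y = chart_inv c w" by blast
    moreover have "w \<in> snd c ` fst c" using w(1) r(2) \<rho>(2) by auto
    ultimately show ?thesis using chart_chart_inv[OF atlas c(1), of w] by simp
  qed
  have "dist ?z (snd c y) \<le> 0"
  proof (rule field_le_epsilon)
    fix e :: real assume "0 < e"
    then have "dist ?z (snd c y) < min e r" using near[of "min e r"] r(1) by simp
    then show "dist ?z (snd c y) \<le> 0 + e" by simp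
  qed
  then have "snd c y = ?z" by simp
  moreover have "y \<in> fst c" using near[of r] r(1) by simp
  ultimately show "x = y" using inj_onD[OF chart_inj[OF atlas c(1)]] c(2) by metis
qed (simp add: rdist_self)

end

section \<open>Balls in homogeneous manifolds\<close>

locale homogeneous_riemannian_manifold = connected_riemannian_manifold A g
  for A :: "('m::{t2_space,second_countable_topology}, 'n::finite) chart set" and g :: "('m, 'n) metric_field" +
  assumes homog: "homogeneous A g"
begin

abbreviation vol_g :: "'m measure" where "vol_g \<equiv> rvol A g"

abbreviation gball :: "'m \<Rightarrow> real \<Rightarrow> 'm set" where "gball \<equiv> rcball A g"

lemma sets_vol_g: "sets vol_g = sets borel"
  using is_volume_rvol[OF atlas metric] by (simp add: is_volume_def)

lemma gball_borel: "gball x r \<in> sets borel"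
  unfolding rcball_def by (rule borel_closed[OF closed_rcball])

lemma isometry_gball:
  assumes f: "riemannian_isometry A g f"
  shows "f ` gball x r = gball (f x) r"
proof -
  have surj: "f (inv f y) = y" for y using f by (simp add: riemannian_isometry_def bij_is_surj surj_f_inv_f)
  have "y \<in> f ` gball x r" if "y \<in> gball (f x) r" for y
  proof (rule image_eqI)
    show "y = f (inv f y)" by (simp add: surj)
    show "inv f y \<in> gball x r"
      using that rdist_isometry[OF f, of x "inv f y"] by (simp add: rcball_def surj)
  qed
  moreover have "f y \<in> gball (f x) r" if "y \<in> gball x r" for y
    using that by (simp add: rcball_def rdist_isometry[OF f])
  ultimately show ?thesis by blast
qed

lemma ex_isometry: "\<exists>f. riemannian_isometry A g f \<and> f x = y"
  using homog by (auto simp: homogeneous_def)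

lemma volume_gball_eq: "emeasure vol_g (gball x r) = emeasure vol_g (gball y r)"
proof -
  obtain f where f: "riemannian_isometry A g f" "f x = y" using ex_isometry by blast
  have "emeasure vol_g (gball y r) = emeasure vol_g (f ` gball x r)" by (simp add: isometry_gball[OF f(1)] f(2))
  also have "\<dots> = emeasure vol_g (gball x r)" by (rule rvol_isometry[OF atlas metric f(1) gball_borel])
  finally show ?thesis ..
qed

lemma small_gball:
  "\<exists>r>0. emeasure vol_g (gball x0 r) < \<infinity> \<and> (\<exists>C. finite C \<and> gball x0 r \<subseteq> (\<Union>w\<in>C. gball w (r / 2)))"
proof -
  obtain c where c: "c \<in> A" "x0 \<in> fst c" using chart_ex[OF atlas] by blast
  let ?z = "snd c x0"
  have "?z \<in> snd c ` fst c" using c by blast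
  then obtain \<rho> where \<rho>: "0 < \<rho>" "cball ?z \<rho> \<subseteq> snd c ` fst c"
    using chart_open(2)[OF atlas c(1)] open_contains_cball by blast
  from small_ball_in_chart[OF c \<rho>(2)] obtain m where
    m: "0 < m" "\<And>y. dist_g x0 y < m * \<rho> \<Longrightarrow> y \<in> chart_inv c ` ball ?z \<rho>" using \<rho>(1) by blast
  let ?K = "chart_inv c ` cball ?z \<rho>"
  define r where "r = m * \<rho> / 2"
  have r: "0 < r" "r < m * \<rho>" using m(1) \<rho>(1) by (auto simp: r_def)
  have sub: "gball x0 r \<subseteq> ?K"
  proof
    fix y assume "y \<in> gball x0 r"
    then have "y \<in> chart_inv c ` ball ?z \<rho>" using r(2) by (intro m(2)) (simp add: rcball_def)
    then show "y \<in> ?K" by auto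
  qed
  have finK: "emeasure vol_g ?K < \<infinity>" "?K \<in> sets borel"
    using rvol_compact_in_chart_finite[OF atlas metric c(1) compact_cball \<rho>(2)] by auto
  have "emeasure vol_g (gball x0 r) \<le> emeasure vol_g ?K"
    using sub finK(2) by (intro emeasure_mono) (simp_all add: sets_vol_g)
  then have fin: "emeasure vol_g (gball x0 r) < \<infinity>" using finK(1) by (rule order_le_less_trans)
  have "\<forall>w. \<exists>W. open W \<and> w \<in> W \<and> (\<forall>y\<in>W. dist_g w y < r / 2)"
    using r(1) by (intro allI rdist_near) simp
  from choice[OF this] obtain W where W: "\<forall>w. open (W w) \<and> w \<in> W w \<and> (\<forall>y\<in>W w. dist_g w y < r / 2)" ..
  have "compact ?K"
    by (intro compact_continuous_image compact_cball continuous_on_subset[OF continuous_on_chart(2)[OF atlas c(1)] \<rho>(2)])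
  then obtain C where C: "C \<subseteq> ?K" "finite C" "?K \<subseteq> (\<Union>w\<in>C. W w)"
    by (rule compactE_image[of ?K ?K W]) (use W in auto)
  have "W w \<subseteq> gball w (r / 2)" for w using W by (auto simp: rcball_def less_imp_le)
  then have "(\<Union>w\<in>C. W w) \<subseteq> (\<Union>w\<in>C. gball w (r / 2))" by (intro UN_mono subset_refl)
  then have "gball x0 r \<subseteq> (\<Union>w\<in>C. gball w (r / 2))" using sub C(3) by (meson order_trans)
  then show ?thesis using r(1) fin C(2) by (intro exI[of _ r] conjI exI[of _ C])
qed

text \<open>Homogeneity propagates local finiteness to all scales: finitely many balls of radius
  \<open>r/2\<close> cover each ball of radius \<open>r\<close>, and a point at distance at most \<open>s + r/4\<close> from the centre is
  within \<open>r/2\<close> of the ball of radius \<open>s\<close>.\<close>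

lemma volume_gball_finite: "emeasure vol_g (gball x t) < \<infinity>"
proof -
  obtain r C0 where r: "0 < r" and fin: "emeasure vol_g (gball x r) < \<infinity>"
    and C0: "finite C0" "gball x r \<subseteq> (\<Union>w\<in>C0. gball w (r / 2))" using small_gball[of x] by blast
  have cover: "\<exists>C. finite C \<and> gball w r \<subseteq> (\<Union>w\<in>C. gball w (r / 2))" for w
  proof -
    obtain f where f: "riemannian_isometry A g f" "f x = w" using ex_isometry by blast
    have "gball w r = f ` gball x r" by (simp add: isometry_gball[OF f(1)] f(2))
    also have "\<dots> \<subseteq> (\<Union>w\<in>C0. f ` gball w (r / 2))" using C0(2) by blast
    also have "\<dots> = (\<Union>w\<in>f ` C0. gball w (r / 2))" by (simp add: isometry_gball[OF f(1)])
    finally show ?thesis using C0(1) by (intro exI[of _ "f ` C0"]) simp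
  qed
  have step: "gball x (s + r / 4) \<subseteq> (\<Union>w\<in>C. gball w r)" if s: "0 \<le> s" and C: "gball x s \<subseteq> (\<Union>w\<in>C. gball w (r / 2))" for s C
  proof
    fix z assume "z \<in> gball x (s + r / 4)"
    then have "dist_g x z < s + r / 2" using r by (simp add: rcball_def)
    from rdist_less[OF this] obtain l where l: "l < s + r / 2" "joins x z l" by blast
    have "\<exists>y. dist_g x y \<le> s \<and> dist_g y z \<le> r / 2"
    proof (cases "l \<le> s")
      case True
      then show ?thesis using rdist_le[OF l(2)] rdist_self[of z] r by (intro exI[of _ z]) simp
    next
      case False
      then obtain y where "joins x y s" "joins y z (l - s)" using joins_split[OF l(2) s] by auto
      then show ?thesis using rdist_le[of x y s] rdist_le[of y z "l - s"] l(1) by (intro exI[of _ y]) simp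
    qed
    then obtain y where y: "dist_g x y \<le> s" "dist_g y z \<le> r / 2" by blast
    then obtain w where w: "w \<in> C" "dist_g w y \<le> r / 2" using C by (auto simp: rcball_def)
    then have "dist_g w z \<le> r" using y(2) rdist_triangle[of w z y] by simp
    then show "z \<in> (\<Union>w\<in>C. gball w r)" using w(1) by (auto simp: rcball_def)
  qed
  have "\<exists>C. finite C \<and> gball x (real k * (r / 4)) \<subseteq> (\<Union>w\<in>C. gball w (r / 2))" for k
  proof (induction k)
    case 0
    have "gball x 0 \<subseteq> gball x (r / 2)" using r by (auto simp: rcball_def)
    then show ?case by (intro exI[of _ "{x}"]) simp
  next
    case (Suc k)
    then obtain C where C: "finite C" "gball x (real k * (r / 4)) \<subseteq> (\<Union>w\<in>C. gball w (r / 2))" by blast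
    have "gball x (real (Suc k) * (r / 4)) = gball x (real k * (r / 4) + r / 4)"
      by (simp add: algebra_simps add_divide_distrib)
    also have "\<dots> \<subseteq> (\<Union>w\<in>C. gball w r)" using r by (intro step C(2)) simp
    finally have sub: "gball x (real (Suc k) * (r / 4)) \<subseteq> (\<Union>w\<in>C. gball w r)" .
    from cover have "\<forall>w. \<exists>D. finite D \<and> gball w r \<subseteq> (\<Union>w\<in>D. gball w (r / 2))" by blast
    from choice[OF this] obtain D where D: "\<forall>w. finite (D w) \<and> gball w r \<subseteq> (\<Union>v\<in>D w. gball v (r / 2))" ..
    show ?case
    proof (intro exI[of _ "\<Union>w\<in>C. D w"] conjI)
      show "finite (\<Union>w\<in>C. D w)" using C(1) D by simp
      have "(\<Union>w\<in>C. gball w r) \<subseteq> (\<Union>w\<in>C. \<Union>v\<in>D w. gball v (r / 2))"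
        using D by (intro UN_mono subset_refl) simp
      also have "\<dots> = (\<Union>v\<in>(\<Union>w\<in>C. D w). gball v (r / 2))" by simp
      finally show "gball x (real (Suc k) * (r / 4)) \<subseteq> (\<Union>v\<in>(\<Union>w\<in>C. D w). gball v (r / 2))"
        by (rule order_trans[OF sub])
    qed
  qed note covers = this
  obtain k :: nat where k: "t \<le> real k * (r / 4)"
  proof -
    obtain k :: nat where "t / (r / 4) \<le> real k" using real_arch_simple by blast
    then show thesis using r by (intro that[of k]) (simp add: pos_divide_le_eq)
  qed
  from covers[of k] obtain C where C: "finite C" "gball x (real k * (r / 4)) \<subseteq> (\<Union>w\<in>C. gball w (r / 2))" by blast
  have "gball x t \<subseteq> gball x (real k * (r / 4))" using k by (auto simp: rcball_def)
  with C(2) have sub: "gball x t \<subseteq> (\<Union>w\<in>C. gball w (r / 2))" by blast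
  have half: "emeasure vol_g (gball w (r / 2)) < \<infinity>" for w
  proof -
    have "emeasure vol_g (gball w (r / 2)) \<le> emeasure vol_g (gball w r)"
      using gball_borel r by (intro emeasure_mono) (auto simp: sets_vol_g rcball_def)
    then show ?thesis using fin volume_gball_eq[of w r x] by simp
  qed
  have "emeasure vol_g (gball x t) \<le> emeasure vol_g (\<Union>w\<in>C. gball w (r / 2))"
    using sub gball_borel C(1) by (intro emeasure_mono) (auto simp: sets_vol_g)
  also have "\<dots> \<le> (\<Sum>w\<in>C. emeasure vol_g (gball w (r / 2)))"
    using C(1) gball_borel by (intro emeasure_subadditive_finite) (auto simp: sets_vol_g)
  also have "\<dots> < \<infinity>" using half C(1) by (simp add: ennreal_sum_less_top)
  finally show ?thesis .
qed

lemma ex_dense_sequence: "\<exists>q :: nat \<Rightarrow> 'm. \<forall>x e. 0 < e \<longrightarrow> (\<exists>i. dist_g (q i) x \<le> e)"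
proof -
  obtain D :: "'m set" where D: "countable D" "\<And>X. open X \<Longrightarrow> X \<noteq> {} \<Longrightarrow> \<exists>d\<in>D. d \<in> X"
    using countable_dense_setE by blast
  have "D \<noteq> {}" using D(2)[of UNIV] by auto
  have "\<exists>i. dist_g (from_nat_into D i) x \<le> e" if "0 < e" for x e
  proof -
    from rdist_near[OF that, of x] obtain W where W: "open W \<and> x \<in> W \<and> (\<forall>y\<in>W. dist_g x y < e)" ..
    then obtain y where y: "y \<in> D" "y \<in> W" using D(2)[of W] by blast
    obtain i where i: "from_nat_into D i = y" using y(1) D(1) from_nat_into_surj by metis
    have "dist_g x y < e" using W y(2) by blast
    with i show ?thesis by (intro exI[of _ i]) (simp add: rdist_sym[of y x])
  qed
  then show ?thesis by (intro exI[of _ "from_nat_into D"]) simp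
qed

section \<open>Degrees in the threshold model\<close>

lemma homogeneous_metric_measure_scaled:
  fixes \<delta> :: real
  assumes q: "\<forall>x e. 0 < e \<longrightarrow> (\<exists>i. dist_g (q i) x \<le> e)"
  shows "homogeneous_metric_measure (scale_measure (ennreal \<delta>) vol_g) dist_g q"
proof
  let ?\<mu> = "scale_measure (ennreal \<delta>) vol_g"
  note b = gball_borel[unfolded rcball_def] and v = volume_gball_finite[unfolded rcball_def]
    and h = volume_gball_eq[unfolded rcball_def]
  show "space ?\<mu> = UNIV" using sets_eq_imp_space_eq[OF sets_vol_g] by (simp add: space_scale_measure)
  show "dist_g x y = 0 \<longleftrightarrow> x = y" "dist_g x y = dist_g y x" "dist_g x z \<le> dist_g x y + dist_g y z" for x y z
    by (rule rdist_eq_0, rule rdist_sym, rule rdist_triangle)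
  show "\<exists>i. dist_g (q i) x \<le> e" if "0 < e" for x e using q that by blast
  show "{y. dist_g x y \<le> r} \<in> sets ?\<mu>" for x r using b[of x r] by (simp add: sets_vol_g)
  show "emeasure ?\<mu> {y. dist_g x y \<le> r} < \<infinity>" for x r using v[of x r] by (simp add: ennreal_mult_less_top)
  show "emeasure ?\<mu> {y. dist_g x y \<le> r} = emeasure ?\<mu> {y. dist_g x' y \<le> r}" for x r x' using h[of x r x'] by simp
  show "emeasure ?\<mu> {x} = 0" for x by (simp add: rvol_singleton[OF atlas metric])
qed

end

theorem proposition32:
  fixes A :: "('m::{t2_space, second_countable_topology}, 'n::finite) chart set"
    and g :: "('m, 'n) metric_field"
    and \<delta> t :: real
    and P :: "'w measure"
    and \<nu> :: "'w \<Rightarrow> 'm measure"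
    and E :: "nat \<Rightarrow> 'm set"
    and k :: nat
    and x0 :: 'm
  assumes "smooth_atlas A"
    and "riemannian_metric A g"
    and "connected (UNIV :: 'm set)"
    and "homogeneous A g"
    and "emeasure (rvol A g) UNIV = \<infinity>"
    and "\<delta> > 0" and "t > 0"
    and "prob_space P"
    and "poisson_process P (scale_measure (ennreal \<delta>) (rvol A g)) \<nu>"
    and "\<And>n. E n \<in> sets borel"
    and "\<And>n. emeasure (rvol A g) (E n) < \<infinity>"
    and "incseq E" and "(\<Union>n. E n) = UNIV"
  defines "V \<equiv> measure (rvol A g) (rcball A g x0 t)"
  defines "p \<equiv> \<lambda>n \<omega>. p_hat (rdist A g) t (\<nu> \<omega>) (E n) k"
  shows "tendsto_in_prob (completion P) p (\<lambda>_. exp (- \<delta> * V) * (\<delta> * V) ^ k / fact k) \<and>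
    ((\<Sum>n. 1 / emeasure (rvol A g) (E n)) < \<infinity> \<longrightarrow>
       (AE \<omega> in P. (\<lambda>n. p n \<omega>) \<longlonglongrightarrow> exp (- \<delta> * V) * (\<delta> * V) ^ k / fact k))"
proof -
  interpret M: homogeneous_riemannian_manifold A g
    using assms(1-4) by (simp add: homogeneous_riemannian_manifold_def connected_riemannian_manifold_def
        homogeneous_riemannian_manifold_axioms_def)
  from M.ex_dense_sequence obtain q :: "nat \<Rightarrow> 'm" where
    q: "\<forall>x e. 0 < e \<longrightarrow> (\<exists>i. rdist A g (q i) x \<le> e)" ..
  let ?\<mu> = "scale_measure (ennreal \<delta>) (rvol A g)"
  interpret homogeneous_poisson ?\<mu> "rdist A g" q P \<nu>
    using M.homogeneous_metric_measure_scaled[OF q] assms(8,9)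
    by (simp add: homogeneous_poisson_def homogeneous_poisson_axioms_def)
  have "emeasure ?\<mu> (rcball A g x0 t) = ennreal (\<delta> * V)"
    using M.volume_gball_finite[of x0 t] assms(6)
    by (simp add: V_def emeasure_eq_ennreal_measure ennreal_mult')
  moreover have "emeasure ?\<mu> (rcball A g x0 t) = ennreal (vol t)"
    using emeasure_cb[of x0 t] by (simp add: cb_def rcball_def)
  ultimately have "ennreal (vol t) = ennreal (\<delta> * V)" by simp
  then have vol: "vol t = \<delta> * V"
    using vol_nonneg[of t] assms(6) by (simp add: V_def ennreal_inj)
  have E_sets: "E n \<in> sets ?\<mu>" for n using assms(10) by (simp add: M.sets_vol_g)
  have E_fin: "emeasure ?\<mu> (E n) < \<infinity>" for n using assms(11)[of n] by (simp add: ennreal_mult_less_top)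
  have inf: "emeasure ?\<mu> UNIV = \<infinity>" using assms(5,6) by (simp add: ennreal_mult_top)
  have lim: "exp (- \<delta> * V) * (\<delta> * V) ^ k / fact k = poisson_weight (vol t) k"
    by (simp add: poisson_weight_def vol)
  note main = degree_frequencies[OF E_sets E_fin assms(12,13) inf less_imp_le[OF assms(7)], of k]
  have summ: "(\<Sum>n. 1 / emeasure ?\<mu> (E n)) < \<infinity>" if *: "(\<Sum>n. 1 / emeasure (rvol A g) (E n)) < \<infinity>"
  proof -
    have "1 / emeasure ?\<mu> (E n) = ennreal (1 / \<delta>) * (1 / emeasure (rvol A g) (E n))" for n
      using assms(6) assms(11)[of n]
      by (simp add: divide_ennreal_def ennreal_inverse_mult inverse_ennreal[symmetric] inverse_eq_divide[symmetric])
    then have "(\<Sum>n. 1 / emeasure ?\<mu> (E n)) = ennreal (1 / \<delta>) * (\<Sum>n. 1 / emeasure (rvol A g) (E n))"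
      by (simp only: ennreal_suminf_cmult)
    then show ?thesis using * by (simp add: ennreal_mult_less_top)
  qed
  show ?thesis unfolding lim p_def using main(1) main(2)[OF summ] by blast
qed

end
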